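(* Let $M$ be an oriented Riemannian manifold of dimension $n+1$, let $f:N\to M$ be a compact isometrically immersed oriented submanifold of dimension $n$, and let $\hat f:N\to S_1M$ be its lift by the unit normal. Then, for $0\le i\le n$, $$ \hat f^*\alpha_i=(-1)^i\,e_i(A)\,\mathrm{vol}_N, $$ where $e_i(A)$ is the elementary symmetric polynomial of degree $i$ in the eigenvalues $\lambda_1,\dots,\lambda_n$ of the second fundamental form $A$ of $N$, and $\alpha_i$ are the natural $n$-forms on the unit tangent sphere bundle $S_1M$ (defined in the context).
   Context: Let $(M,g=\langle\,,\rangle)$ be an oriented Riemannian manifold of dimension $n+1$ with Levi-Civita connection $\nabla$ and let $\pi:TM\to M$ be the tangent bundle. The connection gives a splitting $TTM=H\oplus V$, with $V=\ker d\pi\simeq\pi^*TM$ (vertical) and $H\simeq\pi^*TM$ via $d\pi$ (horizontal). The mirror map $B:TTM\to TTM$ is the endomorphism sending $H$ to $V$ by the identification $H\simeq\pi^*TM\simeq V$ and vanishing on $V$. $\xi$ is the canonical vertical vector field on $TM$, $\xi_u=u$. Let $S_1M=\{u\in TM:\|u\|=1\}$. Let $\pi^{-1}\mathrm{vol}_M$ denote the vertical pullback of the volume form: the $(n+1)$-form on $TM$ which vanishes when contracted with a horizontal vector and equals $\mathrm{vol}_M$ on $V\simeq\pi^*TM$. Define $\alpha_n=\frac{\xi}{\|\xi\|}\lrcorner\,\pi^{-1}\mathrm{vol}_M$ and, for $0\le i\le n$, the $n$-form $\alpha_i$ on $S_1M$ by $$\alpha_i(v_1,\dots,v_n)=\frac{1}{i!(n-i)!}\sum_{\sigma\in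 S_n}\mathrm{sg}(\sigma)\,\alpha_n(Bv_{\sigma_1},\dots,Bv_{\sigma_{n-i}},v_{\sigma_{n-i+1}},\dots,v_{\sigma_n}).$$ $\vec n$ is the unit normal of $N$ in $M$ determined by the orientations (if $e_1,\dots,e_n$ is a direct orthonormal frame of $N$, then $\vec n,e_1,\dots,e_n$ is direct in $M$). The lift is $\hat f(x)=\vec n_{f(x)}\in S_1M$. The second fundamental form is the symmetric endomorphism $A=-\nabla\vec n:TN\to TN$. $\mathrm{vol}_N$ is the Riemannian volume form of $N$. *)

theory Defs
  imports "HOL-Analysis.Analysis" "HOL-Combinatorics.Permutations"
begin

section \<open>Smooth manifolds\<close>

text \<open>A chart is a domain together with a coordinate map into a Euclidean model space; a manifold
  is given by a smooth atlas, and its topology is the one induced by the atlas.\<close>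

type_synonym ('a, 'e) chart = "'a set \<times> ('a \<Rightarrow> 'e)"

abbreviation cdom :: "('a, 'e) chart \<Rightarrow> 'a set" where "cdom \<equiv> fst"

abbreviation cmap :: "('a, 'e) chart \<Rightarrow> 'a \<Rightarrow> 'e" where "cmap \<equiv> snd"

definition cinv :: "('a, 'e) chart \<Rightarrow> 'e \<Rightarrow> 'a" where
  "cinv c = inv_into (cdom c) (cmap c)"

definition carrier :: "('a, 'e) chart set \<Rightarrow> 'a set" where
  "carrier A = (\<Union>c\<in>A. cdom c)"

primrec Ck_on ::
  "nat \<Rightarrow> 'e set \<Rightarrow> ('e::real_normed_vector \<Rightarrow> 'f::real_normed_vector) \<Rightarrow> bool" where
  "Ck_on 0 S = (\<lambda>F. continuous_on S F)"
| "Ck_on (Suc k) S = (\<lambda>F. (\<forall>x\<in>S. F differentiable (at x)) \<and>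
     (\<forall>v. Ck_on k S (\<lambda>x. frechet_derivative F (at x) v)))"

text \<open>Only used for open \<open>S\<close> in a finite-dimensional space, where directional derivatives suffice.\<close>

definition smooth_on ::
  "'e set \<Rightarrow> ('e::real_normed_vector \<Rightarrow> 'f::real_normed_vector) \<Rightarrow> bool" where
  "smooth_on S F \<longleftrightarrow> (\<forall>k. Ck_on k S F)"

definition smooth_atlas :: "('a, 'e::euclidean_space) chart set \<Rightarrow> bool" where
  "smooth_atlas A \<longleftrightarrow>
     (\<forall>c\<in>A. inj_on (cmap c) (cdom c) \<and> open (cmap c ` cdom c)) \<and>
     (\<forall>c\<in>A. \<forall>d\<in>A. open (cmap c ` (cdom c \<inter> cdom d)) \<and>
        smooth_on (cmap c ` (cdom c \<inter> cdom d)) (cmap d \<circ> cinv c))"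

definition mtopology :: "('a, 'e::euclidean_space) chart set \<Rightarrow> 'a topology" where
  "mtopology A =
     topology (\<lambda>U. U \<subseteq> carrier A \<and> (\<forall>c\<in>A. open (cmap c ` (U \<inter> cdom c))))"

definition smooth_manifold :: "('a, 'e::euclidean_space) chart set \<Rightarrow> bool" where
  "smooth_manifold A \<longleftrightarrow>
     smooth_atlas A \<and> Hausdorff_space (mtopology A) \<and> second_countable (mtopology A)"

definition smooth_map ::
  "('a, 'e::euclidean_space) chart set \<Rightarrow> ('b, 'f::euclidean_space) chart set \<Rightarrow> ('a \<Rightarrow> 'b) \<Rightarrow> bool"
where
  "smooth_map A A' F \<longleftrightarrow>
     F ` carrier A \<subseteq> carrier A' \<and>
     (\<forall>c\<in>A. \<forall>d\<in>A'. open (cmap c ` (cdom c \<inter> F -` cdom d)) \<and>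
        smooth_on (cmap c ` (cdom c \<inter> F -` cdom d)) (cmap d \<circ> F \<circ> cinv c))"

text \<open>The atlas \<open>A\<close> is an oriented atlas, i.e. it is itself the orientation: its charts are the
  direct ones.\<close>

definition oriented_atlas :: "('a, real ^ 'k::finite) chart set \<Rightarrow> bool" where
  "oriented_atlas A \<longleftrightarrow> (\<forall>c\<in>A. \<forall>d\<in>A. \<forall>p\<in>cdom c \<inter> cdom d.
     0 < det (matrix (frechet_derivative (cmap d \<circ> cinv c) (at (cmap c p)))))"

text \<open>An arbitrary chart around a point. Everything below that is written with it is independent
  of the choice.\<close>

definition chart_at :: "('a, 'e) chart set \<Rightarrow> 'a \<Rightarrow> ('a, 'e) chart" where
  "chart_at A p = (SOME c. c \<in> A \<and> p \<in> cdom c)"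


section \<open>Tangent vectors\<close>

text \<open>A tangent vector is a base point together with its components in all charts around that
  point, related by the differentials of the transition maps. Components at all other charts are
  set to 0, so that tangent vectors are equal as soon as they have the same components.\<close>

type_synonym ('a, 'e) tvec = "'a \<times> (('a, 'e) chart \<Rightarrow> 'e)"

definition tangent_bundle :: "('a, 'e::euclidean_space) chart set \<Rightarrow> ('a, 'e) tvec set" where
  "tangent_bundle A = {(p, v). p \<in> carrier A \<and>
     (\<forall>c. \<not> (c \<in> A \<and> p \<in> cdom c) \<longrightarrow> v c = 0) \<and>
     (\<forall>c\<in>A. \<forall>d\<in>A. p \<in> cdom c \<inter> cdom d \<longrightarrow>
        v d = frechet_derivative (cmap d \<circ> cinv c) (at (cmap c p)) (v c))}"

definition tspace :: "('a, 'e::euclidean_space) chart set \<Rightarrow> 'a \<Rightarrow> ('a, 'e) tvec set" where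
  "tspace A p = {v \<in> tangent_bundle A. fst v = p}"

text \<open>The tangent vector at \<open>p\<close> whose component in the chart \<open>c\<close> is \<open>z\<close>.\<close>

definition mk_tvec ::
  "('a, 'e::euclidean_space) chart set \<Rightarrow> 'a \<Rightarrow> ('a, 'e) chart \<Rightarrow> 'e \<Rightarrow> ('a, 'e) tvec" where
  "mk_tvec A p c z = (p, \<lambda>d. if d \<in> A \<and> p \<in> cdom d
     then frechet_derivative (cmap d \<circ> cinv c) (at (cmap c p)) z else 0)"

definition tscale :: "real \<Rightarrow> ('a, 'e::euclidean_space) tvec \<Rightarrow> ('a, 'e) tvec" where
  "tscale r v = (fst v, \<lambda>c. r *\<^sub>R snd v c)"

definition tmap ::
  "('a, 'e::euclidean_space) chart set \<Rightarrow> ('b, 'f::euclidean_space) chart set \<Rightarrow> ('a \<Rightarrow> 'b) \<Rightarrow>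
   ('a, 'e) tvec \<Rightarrow> ('b, 'f) tvec" where
  "tmap A A' F v = (let x = fst v; c = chart_at A x; d = chart_at A' (F x) in
     mk_tvec A' (F x) d (frechet_derivative (cmap d \<circ> F \<circ> cinv c) (at (cmap c x)) (snd v c)))"

text \<open>The manifold structure of \<open>TM\<close>; its projection onto \<open>M\<close> is \<open>fst\<close>.\<close>

definition tchart ::
  "('a, 'e::euclidean_space) chart set \<Rightarrow> ('a, 'e) chart \<Rightarrow> (('a, 'e) tvec, 'e \<times> 'e) chart" where
  "tchart A c = ({u \<in> tangent_bundle A. fst u \<in> cdom c}, \<lambda>u. (cmap c (fst u), snd u c))"

definition tangent_atlas ::
  "('a, 'e::euclidean_space) chart set \<Rightarrow> (('a, 'e) tvec, 'e \<times> 'e) chart set" where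
  "tangent_atlas A = tchart A ` A"


section \<open>Riemannian metrics, volume forms and the Levi-Civita connection\<close>

type_synonym ('a, 'e) metric = "('a, 'e) tvec \<Rightarrow> ('a, 'e) tvec \<Rightarrow> real"

definition local_metric ::
  "('a, 'e::euclidean_space) chart set \<Rightarrow> ('a, 'e) metric \<Rightarrow> ('a, 'e) chart \<Rightarrow> 'e \<Rightarrow> 'e \<Rightarrow> 'e \<Rightarrow> real"
where
  "local_metric A g c y a b = g (mk_tvec A (cinv c y) c a) (mk_tvec A (cinv c y) c b)"

definition riemannian_metric ::
  "('a, 'e::euclidean_space) chart set \<Rightarrow> ('a, 'e) metric \<Rightarrow> bool" where
  "riemannian_metric A g \<longleftrightarrow> (\<forall>c\<in>A.
     (\<forall>y\<in>cmap c ` cdom c.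
        bilinear (local_metric A g c y) \<and>
        (\<forall>a b. local_metric A g c y a b = local_metric A g c y b a) \<and>
        (\<forall>a. a \<noteq> 0 \<longrightarrow> 0 < local_metric A g c y a a)) \<and>
     (\<forall>a b. smooth_on (cmap c ` cdom c) (\<lambda>y. local_metric A g c y a b)))"

definition oriented_riemannian_manifold ::
  "('a, real ^ 'k::finite) chart set \<Rightarrow> ('a, real ^ 'k) metric \<Rightarrow> bool" where
  "oriented_riemannian_manifold A g \<longleftrightarrow>
     smooth_manifold A \<and> oriented_atlas A \<and> riemannian_metric A g"

text \<open>The matrix of components of a \<open>'k\<close>-indexed family of vectors, the index of the vector being
  the column index.\<close>

definition comp_matrix ::
  "('a, real ^ 'k::finite) chart \<Rightarrow> ('k \<Rightarrow> ('a, real ^ 'k) tvec) \<Rightarrow> real ^ 'k ^ 'k" where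
  "comp_matrix c v = (\<chi> i j. snd (v j) c $ i)"

definition frame ::
  "('a, real ^ 'k::finite) chart set \<Rightarrow> 'a \<Rightarrow> ('k \<Rightarrow> ('a, real ^ 'k) tvec) \<Rightarrow> bool" where
  "frame A p v \<longleftrightarrow> (\<forall>j. v j \<in> tspace A p) \<and>
     (\<forall>c\<in>A. p \<in> cdom c \<longrightarrow> det (comp_matrix c v) \<noteq> 0)"

definition direct_orthonormal_frame ::
  "('a, real ^ 'k::finite) chart set \<Rightarrow> ('a, real ^ 'k) metric \<Rightarrow> 'a \<Rightarrow>
   ('k \<Rightarrow> ('a, real ^ 'k) tvec) \<Rightarrow> bool" where
  "direct_orthonormal_frame A g p v \<longleftrightarrow> (\<forall>j. v j \<in> tspace A p) \<and>
     (\<forall>c\<in>A. p \<in> cdom c \<longrightarrow> 0 < det (comp_matrix c v)) \<and>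
     (\<forall>i j. g (v i) (v j) = (if i = j then 1 else 0))"

text \<open>In a direct chart, \<open>vol = sqrt (det (g\<^sub>i\<^sub>j)) dx\<^sup>1 \<and> \<dots> \<and> dx\<^sup>k\<close>.\<close>

definition vol ::
  "('a, real ^ 'k::finite) chart set \<Rightarrow> ('a, real ^ 'k) metric \<Rightarrow> 'a \<Rightarrow>
   ('k \<Rightarrow> ('a, real ^ 'k) tvec) \<Rightarrow> real" where
  "vol A g p v = (let c = chart_at A p in
     sqrt (det (\<chi> i j. local_metric A g c (cmap c p) (axis i 1) (axis j 1))) *
     det (comp_matrix c v))"

text \<open>In a chart a connection is \<open>\<nabla>\<^sub>X Y = dY(X) + \<Gamma>(X, Y)\<close>; the Levi-Civita connection is
  the one which is torsion-free (\<open>\<Gamma>\<close> symmetric) and for which the metric is parallel. The latter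
  is written for fields \<open>b\<close>, \<open>e\<close> with constant components in the chart, where
  \<open>\<nabla>\<^sub>a b = \<Gamma>(a, b)\<close>.\<close>

definition levi_civita ::
  "('a, 'e::euclidean_space) chart set \<Rightarrow> ('a, 'e) metric \<Rightarrow> ('a, 'e) chart \<Rightarrow> 'e \<Rightarrow> 'e \<Rightarrow> 'e \<Rightarrow> 'e"
where
  "levi_civita A g c y = (THE \<Gamma>. bilinear \<Gamma> \<and> (\<forall>a b. \<Gamma> a b = \<Gamma> b a) \<and>
     (\<forall>a b e. frechet_derivative (\<lambda>z. local_metric A g c z b e) (at y) a =
        local_metric A g c y (\<Gamma> a b) e + local_metric A g c y b (\<Gamma> a e)))"


section \<open>Geometry of the tangent bundle\<close>

text \<open>The connection map \<open>K : TTM \<rightarrow> TM\<close>, defined by \<open>K(dX(v)) = \<nabla>\<^sub>v X\<close>. The horizontal space at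
  \<open>u\<close> is its kernel in \<open>T\<^sub>u TM\<close>, and on the vertical space it is the identification
  \<open>V \<simeq> \<pi>\<^sup>*TM\<close>; so \<open>K\<close> is the projection onto \<open>V\<close> along \<open>H\<close> followed by that
  identification.\<close>

definition connection_map ::
  "('a, 'e::euclidean_space) chart set \<Rightarrow> ('a, 'e) metric \<Rightarrow> (('a, 'e) tvec, 'e \<times> 'e) tvec \<Rightarrow>
   ('a, 'e) tvec" where
  "connection_map A g w = (let u = fst w; p = fst u; c = chart_at A p; z = snd w (tchart A c) in
     mk_tvec A p c (snd z + levi_civita A g c (cmap c p) (fst z) (snd u c)))"

text \<open>The identification of \<open>T\<^sub>p M\<close> with the vertical space at \<open>u \<in> T\<^sub>p M\<close>.\<close>

definition vertical_lift ::
  "('a, 'e::euclidean_space) chart set \<Rightarrow> ('a, 'e) tvec \<Rightarrow> ('a, 'e) tvec \<Rightarrow>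
   (('a, 'e) tvec, 'e \<times> 'e) tvec" where
  "vertical_lift A u z = (let c = chart_at A (fst u) in
     mk_tvec (tangent_atlas A) u (tchart A c) (0, snd z c))"

text \<open>\<open>d\<pi>\<close> vanishes on \<open>V\<close> and is the identification \<open>H \<simeq> \<pi>\<^sup>*TM\<close> on \<open>H\<close>, so this is the
  mirror map \<open>B\<close>.\<close>

definition mirror ::
  "('a, 'e::euclidean_space) chart set \<Rightarrow> (('a, 'e) tvec, 'e \<times> 'e) tvec \<Rightarrow>
   (('a, 'e) tvec, 'e \<times> 'e) tvec" where
  "mirror A w = vertical_lift A (fst w) (tmap (tangent_atlas A) A fst w)"

definition canonical_field ::
  "('a, 'e::euclidean_space) chart set \<Rightarrow> ('a, 'e) tvec \<Rightarrow> (('a, 'e) tvec, 'e \<times> 'e) tvec" where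
  "canonical_field A u = vertical_lift A u u"

definition vertical_vol ::
  "('a, real ^ 'k::finite) chart set \<Rightarrow> ('a, real ^ 'k) metric \<Rightarrow> ('a, real ^ 'k) tvec \<Rightarrow>
   ('k \<Rightarrow> (('a, real ^ 'k) tvec, (real ^ 'k) \<times> (real ^ 'k)) tvec) \<Rightarrow> real" where
  "vertical_vol A g u w = vol A g (fst u) (\<lambda>j. connection_map A g (w j))"

text \<open>From here on \<open>n\<close> is \<open>CARD('n)\<close> and \<open>M\<close> is modelled on \<open>real ^ ('n option)\<close>, which has
  dimension \<open>n + 1\<close>. The index \<open>None\<close> is the first slot of an \<open>(n+1)\<close>-form and of a frame, so
  that \<open>case_option w v\<close> is the family \<open>w, v\<^sub>1, \<dots>, v\<^sub>n\<close>. Contracting with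
  \<open>\<xi>\<^sub>u/\<parallel>\<xi>\<^sub>u\<parallel>\<close> therefore fills the slot \<open>None\<close>; \<open>\<parallel>\<xi>\<^sub>u\<parallel>\<close> is the norm of \<open>u\<close>, by
  \<open>V \<simeq> \<pi>\<^sup>*TM\<close>.\<close>

definition alpha_top ::
  "('a, real ^ ('n::finite option)) chart set \<Rightarrow> ('a, real ^ ('n option)) metric \<Rightarrow>
   ('a, real ^ ('n option)) tvec \<Rightarrow>
   ('n \<Rightarrow> (('a, real ^ ('n option)) tvec, (real ^ ('n option)) \<times> (real ^ ('n option))) tvec) \<Rightarrow>
   real" where
  "alpha_top M g u w =
     vertical_vol M g u (case_option (tscale (1 / sqrt (g u u)) (canonical_field M u)) w)"

text \<open>The order of \<open>'n\<close> is used only to number the slots: the slot \<open>j\<close> is among the first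
  \<open>n - i\<close> iff fewer than \<open>n - i\<close> slots precede it. The form on the unit sphere bundle is the
  restriction of this one to unit \<open>u\<close> and to vectors tangent to that bundle.\<close>

definition alpha ::
  "('a, real ^ ('n::{finite,linorder} option)) chart set \<Rightarrow> ('a, real ^ ('n option)) metric \<Rightarrow>
   nat \<Rightarrow> ('a, real ^ ('n option)) tvec \<Rightarrow>
   ('n \<Rightarrow> (('a, real ^ ('n option)) tvec, (real ^ ('n option)) \<times> (real ^ ('n option))) tvec) \<Rightarrow>
   real" where
  "alpha M g i u v = 1 / (fact i * fact (CARD('n) - i)) *
     (\<Sum>\<sigma> | \<sigma> permutes (UNIV :: 'n set). of_int (sign \<sigma>) *
        alpha_top M g u (\<lambda>j. if card {k. k < j} < CARD('n) - i
          then mirror M (v (\<sigma> j)) else v (\<sigma> j)))"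

definition pullback ::
  "('a, 'e::euclidean_space) chart set \<Rightarrow> ('b, 'f::euclidean_space) chart set \<Rightarrow> ('a \<Rightarrow> 'b) \<Rightarrow>
   ('b \<Rightarrow> ('k \<Rightarrow> ('b, 'f) tvec) \<Rightarrow> real) \<Rightarrow> 'a \<Rightarrow> ('k \<Rightarrow> ('a, 'e) tvec) \<Rightarrow> real" where
  "pullback A A' F \<omega> x v = \<omega> (F x) (\<lambda>j. tmap A A' F (v j))"


section \<open>Immersed hypersurfaces\<close>

text \<open>Such a map is an immersion because \<open>h\<close> is positive definite.\<close>

definition isometric_immersion ::
  "('b, 'e::euclidean_space) chart set \<Rightarrow> ('b, 'e) metric \<Rightarrow>
   ('a, 'f::euclidean_space) chart set \<Rightarrow> ('a, 'f) metric \<Rightarrow> ('b \<Rightarrow> 'a) \<Rightarrow> bool" where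
  "isometric_immersion N h M g f \<longleftrightarrow> smooth_map N M f \<and>
     (\<forall>x\<in>carrier N. \<forall>v\<in>tspace N x. \<forall>w\<in>tspace N x. g (tmap N M f v) (tmap N M f w) = h v w)"

text \<open>The unit normal determined by the orientations, as a map into \<open>TM\<close>: the lift of \<open>f\<close>.\<close>

definition unit_normal_lift ::
  "('b, real ^ 'n::finite) chart set \<Rightarrow> ('b, real ^ 'n) metric \<Rightarrow>
   ('a, real ^ ('n option)) chart set \<Rightarrow> ('a, real ^ ('n option)) metric \<Rightarrow> ('b \<Rightarrow> 'a) \<Rightarrow>
   'b \<Rightarrow> ('a, real ^ ('n option)) tvec" where
  "unit_normal_lift N h M g f x = (THE w. w \<in> tspace M (f x) \<and> g w w = 1 \<and>
     (\<forall>v\<in>tspace N x. g w (tmap N M f v) = 0) \<and>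
     (\<forall>e. direct_orthonormal_frame N h x e \<longrightarrow>
        direct_orthonormal_frame M g (f x) (case_option w (\<lambda>j. tmap N M f (e j)))))"

text \<open>\<open>A v = - \<nabla>\<^sub>v \<nu>\<close> for the unit normal \<open>\<nu>\<close>, where \<open>TN\<close> is identified with its image
  under \<open>df\<close>.\<close>

definition second_fundamental_form ::
  "('b, real ^ 'n::finite) chart set \<Rightarrow> ('b, real ^ 'n) metric \<Rightarrow>
   ('a, real ^ ('n option)) chart set \<Rightarrow> ('a, real ^ ('n option)) metric \<Rightarrow> ('b \<Rightarrow> 'a) \<Rightarrow>
   ('b, real ^ 'n) tvec \<Rightarrow> ('b, real ^ 'n) tvec" where
  "second_fundamental_form N h M g f v = (THE a. a \<in> tspace N (fst v) \<and>
     tmap N M f a = tscale (-1)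
       (connection_map M g (tmap N (tangent_atlas M) (unit_normal_lift N h M g f) v)))"

text \<open>The eigenvalues of a diagonalizable endomorphism of \<open>T\<^sub>p\<close>, listed with multiplicity.\<close>

definition eigenvalue_list ::
  "('a, real ^ 'k::finite) chart set \<Rightarrow> 'a \<Rightarrow>
   (('a, real ^ 'k) tvec \<Rightarrow> ('a, real ^ 'k) tvec) \<Rightarrow> ('k \<Rightarrow> real) \<Rightarrow> bool" where
  "eigenvalue_list A p L l \<longleftrightarrow> (\<exists>b. frame A p b \<and> (\<forall>j. L (b j) = tscale (l j) (b j)))"

definition elem_sym :: "nat \<Rightarrow> ('k::finite \<Rightarrow> real) \<Rightarrow> real" where
  "elem_sym i l = (\<Sum>I | I \<subseteq> UNIV \<and> card I = i. \<Prod>j\<in>I. l j)"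

definition elem_sym_eigenvalues ::
  "('a, real ^ 'k::finite) chart set \<Rightarrow> 'a \<Rightarrow>
   (('a, real ^ 'k) tvec \<Rightarrow> ('a, real ^ 'k) tvec) \<Rightarrow> nat \<Rightarrow> real" where
  "elem_sym_eigenvalues A p L i = elem_sym i (SOME l. eigenvalue_list A p L l)"

end

theory Submission
  imports Defs
begin

text \<open>
  Everything happens at one point \<open>x\<close> of \<open>N\<close>. Let \<open>T\<close> be the differential of \<open>f\<close> at \<open>x\<close>, \<open>w\<close> the unit
  normal at \<open>f x\<close> and \<open>L\<close> the second fundamental form. The differential of the lift sends a tangent
  vector \<open>a\<close> to the vector of \<open>TTM\<close> whose horizontal part is \<open>T a\<close> and whose vertical part is the
  covariant derivative of the normal, that is \<open>- T (L a)\<close>. The mirror map replaces this vector by the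
  vertical vector \<open>T a\<close>. As the top form is the volume form of \<open>M\<close> on vertical parts, contracted with
  \<open>w\<close>, the pullback of the \<open>i\<close>-th form evaluated at \<open>v\<close> is, up to the factor \<open>i! (n - i)!\<close>, the
  alternating sum over \<open>\<sigma>\<close> of the numbers \<open>vol\<^sub>M (w, T v\<^sub>\<sigma>\<^sub>1, \<dots>, - T (L v\<^sub>\<sigma>\<^sub>n))\<close> in which the last
  \<open>i\<close> slots carry \<open>- L\<close>. Two facts of linear algebra finish the computation.

  \<^item> \<open>vol\<^sub>M (w, T a\<^sub>1, \<dots>, T a\<^sub>n) = vol\<^sub>N (a\<^sub>1, \<dots>, a\<^sub>n)\<close>: both sides are a constant times
    the determinant of the components of the \<open>a\<^sub>j\<close> (\<open>det_normal_column\<close>), and both equal 1 on a direct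
    orthonormal frame (\<open>vol_normal_frame\<close>).
  \<^item> If \<open>L\<close> has an eigenbasis, the alternating sum is \<open>i! (n - i)! e\<^sub>i (- L)\<close> times the
    determinant (\<open>sum_sign_det_mixed_eigenbasis\<close>): in the eigenbasis the Leibniz formula turns the
    inserted eigenvalues into the sum, over all permutations \<open>p\<close>, of the product of the eigenvalues with
    index in the image under \<open>p\<close> of the last \<open>i\<close> slots; each set of \<open>i\<close> indices is this image for
    exactly \<open>i! (n - i)!\<close> permutations.

  Two points need analysis. The lift is given pointwise by its defining properties, so its
  differentiability has to be established: the unit normal is the normalized gradient, for the metric,
  of the function that sends \<open>z\<close> to the determinant of \<open>z, T e\<^sub>1, \<dots>, T e\<^sub>n\<close>, and Cramer's rule makes it
  a differentiable function of the coefficients of the metric and of \<open>T\<close>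
  (\<open>differentiable_unit_normal\<close>). And the eigenbasis exists because \<open>L\<close> is symmetric. This follows by
  differentiating the two identities which say that the normal has length 1 and is orthogonal to the
  image of \<open>T\<close>; what remains is symmetric because second derivatives are symmetric and the connection
  is torsion-free (\<open>covariant_derivative_of_unit_normal\<close>).
\<close>

section \<open>Determinants of families with a normal column\<close>

definition colmat :: "('k \<Rightarrow> real ^ 'k) \<Rightarrow> real ^ 'k ^ 'k::finite" where
  "colmat u = (\<chi> i j. u j $ i)"

lemma colmat_nth [simp]: "colmat u $ i $ j = u j $ i"
  by (simp add: colmat_def)

lemma matrix_mul_colmat: "A ** colmat u = colmat (\<lambda>j. A *v u j)"
  by (simp add: vec_eq_iff matrix_matrix_mult_def matrix_vector_mult_def)

lemma colmat_mult_vec: "colmat u *v a = (\<Sum>j\<in>UNIV. a $ j *\<^sub>R u j)"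
  by (simp add: vec_eq_iff matrix_vector_mult_def mult.commute)

lemma det_colmat_linear:
  assumes "linear T"
  shows "det (colmat (\<lambda>j. T (u j))) = det (matrix T) * det (colmat u)"
proof -
  have "colmat (\<lambda>j. T (u j)) = matrix T ** colmat u"
    unfolding matrix_mul_colmat by (simp add: assms matrix_works)
  then show ?thesis by (simp add: det_mul)
qed

lemma det_colmat_sum:
  "det (colmat u) = (\<Sum>p | p permutes UNIV. of_int (sign p) * (\<Prod>j\<in>UNIV. u j $ p j))"
proof -
  have "det (colmat u) = det (transpose (colmat u))" by simp
  also have "\<dots> = (\<Sum>p | p permutes UNIV. of_int (sign p) * (\<Prod>j\<in>UNIV. u j $ p j))"
    by (simp add: det_def transpose_def)
  finally show ?thesis .
qed

text \<open>Needed to compare the Leibniz formulas of a matrix and of the matrix with one more row and column.\<close>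
lemma bij_betw_permutations_option:
  "bij_betw (map_permutation UNIV Some) {q. q permutes (UNIV :: 'n::finite set)}
     {p. p permutes (UNIV :: 'n option set) \<and> p None = None}"
proof -
  let ?R = "range (Some :: 'n \<Rightarrow> 'n option)"
  have "bij_betw (map_permutation UNIV Some) {q. q permutes (UNIV :: 'n set)} {p. p permutes ?R}"
    unfolding map_permutation_def restrict_id_def o_def
    by (rule bij_betw_permutations) (simp add: bij_betw_def)
  moreover have "p permutes ?R \<longleftrightarrow> p permutes (UNIV :: 'n option set) \<and> p None = None"
    for p :: "'n option \<Rightarrow> 'n option"
  proof
    assume "p permutes ?R"
    then show "p permutes UNIV \<and> p None = None"
      by (metis UNIV_I imageE option.distinct(1) permutes_not_in permutes_subset subset_UNIV)
  next
    assume a: "p permutes UNIV \<and> p None = None"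
    then show "p permutes ?R"
      using permutes_superset[of p UNIV ?R] by (metis DiffD2 notin_range_Some)
  qed
  ultimately show ?thesis by simp
qed

lemma det_option_block:
  fixes V :: "'n::finite \<Rightarrow> real ^ 'n"
  shows "det (colmat (case_option (axis None 1) (\<lambda>j. \<chi> r. case r of None \<Rightarrow> 0 | Some k \<Rightarrow> V j $ k)))
    = det (colmat V)" (is "det (colmat ?u) = _")
proof -
  let ?P = "{p. p permutes (UNIV :: 'n option set)}"
  let ?Q = "{p. p permutes (UNIV :: 'n option set) \<and> p None = None}"
  \<comment> \<open>The column \<open>None\<close> is a unit vector, so only permutations that fix \<open>None\<close> contribute.\<close>
  have "det (colmat ?u) = (\<Sum>p\<in>?P. of_int (sign p) * (\<Prod>j\<in>UNIV. ?u j $ p j))"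
    by (rule det_colmat_sum)
  also have "\<dots> = (\<Sum>p\<in>?Q. of_int (sign p) * (\<Prod>j\<in>UNIV. ?u j $ p j))"
  proof (rule sum.mono_neutral_right)
    show "finite ?P" by (simp add: finite_permutations)
    show "?Q \<subseteq> ?P" by auto
    show "\<forall>p\<in>?P - ?Q. of_int (sign p) * (\<Prod>j\<in>UNIV. ?u j $ p j) = 0"
    proof
      fix p assume "p \<in> ?P - ?Q"
      then have "?u None $ p None = 0" by (auto simp: axis_def)
      then have "(\<Prod>j\<in>UNIV. ?u j $ p j) = 0" by (meson UNIV_I finite prod_zero)
      then show "of_int (sign p) * (\<Prod>j\<in>UNIV. ?u j $ p j) = 0" by simp
    qed
  qed
  also have "\<dots> = (\<Sum>q | q permutes UNIV.
      of_int (sign (map_permutation UNIV Some q)) * (\<Prod>j\<in>UNIV. ?u j $ map_permutation UNIV Some q j))"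
    by (rule sum.reindex_bij_betw[OF bij_betw_permutations_option, symmetric])
  also have "\<dots> = (\<Sum>q | q permutes UNIV. of_int (sign q) * (\<Prod>j\<in>UNIV. V j $ q j))"
  proof (rule sum.cong[OF refl])
    fix q assume "q \<in> {q. q permutes (UNIV :: 'n set)}"
    then have q: "q permutes UNIV" by simp
    have n: "map_permutation UNIV Some q None = None"
      using bij_betw_apply[OF bij_betw_permutations_option, of q] q by simp
    have s: "map_permutation UNIV Some q (Some j) = Some (q j)" for j
      by (simp add: map_permutation_apply)
    have "(\<Prod>j\<in>UNIV. ?u j $ map_permutation UNIV Some q j) = (\<Prod>j\<in>UNIV. V j $ q j)"
      by (simp add: UNIV_option_conv prod.reindex n s axis_def)
    then show "of_int (sign (map_permutation UNIV Some q)) *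
        (\<Prod>j\<in>UNIV. ?u j $ map_permutation UNIV Some q j) = of_int (sign q) * (\<Prod>j\<in>UNIV. V j $ q j)"
      using q by (simp add: sign_map_permutation)
  qed
  also have "\<dots> = det (colmat V)" by (rule det_colmat_sum[symmetric])
  finally show ?thesis .
qed

text \<open>As a function of \<open>w\<close> this is the Euclidean covector that is normal to the image of \<open>T\<close>.\<close>
definition bordered_det :: "real ^ ('n::finite option) \<Rightarrow> (real ^ 'n \<Rightarrow> real ^ ('n option)) \<Rightarrow> real" where
  "bordered_det w T = det (colmat (case_option w (\<lambda>j. T (axis j 1))))"

lemma vec_expand_axis: "(a :: real ^ 'n::finite) = (\<Sum>j\<in>UNIV. a $ j *\<^sub>R axis j 1)"
  using basis_expansion[of a] by (simp add: scalar_mult_eq_scaleR)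

lemma linear_expand_axis:
  fixes a :: "real ^ 'n::finite"
  assumes "linear T"
  shows "T a = (\<Sum>j\<in>UNIV. a $ j *\<^sub>R T (axis j 1))"
proof -
  have "T a = T (\<Sum>j\<in>UNIV. a $ j *\<^sub>R axis j 1)" using vec_expand_axis by metis
  then show ?thesis by (simp add: linear_sum[OF assms] linear_cmul[OF assms])
qed

lemma sum_UNIV_option: "(\<Sum>r\<in>(UNIV :: 'n::finite option set). F r) = F None + (\<Sum>j\<in>UNIV. F (Some j))"
  by (simp add: UNIV_option_conv sum.reindex)

text \<open>The matrix of \<open>w, T V\<^sub>1, \<dots>, T V\<^sub>n\<close> is the matrix of \<open>w, T e\<^sub>1, \<dots>, T e\<^sub>n\<close> times the block matrix
  with blocks 1 and \<open>V\<close>.\<close>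
lemma det_normal_column:
  fixes V :: "'n::finite \<Rightarrow> real ^ 'n"
  assumes "linear T"
  shows "det (colmat (case_option w (\<lambda>j. T (V j)))) = bordered_det w T * det (colmat V)"
proof -
  let ?u = "case_option (axis None 1) (\<lambda>j. \<chi> r. case r of None \<Rightarrow> 0 | Some k \<Rightarrow> V j $ k)"
  let ?A = "colmat (case_option w (\<lambda>j. T (axis j 1)))"
  have "colmat (case_option w (\<lambda>j. T (V j))) = ?A ** colmat ?u"
    unfolding matrix_mul_colmat
  proof (rule arg_cong[where f = colmat], rule ext)
    fix r
    show "(case r of None \<Rightarrow> w | Some j \<Rightarrow> T (V j)) = ?A *v ?u r"
    proof (cases r)
      case None
      then show ?thesis by (simp add: colmat_mult_vec sum_UNIV_option axis_def)
    next
      case (Some j)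
      have "T (V j) = (\<Sum>k\<in>UNIV. V j $ k *\<^sub>R T (axis k 1))" by (rule linear_expand_axis[OF assms])
      with Some show ?thesis by (simp add: colmat_mult_vec sum_UNIV_option)
    qed
  qed
  then show ?thesis by (simp add: det_mul det_option_block bordered_det_def)
qed

section \<open>Alternating sums and elementary symmetric polynomials\<close>

text \<open>The number of predecessors is a bijection of a finite linear order onto an initial segment of the
  natural numbers.\<close>
lemma card_rank_less:
  fixes m :: nat
  assumes "m \<le> CARD('n::{finite,linorder})"
  shows "card {j :: 'n. card {k. k < j} < m} = m"
proof -
  let ?r = "\<lambda>j :: 'n. card {k. k < j}"
  have "strict_mono ?r"
    by (rule strict_monoI) (auto intro!: psubset_card_mono)
  then have inj: "inj ?r" by (rule strict_mono_imp_inj_on)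
  have sub: "?r ` UNIV \<subseteq> {..<CARD('n)}"
  proof
    fix y assume "y \<in> ?r ` UNIV"
    then obtain j where "y = ?r j" by auto
    moreover have "?r j < CARD('n)" by (rule psubset_card_mono) auto
    ultimately show "y \<in> {..<CARD('n)}" by simp
  qed
  have im: "?r ` UNIV = {..<CARD('n)}"
    by (rule card_subset_eq[OF _ sub]) (simp_all add: card_image[OF inj])
  have "?r ` {j. ?r j < m} = {..<m}"
  proof
    show "{..<m} \<subseteq> ?r ` {j. ?r j < m}"
    proof
      fix y assume y: "y \<in> {..<m}"
      then have "y \<in> ?r ` UNIV" unfolding im using assms by simp
      then show "y \<in> ?r ` {j. ?r j < m}" using y by auto
    qed
  qed auto
  moreover have "card (?r ` {j. ?r j < m}) = card {j. ?r j < m}"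
    by (rule card_image) (rule inj_on_subset[OF inj], simp)
  ultimately show ?thesis by simp
qed

text \<open>Fixing one permutation \<open>t\<close> that maps \<open>J\<close> onto \<open>I\<close>, all others are \<open>t\<close> after a permutation of \<open>J\<close>
  together with a permutation of its complement.\<close>
lemma card_permutations_mapping_set:
  fixes J I :: "'n::finite set"
  assumes "card I = card J"
  shows "card {p. p permutes (UNIV :: 'n set) \<and> p ` J = I} = fact (card J) * fact (CARD('n) - card J)"
proof -
  obtain e1 where e1: "bij_betw e1 J I"
    using assms by (metis finite finite_same_card_bij)
  have "card (- J) = card (- I)" using assms by (simp add: Compl_eq_Diff_UNIV card_Diff_subset)
  then obtain e2 where e2: "bij_betw e2 (- J) (- I)"
    by (metis finite finite_same_card_bij)
  define t where "t = (\<lambda>x. if x \<in> J then e1 x else e2 x)"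
  have t1: "bij_betw t J I" using e1 by (rule bij_betw_cong[THEN iffD1, rotated]) (simp add: t_def)
  have t2: "bij_betw t (- J) (- I)" using e2 by (rule bij_betw_cong[THEN iffD1, rotated]) (simp add: t_def)
  have "bij_betw t (J \<union> - J) (I \<union> - I)" by (rule bij_betw_combine[OF t1 t2]) simp
  then have t: "bij t" by simp
  let ?A = "{q. q permutes J}" and ?B = "{q. q permutes (- J)}"
  let ?S = "{p. p permutes (UNIV :: 'n set) \<and> p ` J = I}"
  let ?F = "\<lambda>(q, r). t \<circ> (\<lambda>x. if x \<in> J then q x else r x)"
  have "bij_betw ?F (?A \<times> ?B) ?S"
  proof (rule bij_betw_byWitness[where f' = "\<lambda>p. (\<lambda>x. if x \<in> J then inv t (p x) else x,
      \<lambda>x. if x \<in> J then x else inv t (p x))"])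
    have it: "inv t (t x) = x" "t (inv t x) = x" for x
      using t by (simp_all add: bij_def inv_f_f surj_f_inv_f)
    show "\<forall>a\<in>?A \<times> ?B. (\<lambda>x. if x \<in> J then inv t ((?F a) x) else x,
      \<lambda>x. if x \<in> J then x else inv t ((?F a) x)) = a"
      by (auto simp: fun_eq_iff it permutes_def)
    show "\<forall>p\<in>?S. ?F (\<lambda>x. if x \<in> J then inv t (p x) else x,
      \<lambda>x. if x \<in> J then x else inv t (p x)) = p"
      by (auto simp: fun_eq_iff it)
    show "?F ` (?A \<times> ?B) \<subseteq> ?S"
    proof clarify
      fix q r assume q: "q permutes J" and r: "r permutes (- J)"
      let ?c = "\<lambda>x. if x \<in> J then q x else r x"
      have c1: "bij_betw ?c J J"
        using permutes_imp_bij[OF q] by (rule bij_betw_cong[THEN iffD1, rotated]) simp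
      have c2: "bij_betw ?c (- J) (- J)"
        using permutes_imp_bij[OF r] by (rule bij_betw_cong[THEN iffD1, rotated]) simp
      have "bij_betw ?c (J \<union> - J) (J \<union> - J)" by (rule bij_betw_combine[OF c1 c2]) simp
      then have "bij ?c" by simp
      then have "bij (t \<circ> ?c)" using t by (rule bij_comp)
      moreover have "(t \<circ> ?c) ` J = I"
        using t1 c1 unfolding bij_betw_def image_comp[symmetric] by metis
      ultimately show "t \<circ> ?c permutes UNIV \<and> (t \<circ> ?c) ` J = I"
        by (metis UNIV_I bij_imp_permutes)
    qed
    show "(\<lambda>p. (\<lambda>x. if x \<in> J then inv t (p x) else x,
      \<lambda>x. if x \<in> J then x else inv t (p x))) ` ?S \<subseteq> ?A \<times> ?B"
    proof (rule image_subsetI)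
      fix p assume "p \<in> ?S"
      then have p: "p permutes (UNIV :: 'n set)" and I: "I = p ` J" by auto
      have bp: "bij p" using p by (simp add: permutes_bij)
      have p1: "bij_betw p J I" using bp I by (meson bij_betw_subset subset_UNIV)
      have "p ` (- J) = - I" using bp I by (simp add: bij_image_Compl_eq)
      then have p2: "bij_betw p (- J) (- I)" using bp by (metis bij_betw_subset subset_UNIV)
      have s1: "inv t ` I = J" using t1 by (metis bij_betw_def inv_f_f bij_is_inj t image_inv_f_f)
      have s2: "inv t ` (- I) = - J" using t2 by (metis bij_betw_def inv_f_f bij_is_inj t image_inv_f_f)
      have bi: "bij (inv t)" using t by (rule bij_imp_bij_inv)
      have i1: "bij_betw (inv t) I J" using bi s1 by (meson bij_betw_subset subset_UNIV)
      have i2: "bij_betw (inv t) (- I) (- J)" using bi s2 by (metis bij_betw_subset subset_UNIV)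
      have a: "bij_betw (\<lambda>x. if x \<in> J then inv t (p x) else x) J J"
        using bij_betw_trans[OF p1 i1] by (rule bij_betw_cong[THEN iffD1, rotated]) simp
      have b: "bij_betw (\<lambda>x. if x \<in> J then x else inv t (p x)) (- J) (- J)"
        using bij_betw_trans[OF p2 i2] by (rule bij_betw_cong[THEN iffD1, rotated]) simp
      show "(\<lambda>x. if x \<in> J then inv t (p x) else x,
        \<lambda>x. if x \<in> J then x else inv t (p x)) \<in> ?A \<times> ?B"
        using bij_imp_permutes[OF a] bij_imp_permutes[OF b] by auto
    qed
  qed
  then have "card ?S = card (?A \<times> ?B)" by (simp add: bij_betw_same_card)
  also have "\<dots> = fact (card J) * fact (CARD('n) - card J)"
    by (simp add: card_cartesian_product card_permutations Compl_eq_Diff_UNIV card_Diff_subset)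
  finally show ?thesis .
qed

text \<open>The product only depends on the image of \<open>J\<close>, so the permutations are grouped by this image.\<close>
lemma sum_permutations_prod_image:
  fixes J :: "'n::finite set" and l :: "'n \<Rightarrow> real"
  shows "(\<Sum>p | p permutes UNIV. \<Prod>j\<in>J. l (p j)) =
    fact (card J) * fact (CARD('n) - card J) * elem_sym (card J) l"
proof -
  let ?P = "{p. p permutes (UNIV :: 'n set)}"
  let ?Q = "{I :: 'n set. card I = card J}"
  have pr: "(\<Prod>j\<in>J. l (p j)) = (\<Prod>j\<in>p ` J. l j)" if "p \<in> ?P" for p
    using that by (simp add: prod.reindex permutes_inj_on)
  have "(\<Sum>p\<in>?P. \<Prod>j\<in>J. l (p j)) = (\<Sum>p\<in>?P. \<Prod>j\<in>p ` J. l j)"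
    using pr by simp
  also have "\<dots> = (\<Sum>I\<in>?Q. \<Sum>p | p \<in> ?P \<and> p ` J = I. \<Prod>j\<in>p ` J. l j)"
    by (rule sum.group[symmetric]) (auto simp: finite_permutations card_image permutes_inj_on)
  also have "\<dots> = (\<Sum>I\<in>?Q. fact (card J) * fact (CARD('n) - card J) * (\<Prod>j\<in>I. l j))"
  proof (rule sum.cong[OF refl])
    fix I assume I: "I \<in> ?Q"
    have "(\<Sum>p | p \<in> ?P \<and> p ` J = I. \<Prod>j\<in>p ` J. l j) = (\<Sum>p | p \<in> ?P \<and> p ` J = I. \<Prod>j\<in>I. l j)"
      by (rule sum.cong) auto
    also have "\<dots> = real (card {p. p permutes UNIV \<and> p ` J = I}) * (\<Prod>j\<in>I. l j)"
      by simp
    also have "\<dots> = fact (card J) * fact (CARD('n) - card J) * (\<Prod>j\<in>I. l j)"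
      using I by (simp add: card_permutations_mapping_set)
    finally show "(\<Sum>p | p \<in> ?P \<and> p ` J = I. \<Prod>j\<in>p ` J. l j) =
      fact (card J) * fact (CARD('n) - card J) * (\<Prod>j\<in>I. l j)" .
  qed
  also have "\<dots> = fact (card J) * fact (CARD('n) - card J) * elem_sym (card J) l"
    by (simp add: elem_sym_def sum_distrib_left)
  finally show ?thesis .
qed

lemma elem_sym_uminus: "elem_sym i (\<lambda>j. - l j) = (- 1) ^ i * elem_sym i l"
proof -
  have "(\<Prod>j\<in>I. - l j) = (- 1) ^ i * (\<Prod>j\<in>I. l j)" if "card I = i" for I
    using that prod_uminus[of l I] by simp
  then show ?thesis by (simp add: elem_sym_def sum_distrib_left)
qed

text \<open>The Leibniz formula gives a double sum over \<open>\<sigma>\<close> and over the permutation \<open>p\<close> of the rows. The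
  weights \<open>m\<close> only see \<open>p\<close>; for fixed \<open>p\<close> the sum over \<open>\<sigma>\<close> is the determinant again.\<close>
lemma sum_sign_det_mixed_diagonal:
  fixes u :: "'n::finite \<Rightarrow> real ^ 'n" and J :: "'n set" and m :: "'n \<Rightarrow> real"
  shows "(\<Sum>\<sigma> | \<sigma> permutes UNIV. of_int (sign \<sigma>) *
      det (colmat (\<lambda>j. if j \<in> J then (\<chi> r. m r * u (\<sigma> j) $ r) else u (\<sigma> j)))) =
    fact (card J) * fact (CARD('n) - card J) * elem_sym (card J) m * det (colmat u)"
proof -
  let ?P = "{p. p permutes (UNIV :: 'n set)}"
  have coef: "(\<Prod>j\<in>UNIV. (if j \<in> J then (\<chi> r. m r * u (\<sigma> j) $ r) else u (\<sigma> j)) $ p j) =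
      (\<Prod>j\<in>J. m (p j)) * (\<Prod>j\<in>UNIV. u (\<sigma> j) $ p j)" for p \<sigma>
  proof -
    have "(\<Prod>j\<in>UNIV. (if j \<in> J then (\<chi> r. m r * u (\<sigma> j) $ r) else u (\<sigma> j)) $ p j) =
      (\<Prod>j\<in>UNIV. (if j \<in> J then m (p j) else 1) * u (\<sigma> j) $ p j)"
      by (rule prod.cong) auto
    also have "\<dots> = (\<Prod>j\<in>UNIV. if j \<in> J then m (p j) else 1) * (\<Prod>j\<in>UNIV. u (\<sigma> j) $ p j)"
      by (rule prod.distrib)
    also have "(\<Prod>j\<in>UNIV. if j \<in> J then m (p j) else 1) = (\<Prod>j\<in>J. m (p j))"
      using prod.inter_restrict[of UNIV "\<lambda>j. m (p j)" J] by simp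
    finally show ?thesis .
  qed
  have inner: "(\<Sum>\<sigma>\<in>?P. of_int (sign \<sigma>) * of_int (sign p) * (\<Prod>j\<in>UNIV. u (\<sigma> j) $ p j)) = det (colmat u)"
    if p: "p \<in> ?P" for p
  proof -
    have pp: "p permutes UNIV" using p by simp
    have "(\<Sum>\<sigma>\<in>?P. of_int (sign \<sigma>) * of_int (sign p) * (\<Prod>j\<in>UNIV. u (\<sigma> j) $ p j)) =
      (\<Sum>\<sigma>\<in>?P. of_int (sign (\<sigma> \<circ> p)) * of_int (sign p) * (\<Prod>j\<in>UNIV. u ((\<sigma> \<circ> p) j) $ p j))"
      by (rule sum_permutations_compose_right[OF pp])
    also have "\<dots> = (\<Sum>\<sigma>\<in>?P. of_int (sign \<sigma>) * (\<Prod>j\<in>UNIV. u (\<sigma> j) $ j))"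
    proof (rule sum.cong[OF refl])
      fix \<sigma> assume "\<sigma> \<in> ?P"
      then have s: "\<sigma> permutes UNIV" by simp
      have "sign (\<sigma> \<circ> p) = sign \<sigma> * sign p"
        using s pp by (metis finite permutation_permutes sign_compose)
      moreover have "(\<Prod>j\<in>UNIV. u ((\<sigma> \<circ> p) j) $ p j) = (\<Prod>j\<in>UNIV. u (\<sigma> j) $ j)"
        using prod.reindex_bij_betw[OF permutes_imp_bij[OF pp], of "\<lambda>j. u (\<sigma> j) $ j"] by simp
      moreover have "of_int (sign p) * of_int (sign p) = (1 :: real)"
        by (metis of_int_1 of_int_mult sign_idempotent)
      ultimately show "of_int (sign (\<sigma> \<circ> p)) * of_int (sign p) * (\<Prod>j\<in>UNIV. u ((\<sigma> \<circ> p) j) $ p j) =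
        of_int (sign \<sigma>) * (\<Prod>j\<in>UNIV. u (\<sigma> j) $ j)"
        by (simp add: mult.assoc)
    qed
    also have "\<dots> = det (colmat u)"
      by (simp add: det_def)
    finally show ?thesis .
  qed
  have "(\<Sum>\<sigma>\<in>?P. of_int (sign \<sigma>) *
      det (colmat (\<lambda>j. if j \<in> J then (\<chi> r. m r * u (\<sigma> j) $ r) else u (\<sigma> j)))) =
    (\<Sum>\<sigma>\<in>?P. \<Sum>p\<in>?P. (\<Prod>j\<in>J. m (p j)) *
      (of_int (sign \<sigma>) * of_int (sign p) * (\<Prod>j\<in>UNIV. u (\<sigma> j) $ p j)))"
    by (simp add: det_colmat_sum coef sum_distrib_left mult_ac)
  also have "\<dots> = (\<Sum>p\<in>?P. \<Sum>\<sigma>\<in>?P. (\<Prod>j\<in>J. m (p j)) *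
      (of_int (sign \<sigma>) * of_int (sign p) * (\<Prod>j\<in>UNIV. u (\<sigma> j) $ p j)))"
    by (rule sum.swap)
  also have "\<dots> = (\<Sum>p\<in>?P. (\<Prod>j\<in>J. m (p j)) * det (colmat u))"
    by (rule sum.cong[OF refl], subst sum_distrib_left[symmetric], subst inner) auto
  also have "\<dots> = fact (card J) * fact (CARD('n) - card J) * elem_sym (card J) m * det (colmat u)"
    by (simp add: sum_distrib_right[symmetric] sum_permutations_prod_image)
  finally show ?thesis .
qed

text \<open>In the coordinates given by the eigenbasis \<open>b\<close> the operator \<open>L\<close> multiplies the row \<open>r\<close> by
  \<open>l r\<close>, and all determinants are divided by that of \<open>b\<close>.\<close>
lemma sum_sign_det_mixed_eigenbasis:
  fixes v b :: "'n::finite \<Rightarrow> real ^ 'n" and J :: "'n set"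
  assumes "linear L" and "det (colmat b) \<noteq> 0" and L: "\<And>j. L (b j) = l j *\<^sub>R b j"
  shows "(\<Sum>\<sigma> | \<sigma> permutes UNIV. of_int (sign \<sigma>) *
      det (colmat (\<lambda>j. if j \<in> J then L (v (\<sigma> j)) else v (\<sigma> j)))) =
    fact (card J) * fact (CARD('n) - card J) * elem_sym (card J) l * det (colmat v)"
proof -
  let ?B = "colmat b"
  have "invertible ?B" using assms(2) by (simp add: invertible_det_nz)
  then obtain C where C: "?B ** C = mat 1" by (auto simp: invertible_def)
  define u where "u j = C *v v j" for j
  have v: "v j = ?B *v u j" for j by (simp add: u_def matrix_vector_mul_assoc C)
  have Lv: "L (v j) = ?B *v (\<chi> r. l r * u j $ r)" for j
    unfolding v colmat_mult_vec
    by (simp add: linear_sum[OF assms(1)] linear_cmul[OF assms(1)] L mult.commute)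
  have "det (colmat (\<lambda>j. if j \<in> J then L (v (\<sigma> j)) else v (\<sigma> j))) = det ?B *
      det (colmat (\<lambda>j. if j \<in> J then (\<chi> r. l r * u (\<sigma> j) $ r) else u (\<sigma> j)))" for \<sigma>
  proof -
    have "(\<lambda>j. if j \<in> J then L (v (\<sigma> j)) else v (\<sigma> j)) =
      (\<lambda>j. ?B *v (if j \<in> J then (\<chi> r. l r * u (\<sigma> j) $ r) else u (\<sigma> j)))"
      unfolding Lv unfolding v by auto
    then show ?thesis by (simp add: matrix_mul_colmat[symmetric] det_mul)
  qed
  then have "(\<Sum>\<sigma> | \<sigma> permutes UNIV. of_int (sign \<sigma>) *
      det (colmat (\<lambda>j. if j \<in> J then L (v (\<sigma> j)) else v (\<sigma> j)))) =
    det ?B * (\<Sum>\<sigma> | \<sigma> permutes UNIV. of_int (sign \<sigma>) *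
      det (colmat (\<lambda>j. if j \<in> J then (\<chi> r. l r * u (\<sigma> j) $ r) else u (\<sigma> j))))"
    by (simp add: sum_distrib_left mult_ac)
  also have "\<dots> = fact (card J) * fact (CARD('n) - card J) * elem_sym (card J) l * (det ?B * det (colmat u))"
    by (simp add: sum_sign_det_mixed_diagonal)
  also have "det ?B * det (colmat u) = det (colmat v)"
    unfolding v[abs_def] by (simp add: matrix_mul_colmat[symmetric] det_mul)
  finally show ?thesis .
qed

section \<open>Inner products given by bilinear forms\<close>

lemma linear_expand_Basis:
  fixes l :: "'e::euclidean_space \<Rightarrow> 'f::real_vector"
  assumes "linear l"
  shows "l a = (\<Sum>i\<in>Basis. (a \<bullet> i) *\<^sub>R l i)"
proof -
  have "l a= l (\<Sum>i\<in>Basis. (a \<bullet> i) *\<^sub>R i)" by (simp only: euclidean_representation)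
  also have "\<dots> = (\<Sum>i\<in>Basis. (a \<bullet> i) *\<^sub>R l i)"
    by (simp only: linear_sum[OF assms] linear_cmul[OF assms])
  finally show ?thesis .
qed

locale inner_form =
  fixes G :: "'e::euclidean_space \<Rightarrow> 'e \<Rightarrow> real"
  assumes bilinear: "bilinear G"
    and sym: "G a b = G b a"
    and pos: "a \<noteq> 0 \<Longrightarrow> 0 < G a a"
begin

lemma linear_right: "linear (G a)"
  using bilinear by (simp add: bilinear_def)

lemma linear_left: "linear (\<lambda>a. G a b)"
  using bilinear by (simp add: bilinear_def)

lemmas simps = bilinear_ladd[OF bilinear] bilinear_radd[OF bilinear] bilinear_lsub[OF bilinear]
  bilinear_rsub[OF bilinear] bilinear_lmul[OF bilinear] bilinear_rmul[OF bilinear]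
  bilinear_lzero[OF bilinear] bilinear_rzero[OF bilinear] bilinear_lneg[OF bilinear]
  bilinear_rneg[OF bilinear]

lemma eq_zero_iff: "G a a = 0 \<longleftrightarrow> a = 0"
  using pos[of a] by (cases "a = 0") (auto simp: simps)

lemma eqI:
  assumes "\<And>e. G a e = G b e"
  shows "a = b"
proof -
  have "G (a - b) (a - b) = 0" using assms[of "a - b"] by (simp add: simps)
  then show ?thesis by (simp add: eq_zero_iff)
qed

text \<open>The linear map that sends \<open>a\<close> to the Euclidean vector representing \<open>G a\<close> is injective by
  definiteness, hence surjective.\<close>
lemma riesz:
  assumes "linear l"
  shows "\<exists>a. \<forall>e. G a e = l e"
proof -
  define F where "F a = (\<Sum>i\<in>Basis. G a i *\<^sub>R i)" for a
  have "linear F"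
    by (rule linearI) (auto simp: F_def simps scaleR_left_distrib sum.distrib scaleR_sum_right)
  moreover have "inj F"
  proof (rule linear_injective_0[OF \<open>linear F\<close>, THEN iffD2], intro allI impI)
    fix a assume "F a = 0"
    then have F0: "F a \<bullet> i = 0" for i by simp
    have "G a i = 0" if "i \<in> Basis" for i
      using F0[of i] that unfolding F_def by (simp only: inner_sum_left_Basis)
    then have "G a a = 0"
      using linear_expand_Basis[OF linear_right, of a a] by simp
    then show "a = 0" by (simp add: eq_zero_iff)
  qed
  ultimately have "surj F" using linear_injective_imp_surjective by blast
  then obtain a where a: "F a = (\<Sum>i\<in>Basis. l i *\<^sub>R i)" by (metis surjD)
  have i: "G a i = l i" if "i \<in> Basis" for i
    using arg_cong[OF a, of "\<lambda>z. z \<bullet> i"] that by (simp add: F_def)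
  have "G a e = l e" for e
    using linear_expand_Basis[OF linear_right, of a e] linear_expand_Basis[OF assms, of e] i by simp
  then show ?thesis by auto
qed

end

text \<open>The spectral theorem for a symmetric form relative to an inner product. The basis is built one
  vector at a time: on the orthogonal complement \<open>S\<close> of the vectors already found, a maximum point
  \<open>z0\<close> of the quotient \<open>q z z / G z z\<close> is the next eigenvector.\<close>
lemma inner_form_diagonalize_symmetric:
  fixes G q :: "real ^ 'n::finite \<Rightarrow> real ^ 'n \<Rightarrow> real"
  assumes "inner_form G" and q: "bilinear q" and qsym: "\<And>a b. q a b = q b a"
  shows "\<exists>(b :: 'n \<Rightarrow> real ^ 'n) l. (\<forall>i j. G (b i) (b j) = (if i = j then 1 else 0)) \<and> (\<forall>j z. q (b j) z = l j * G (b j) z)"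
proof -
  interpret inner_form G by fact
  note qsimps = bilinear_ladd[OF q] bilinear_radd[OF q] bilinear_lsub[OF q]
    bilinear_rsub[OF q] bilinear_lmul[OF q] bilinear_rmul[OF q]
  have qr: "linear (q a)" for a using q by (simp add: bilinear_def)
  have "finite J \<Longrightarrow> \<exists>b l. (\<forall>i\<in>J. \<forall>j\<in>J. G (b i) (b j) = (if i = j then 1 else 0)) \<and>
      (\<forall>j\<in>J. \<forall>z. q (b j) z = l j * G (b j) z)" for J :: "'n set"
  proof (induction J rule: finite_induct)
    case empty
    then show ?case by simp
  next
    case (insert k J)
    then obtain b l where on: "\<And>i j. i \<in> J \<Longrightarrow> j \<in> J \<Longrightarrow> G (b i) (b j) = (if i = j then 1 else 0)"
      and ev: "\<And>j z. j \<in> J \<Longrightarrow> q (b j) z = l j * G (b j) z" by metis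
    \<comment> \<open>The complement is not trivial: the map \<open>T\<close>, which computes the products with the fewer than \<open>n\<close>
      vectors already found, misses the axis \<open>k\<close>, so it is not injective.\<close>
    define S where "S = {z. \<forall>j\<in>J. G (b j) z = 0}"
    define T where "T z = (\<chi> j. if j \<in> J then G (b j) z else 0)" for z
    have linT: "linear T"
      by (rule linearI) (auto simp: T_def vec_eq_iff simps)
    have "\<not> surj T"
    proof
      assume "surj T"
      then obtain z where "T z = axis k 1" by (metis surjD)
      then have "T z $ k = 1" by simp
      then show False using insert.hyps by (simp add: T_def)
    qed
    then have "\<not> inj T" using linT linear_injective_imp_surjective by blast
    then obtain y where y: "T y = 0" "y \<noteq> 0" using linear_injective_0[OF linT] by auto
    have "G (b j) y = 0" if "j \<in> J" for j
      using arg_cong[OF y(1), of "\<lambda>z. z $ j"] that by (simp add: T_def)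
    then have yS: "y \<in> S" by (simp add: S_def)
    have S_lin: "z + w \<in> S" "r *\<^sub>R z \<in> S" if "z \<in> S" "w \<in> S" for z w r
      using that by (auto simp: S_def simps)
    define K where "K = S \<inter> sphere 0 1"
    have "closed S"
    proof -
      have "S = (\<Inter>j\<in>J. {z. G (b j) z = 0})" by (auto simp: S_def)
      moreover have "closed {z. G (b j) z = 0}" for j
        by (intro closed_Collect_eq continuous_intros linear_continuous_on)
          (simp add: linear_conv_bounded_linear[symmetric] linear_right)
      ultimately show ?thesis by (simp add: closed_INT)
    qed
    then have "compact K" by (simp add: K_def closed_Int_compact)
    moreover have "(1 / norm y) *\<^sub>R y \<in> K" using y yS S_lin(2)[OF yS yS] by (simp add: K_def)
    then have "K \<noteq> {}" by auto
    moreover have "continuous_on K (\<lambda>z. q z z / G z z)"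
    proof (intro continuous_intros)
      show "continuous_on K (\<lambda>z. q z z)"
        by (rule bounded_bilinear.continuous_on[OF bilinear_conv_bounded_bilinear[THEN iffD1, OF q]])
          (intro continuous_intros)+
      show "continuous_on K (\<lambda>z. G z z)"
        by (rule bounded_bilinear.continuous_on[OF bilinear_conv_bounded_bilinear[THEN iffD1, OF bilinear]])
          (intro continuous_intros)+
      show "\<forall>z\<in>K. G z z \<noteq> 0" by (auto simp: K_def eq_zero_iff)
    qed
    ultimately obtain z0 where z0: "z0 \<in> K" and max: "\<And>z. z \<in> K \<Longrightarrow> q z z / G z z \<le> q z0 z0 / G z0 z0"
      using continuous_attains_sup[of K "\<lambda>z. q z z / G z z"] by blast
    \<comment> \<open>Now \<open>p = q - m G\<close> is nonpositive on \<open>S\<close> and vanishes at \<open>z0\<close>, hence \<open>p z0\<close> vanishes on \<open>S\<close>: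
      otherwise moving from \<open>z0\<close> along \<open>z\<close> would increase the quotient to first order.\<close>
    define m where "m = q z0 z0 / G z0 z0"
    define p where "p a c = q a c - m * G a c" for a c
    have z0S: "z0 \<in> S" and z0n: "z0 \<noteq> 0" using z0 by (auto simp: K_def)
    have p0: "p z0 z0 = 0" using z0n by (simp add: p_def m_def eq_zero_iff)
    have ple: "p z z \<le> 0" if z: "z \<in> S" for z
    proof (cases "z = 0")
      case True
      then show ?thesis by (simp add: p_def simps bilinear_lzero[OF q])
    next
      case False
      have "(1 / norm z) *\<^sub>R z \<in> K" using False S_lin(2)[OF z z] by (simp add: K_def)
      from max[OF this] have "q z z / G z z \<le> m"
        using False by (simp add: m_def simps qsimps)
      then show ?thesis using pos[OF False] by (simp add: p_def field_simps)
    qed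
    have pS: "p z0 z = 0" if z: "z \<in> S" for z
    proof -
      have q_exp: "2 * t * p z0 z + t\<^sup>2 * p z z \<le> 0" for t
      proof -
        have "p (z0 + t *\<^sub>R z) (z0 + t *\<^sub>R z) \<le> 0"
          by (rule ple) (use z z0S S_lin in blast)
        moreover have "p (z0 + t *\<^sub>R z) (z0 + t *\<^sub>R z) = p z0 z0 + 2 * t * p z0 z + t\<^sup>2 * p z z"
          using qsym[of z z0] sym[of z z0]
          by (simp add: p_def simps qsimps algebra_simps power2_eq_square)
        ultimately show ?thesis using p0 by simp
      qed
      define c where "c = p z0 z"
      \<comment> \<open>The step \<open>t = c / d\<close> is small enough for the linear term \<open>2 t c\<close> to dominate \<open>t\<^sup>2 p z z\<close>.\<close>
      define d where "d = 1 + \<bar>p z z\<bar>"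
      have d: "d > 0" "- p z z \<le> d" by (auto simp: d_def)
      have "2 * (c / d) * c + (c / d)\<^sup>2 * p z z \<le> 0" using q_exp[of "c / d"] by (simp add: c_def)
      then have "2 * c\<^sup>2 / d \<le> (c / d)\<^sup>2 * (- p z z)" by (simp add: power2_eq_square)
      also have "\<dots> \<le> (c / d)\<^sup>2 * d" using d by (intro mult_left_mono) auto
      also have "\<dots> = c\<^sup>2 / d" using d by (simp add: power2_eq_square)
      finally have "c\<^sup>2 \<le> 0" using d by (simp add: field_simps)
      then show ?thesis by (simp add: c_def)
    qed
    \<comment> \<open>On the span of the earlier eigenvectors \<open>p z0\<close> vanishes as well, by their eigenvalue equation.\<close>
    have all: "p z0 z = 0" for z
    proof -
      define z' where "z' = z - (\<Sum>j\<in>J. G (b j) z *\<^sub>R b j)"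
      have "z' \<in> S"
      proof -
        have "G (b i) z' = 0" if i: "i \<in> J" for i
        proof -
          have "(\<Sum>j\<in>J. G (b j) z * G (b i) (b j)) = (\<Sum>j\<in>J. if i = j then G (b j) z else 0)"
            by (rule sum.cong) (auto simp: on i)
          then show ?thesis using i insert.hyps
            by (simp add: z'_def simps linear_sum[OF linear_right])
        qed
        then show ?thesis by (simp add: S_def)
      qed
      then have 1: "p z0 z' = 0" by (rule pS)
      have 2: "p z0 (b j) = 0" if j: "j \<in> J" for j
        using z0S j ev[OF j, of z0] by (simp add: p_def S_def qsym[of z0] sym[of z0])
      have "p z0 z = p z0 z' + (\<Sum>j\<in>J. G (b j) z * p z0 (b j))"
        by (simp add: p_def z'_def simps qsimps linear_sum[OF linear_right] linear_sum[OF qr]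
          right_diff_distrib sum_subtractf sum_distrib_left mult.left_commute)
      then show ?thesis using 1 2 by simp
    qed
    define c where "c = 1 / sqrt (G z0 z0)"
    have cc: "c * c * G z0 z0 = 1" using pos[OF z0n] by (simp add: c_def)
    let ?b = "b(k := c *\<^sub>R z0)" and ?l = "l(k := m)"
    have k: "G (b j) z0 = 0" "G z0 (b j) = 0" if "j \<in> J" for j
      using that z0S sym[of z0 "b j"] by (auto simp: S_def)
    have "G (?b i) (?b j) = (if i = j then 1 else 0)"
      if i: "i \<in> insert k J" and j: "j \<in> insert k J" for i j
    proof (cases "i = k"; cases "j = k")
      assume "i = k" "j = k"
      then show ?thesis using cc by (simp add: simps mult.assoc)
    next
      assume "i = k" "j \<noteq> k"
      then show ?thesis using j k by (simp add: simps)
    next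
      assume "i \<noteq> k" "j = k"
      then show ?thesis using i k by (simp add: simps)
    next
      assume "i \<noteq> k" "j \<noteq> k"
      then show ?thesis using i j on by simp
    qed
    moreover have "q (?b j) z = ?l j * G (?b j) z" if j: "j \<in> insert k J" for j z
    proof (cases "j = k")
      case True
      have "q z0 z = m * G z0 z" using all[of z] by (simp add: p_def)
      with True show ?thesis by (simp add: simps qsimps)
    next
      case False
      then show ?thesis using j ev by simp
    qed
    ultimately show ?case by blast
  qed
  from this[OF finite[of UNIV]] show ?thesis by (simp only: ball_UNIV)
qed

section \<open>Symmetry of second derivatives and differentiability of determinants\<close>

lemma has_derivative_eventually_bound:
  fixes f :: "'e::real_normed_vector \<Rightarrow> 'f::real_normed_vector"
  assumes "(f has_derivative f') (at y)" and "0 < e"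
  shows "\<exists>d>0. \<forall>k. norm k < d \<longrightarrow> norm (f (y + k) - f y - f' k) \<le> e * norm k"
proof -
  from assms obtain d where d: "d > 0"
    and b: "\<And>z. norm (z - y) < d \<Longrightarrow> norm (f z - f y - f' (z - y)) \<le> e * norm (z - y)"
    unfolding has_derivative_at_alt by blast
  have "norm (f (y + k) - f y - f' k) \<le> e * norm k" if "norm k < d" for k
    using b[of "y + k"] that by simp
  with d show ?thesis by blast
qed

text \<open>The second difference of \<open>f\<close> in the directions \<open>a\<close> and \<open>b\<close> is \<open>t\<^sup>2 E b\<close> up to \<open>o(t\<^sup>2)\<close>,
  where \<open>E\<close> is the derivative of the directional derivative along \<open>a\<close>. The second difference is
  symmetric in \<open>a\<close> and \<open>b\<close>, so differentiability of the two directional derivatives at the single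
  point \<open>y\<close> suffices for the symmetry of the second derivative.\<close>
lemma second_difference_estimate:
  fixes f :: "'e::real_normed_vector \<Rightarrow> real"
  assumes "open S" "y \<in> S"
    and f: "\<And>z. z \<in> S \<Longrightarrow> (f has_derivative D z) (at z)"
    and D2: "((\<lambda>z. D z a) has_derivative E) (at y)"
    and "0 < e"
  shows "\<exists>d>0. \<forall>t. 0 < t \<and> t < d \<longrightarrow>
    \<bar>f (y + t *\<^sub>R a + t *\<^sub>R b) - f (y + t *\<^sub>R a) - f (y + t *\<^sub>R b) + f y - t\<^sup>2 * E b\<bar> \<le> e * t\<^sup>2"
proof -
  obtain r where r: "r > 0" "ball y r \<subseteq> S" using assms(1,2) by (auto simp: open_contains_ball)
  define c where "c = norm a + norm b + 1"
  have c: "c > 0" by (auto simp: c_def intro: add_nonneg_pos)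
  have e2: "e / (2 * c) > 0" using \<open>0 < e\<close> c by simp
  obtain d where d: "d > 0"
    and db: "\<And>k. norm k < d \<Longrightarrow> norm (D (y + k) a - D y a - E k) \<le> e / (2 * c) * norm k"
    using has_derivative_eventually_bound[OF D2 e2] by blast
  have linE: "linear E" using D2 by (rule has_derivative_linear)
  have nb: "norm (s *\<^sub>R a + u *\<^sub>R b) \<le> t * c" if "\<bar>s\<bar> \<le> t" "\<bar>u\<bar> \<le> t" for s t u
  proof -
    have "norm (s *\<^sub>R a + u *\<^sub>R b) \<le> \<bar>s\<bar> * norm a + \<bar>u\<bar> * norm b"
      by (rule order_trans[OF norm_triangle_ineq]) simp
    also have "\<dots> \<le> t * norm a + t * norm b"
      using that by (intro add_mono mult_right_mono) auto
    also have "\<dots> \<le> t * c" using that by (simp add: c_def algebra_simps)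
    finally show ?thesis .
  qed
  have "\<bar>f (y + t *\<^sub>R a + t *\<^sub>R b) - f (y + t *\<^sub>R a) - f (y + t *\<^sub>R b) + f y - t\<^sup>2 * E b\<bar> \<le> e * t\<^sup>2"
    if t: "0 < t" "t < min d r / c" for t
  proof -
    have tc: "t * c < d" "t * c < r" using t c by (simp_all add: pos_less_divide_eq)
    have inS: "y + (s *\<^sub>R a + u *\<^sub>R b) \<in> S" if "\<bar>s\<bar> \<le> t" "\<bar>u\<bar> \<le> t" for s u
    proof -
      have "norm (s *\<^sub>R a + u *\<^sub>R b) < r" using nb[OF that] tc by simp
      then have "y + (s *\<^sub>R a + u *\<^sub>R b) \<in> ball y r" 
        unfolding mem_ball dist_norm by (metis add_diff_cancel_left' norm_minus_commute)
      then show ?thesis using r by blast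
    qed
    \<comment> \<open>The second difference is \<open>p t - p 0\<close>, to which the mean value theorem applies. The factor 0 keeps
      the two terms of \<open>p\<close> in the same shape.\<close>
    define p where "p s = f (y + (s *\<^sub>R a + t *\<^sub>R b)) - f (y + (s *\<^sub>R a + 0 *\<^sub>R b))" for s
    define p' where "p' s = D (y + (s *\<^sub>R a + t *\<^sub>R b)) a - D (y + (s *\<^sub>R a + 0 *\<^sub>R b)) a" for s
    have der: "(p has_derivative (\<lambda>h. p' s * h)) (at s)" if s: "0 \<le> s" "s \<le> t" for s
    proof -
      have 1: "((\<lambda>s. f (y + (s *\<^sub>R a + u *\<^sub>R b))) has_derivative
          (\<lambda>h. D (y + (s *\<^sub>R a + u *\<^sub>R b)) (h *\<^sub>R a))) (at s)" if "\<bar>u\<bar> \<le> t" for u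
      proof -
        have "((\<lambda>s. y + (s *\<^sub>R a + u *\<^sub>R b)) has_derivative (\<lambda>h. h *\<^sub>R a)) (at s)"
          by (auto intro!: derivative_eq_intros)
        from has_derivative_compose[OF this f[OF inS]] show ?thesis using s that by simp
      qed
      have lin: "linear (D (y + (s *\<^sub>R a + u *\<^sub>R b)))" if "\<bar>u\<bar> \<le> t" for u
        by (rule has_derivative_linear[OF f[OF inS]]) (use s that in auto)
      have tt: "\<bar>t\<bar> \<le> t" "\<bar>0\<bar> \<le> t" using t by auto
      have "(p has_derivative (\<lambda>h. D (y + (s *\<^sub>R a + t *\<^sub>R b)) (h *\<^sub>R a) -
          D (y + (s *\<^sub>R a + 0 *\<^sub>R b)) (h *\<^sub>R a))) (at s)"
        unfolding p_def by (rule has_derivative_diff[OF 1[OF tt(1)] 1[OF tt(2)]])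
      moreover have "(\<lambda>h. D (y + (s *\<^sub>R a + t *\<^sub>R b)) (h *\<^sub>R a) -
          D (y + (s *\<^sub>R a + 0 *\<^sub>R b)) (h *\<^sub>R a)) = (\<lambda>h. p' s * h)"
        unfolding linear_cmul[OF lin[OF tt(1)]] linear_cmul[OF lin[OF tt(2)]] p'_def
        by (simp add: right_diff_distrib mult.commute)
      ultimately show ?thesis by simp
    qed
    have "\<exists>s\<in>{0<..<t}. p t - p 0 = p' s * (t - 0)"
    proof (rule mvt_simple[OF t(1)])
      fix s assume "0 \<le> s" "s \<le> t"
      then show "(p has_derivative (\<lambda>h. p' s * h)) (at s within {0..t})"
        by (rule has_derivative_at_withinI[OF der])
    qed
    then obtain s where s: "0 < s" "s < t" and ps: "p t - p 0 = p' s * t" by auto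
    have st: "\<bar>s\<bar> \<le> t" "\<bar>t\<bar> \<le> t" "\<bar>0\<bar> \<le> t" using s t by auto
    have B: "\<bar>D (y + (s *\<^sub>R a + u *\<^sub>R b)) a - D y a - E (s *\<^sub>R a + u *\<^sub>R b)\<bar> \<le> e / 2 * t"
      if u: "\<bar>u\<bar> \<le> t" for u
    proof -
      have "norm (D (y + (s *\<^sub>R a + u *\<^sub>R b)) a - D y a - E (s *\<^sub>R a + u *\<^sub>R b)) \<le>
          e / (2 * c) * norm (s *\<^sub>R a + u *\<^sub>R b)"
        using nb[OF st(1) u] tc by (intro db) simp
      also have "\<dots> \<le> e / (2 * c) * (t * c)"
        using nb[OF st(1) u] e2 by (intro mult_left_mono) auto
      also have "\<dots> = e / 2 * t" using c by simp
      finally show ?thesis by simp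
    qed
    have lE: "E (s *\<^sub>R a + u *\<^sub>R b) = s * E a + u * E b" for u
      by (simp add: linear_add[OF linE] linear_cmul[OF linE])
    have "\<bar>p' s - t * E b\<bar> \<le> e * t"
      using B[OF st(2)] B[OF st(3)] unfolding lE p'_def by (simp only: abs_le_iff) linarith
    then have "\<bar>p' s - t * E b\<bar> * t \<le> e * t * t" using t by (intro mult_right_mono) auto
    moreover have "\<bar>p' s - t * E b\<bar> * t = \<bar>p' s * t - t\<^sup>2 * E b\<bar>"
    proof -
      have "p' s * t - t\<^sup>2 * E b = (p' s - t * E b) * t" by (simp add: power2_eq_square algebra_simps)
      then show ?thesis using t by (simp add: abs_mult)
    qed
    ultimately have "\<bar>p t - p 0 - t\<^sup>2 * E b\<bar> \<le> e * t\<^sup>2"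
      unfolding ps by (simp add: power2_eq_square)
    moreover have "p t - p 0 = f (y + t *\<^sub>R a + t *\<^sub>R b) - f (y + t *\<^sub>R a) - f (y + t *\<^sub>R b) + f y"
      by (simp add: p_def add.assoc)
    ultimately show ?thesis by simp
  qed
  moreover have "min d r / c > 0" using d r c by simp
  ultimately show ?thesis by (intro exI[of _ "min d r / c"]) simp
qed

lemma second_derivative_symmetric_real:
  fixes f :: "'e::real_normed_vector \<Rightarrow> real"
  assumes "open S" "y \<in> S"
    and f: "\<And>z. z \<in> S \<Longrightarrow> (f has_derivative D z) (at z)"
    and Da: "((\<lambda>z. D z a) has_derivative Ea) (at y)"
    and Db: "((\<lambda>z. D z b) has_derivative Eb) (at y)"
  shows "Ea b = Eb a"
proof (rule ccontr)
  assume ne: "Ea b \<noteq> Eb a"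
  define e where "e = \<bar>Ea b - Eb a\<bar> / 3"
  have e: "e > 0" using ne by (simp add: e_def)
  obtain d1 where d1: "d1 > 0" "\<And>t. 0 < t \<Longrightarrow> t < d1 \<Longrightarrow>
    \<bar>f (y + t *\<^sub>R a + t *\<^sub>R b) - f (y + t *\<^sub>R a) - f (y + t *\<^sub>R b) + f y - t\<^sup>2 * Ea b\<bar> \<le> e * t\<^sup>2"
    using second_difference_estimate[OF assms(1,2) f Da e, where b = b] by blast
  obtain d2 where d2: "d2 > 0" "\<And>t. 0 < t \<Longrightarrow> t < d2 \<Longrightarrow>
    \<bar>f (y + t *\<^sub>R b + t *\<^sub>R a) - f (y + t *\<^sub>R b) - f (y + t *\<^sub>R a) + f y - t\<^sup>2 * Eb a\<bar> \<le> e * t\<^sup>2"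
    using second_difference_estimate[OF assms(1,2) f Db e, where b = a] by blast
  define t where "t = min d1 d2 / 2"
  have t: "0 < t" "t < d1" "t < d2" using d1 d2 by (auto simp: t_def)
  have eq: "y + t *\<^sub>R b + t *\<^sub>R a = y + t *\<^sub>R a + t *\<^sub>R b" by simp
  have "\<bar>t\<^sup>2 * Ea b - t\<^sup>2 * Eb a\<bar> \<le> 2 * e * t\<^sup>2"
    using d1(2)[OF t(1,2)] d2(2)[OF t(1,3)] unfolding eq by linarith
  moreover have "\<bar>t\<^sup>2 * Ea b - t\<^sup>2 * Eb a\<bar> = \<bar>Ea b - Eb a\<bar> * t\<^sup>2"
    by (simp add: right_diff_distrib[symmetric] abs_mult)
  ultimately have "\<bar>Ea b - Eb a\<bar> * t\<^sup>2 \<le> (2 * e) * t\<^sup>2" by linarith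
  then have "\<bar>Ea b - Eb a\<bar> \<le> 2 * e" using t by simp
  then show False using e by (simp add: e_def)
qed

lemma second_derivative_symmetric:
  fixes f :: "'e::real_normed_vector \<Rightarrow> 'f::euclidean_space"
  assumes "open S" "y \<in> S"
    and f: "\<And>z. z \<in> S \<Longrightarrow> (f has_derivative D z) (at z)"
    and Da: "((\<lambda>z. D z a) has_derivative Ea) (at y)"
    and Db: "((\<lambda>z. D z b) has_derivative Eb) (at y)"
  shows "Ea b = Eb a"
proof (rule euclidean_eqI)
  fix i :: 'f
  show "Ea b \<bullet> i = Eb a \<bullet> i"
    by (rule second_derivative_symmetric_real[OF assms(1,2), of "\<lambda>z. f z \<bullet> i" "\<lambda>z h. D z h \<bullet> i"])
      (use f Da Db in \<open>auto intro: has_derivative_inner_left\<close>)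
qed

lemma differentiable_vec_componentwise:
  fixes f :: "'e::real_normed_vector \<Rightarrow> real ^ 'k::finite"
  shows "f differentiable (at y) \<longleftrightarrow> (\<forall>i. (\<lambda>z. f z $ i) differentiable (at y))"
proof -
  have "f differentiable (at y) \<longleftrightarrow> (\<forall>i\<in>Basis. (\<lambda>z. f z \<bullet> i) differentiable (at y))"
    by (rule differentiable_componentwise_within)
  also have "\<dots> \<longleftrightarrow> (\<forall>i. (\<lambda>z. f z $ i) differentiable (at y))"
    by (simp add: Basis_vec_def inner_axis)
  finally show ?thesis .
qed

lemma differentiable_prod:
  fixes F :: "'i \<Rightarrow> 'e::real_normed_vector \<Rightarrow> real"
  assumes "\<And>i. i \<in> I \<Longrightarrow> F i differentiable (at y)"
  shows "(\<lambda>z. \<Prod>i\<in>I. F i z) differentiable (at y)"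
proof -
  have "(F i has_derivative frechet_derivative (F i) (at y)) (at y)" if "i \<in> I" for i
    using assms[OF that] by (simp add: frechet_derivative_works)
  from differentiableI[OF has_derivative_prod[OF this]] show ?thesis .
qed

lemma differentiable_det:
  fixes A :: "'e::real_normed_vector \<Rightarrow> real ^ 'k ^ 'k::finite"
  assumes "\<And>i j. (\<lambda>z. A z $ i $ j) differentiable (at y)"
  shows "(\<lambda>z. det (A z)) differentiable (at y)"
proof -
  have "(\<lambda>z. of_int (sign p) * (\<Prod>i\<in>UNIV. A z $ i $ p i)) differentiable (at y)" for p :: "'k \<Rightarrow> 'k"
    by (rule differentiable_mult[OF differentiable_const differentiable_prod]) (rule assms)
  then show ?thesis
    unfolding det_def by (intro differentiable_sum) (auto simp: finite_permutations)
qed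

section \<open>Charts and tangent vectors\<close>

lemma smooth_on_differentiable:
  assumes "smooth_on S F" "x \<in> S"
  shows "F differentiable (at x)"
proof -
  have "Ck_on (Suc 0) S F" using assms(1) unfolding smooth_on_def by blast
  then show ?thesis using assms(2) by simp
qed

lemma smooth_on_directional:
  assumes "smooth_on S F"
  shows "smooth_on S (\<lambda>x. frechet_derivative F (at x) a)"
  unfolding smooth_on_def
proof
  fix k
  have "Ck_on (Suc k) S F" using assms unfolding smooth_on_def by blast
  then show "Ck_on k S (\<lambda>x. frechet_derivative F (at x) a)" by simp
qed

lemma cmap_cinv:
  assumes "y \<in> cmap c ` cdom c"
  shows "cmap c (cinv c y) = y" and "cinv c y \<in> cdom c"
  using assms by (auto simp: cinv_def f_inv_into_f inv_into_into)

lemma cinv_cmap: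
  assumes "inj_on (cmap c) (cdom c)" "p \<in> cdom c"
  shows "cinv c (cmap c p) = p"
  using assms by (simp add: cinv_def)

text \<open>The chain rule for maps between manifolds; with the identity for \<open>F\<close> or \<open>G\<close> it is the
  compatibility with a change of charts.\<close>
lemma has_derivative_chart_compose:
  assumes c: "inj_on (cmap c) (cdom c)" and d: "inj_on (cmap d) (cdom d)"
    and p: "p \<in> cdom c" "F p \<in> cdom d"
    and op: "open (cmap c ` (cdom c \<inter> F -` cdom d))"
    and F: "(cmap d \<circ> F \<circ> cinv c) differentiable (at (cmap c p))"
    and G: "(cmap e \<circ> G \<circ> cinv d) differentiable (at (cmap d (F p)))"
  shows "((cmap e \<circ> (G \<circ> F) \<circ> cinv c) has_derivative
    frechet_derivative (cmap e \<circ> G \<circ> cinv d) (at (cmap d (F p))) \<circ>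
    frechet_derivative (cmap d \<circ> F \<circ> cinv c) (at (cmap c p))) (at (cmap c p))"
proof -
  have y: "(cmap d \<circ> F \<circ> cinv c) (cmap c p) = cmap d (F p)"
    using c p by (simp add: cinv_cmap)
  have "((cmap e \<circ> G \<circ> cinv d) \<circ> (cmap d \<circ> F \<circ> cinv c) has_derivative
    frechet_derivative (cmap e \<circ> G \<circ> cinv d) (at (cmap d (F p))) \<circ>
    frechet_derivative (cmap d \<circ> F \<circ> cinv c) (at (cmap c p))) (at (cmap c p))"
    by (rule diff_chain_at) (use F G y frechet_derivative_works in auto)
  then show ?thesis
  proof (rule has_derivative_transform_within_open[OF _ op])
    show "cmap c p \<in> cmap c ` (cdom c \<inter> F -` cdom d)" using p by auto
    fix z assume "z \<in> cmap c ` (cdom c \<inter> F -` cdom d)"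
    then obtain q where q: "q \<in> cdom c" "F q \<in> cdom d" "z = cmap c q" by auto
    then show "(cmap e \<circ> G \<circ> cinv d \<circ> (cmap d \<circ> F \<circ> cinv c)) z = (cmap e \<circ> (G \<circ> F) \<circ> cinv c) z"
      using c d by (simp add: cinv_cmap)
  qed
qed

text \<open>A notion weak enough for \<open>TM\<close> to inherit it at the cost of one derivative of the transition
  maps of \<open>M\<close>, so that one calculus of tangent vectors serves both.\<close>

definition differentiable_atlas :: "('a, 'e::euclidean_space) chart set \<Rightarrow> bool" where
  "differentiable_atlas A \<longleftrightarrow> (\<forall>c\<in>A. inj_on (cmap c) (cdom c)) \<and>
    (\<forall>c\<in>A. \<forall>d\<in>A. open (cmap c ` (cdom c \<inter> cdom d)) \<and>
      (\<forall>y \<in> cmap c ` (cdom c \<inter> cdom d). (cmap d \<circ> cinv c) differentiable (at y)))"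

lemma smooth_atlas_imp_differentiable: "smooth_atlas A \<Longrightarrow> differentiable_atlas A"
  unfolding smooth_atlas_def differentiable_atlas_def by (meson smooth_on_differentiable)

definition differentiable_map_at ::
  "('a, 'e::euclidean_space) chart set \<Rightarrow> ('b, 'f::euclidean_space) chart set \<Rightarrow> ('a \<Rightarrow> 'b) \<Rightarrow> 'a \<Rightarrow> bool"
where
  "differentiable_map_at A A' F p \<longleftrightarrow> (\<forall>c\<in>A. \<forall>d\<in>A'. p \<in> cdom c \<longrightarrow> F p \<in> cdom d \<longrightarrow>
    open (cmap c ` (cdom c \<inter> F -` cdom d)) \<and> (cmap d \<circ> F \<circ> cinv c) differentiable (at (cmap c p)))"

abbreviation chart_derivative ::
  "('a, 'e::euclidean_space) chart \<Rightarrow> ('b, 'f::euclidean_space) chart \<Rightarrow> ('a \<Rightarrow> 'b) \<Rightarrow> 'a \<Rightarrow> 'e \<Rightarrow> 'f" where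
  "chart_derivative c d F p \<equiv> frechet_derivative (cmap d \<circ> F \<circ> cinv c) (at (cmap c p))"

abbreviation transition ::
  "('a, 'e::euclidean_space) chart \<Rightarrow> ('a, 'e) chart \<Rightarrow> 'a \<Rightarrow> 'e \<Rightarrow> 'e" where
  "transition c d p \<equiv> frechet_derivative (cmap d \<circ> cinv c) (at (cmap c p))"

lemma fst_mk_tvec [simp]: "fst (mk_tvec A p c z) = p"
  by (simp add: mk_tvec_def)

lemma snd_mk_tvec: "d \<in> A \<Longrightarrow> p \<in> cdom d \<Longrightarrow> snd (mk_tvec A p c z) d = transition c d p z"
  by (simp add: mk_tvec_def)

lemma chart_at:
  assumes "p \<in> carrier A"
  shows "chart_at A p \<in> A" "p \<in> cdom (chart_at A p)"
proof -
  have "\<exists>c. c \<in> A \<and> p \<in> cdom c" using assms by (auto simp: carrier_def)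
  then have "chart_at A p \<in> A \<and> p \<in> cdom (chart_at A p)" unfolding chart_at_def by (rule someI_ex)
  then show "chart_at A p \<in> A" "p \<in> cdom (chart_at A p)" by auto
qed

lemma fst_tmap [simp]: "fst (tmap A A' F v) = F (fst v)"
  by (simp add: tmap_def Let_def)

text \<open>The next three lemmas describe a tangent space through components, so that the quantifiers over
  charts in the definition of the tangent bundle need not be unfolded again.\<close>
lemma tspaceD:
  assumes "v \<in> tspace A p"
  shows "fst v = p" "p \<in> carrier A" "\<And>c. \<not> (c \<in> A \<and> p \<in> cdom c) \<Longrightarrow> snd v c = 0"
    "\<And>c d. c \<in> A \<Longrightarrow> d \<in> A \<Longrightarrow> p \<in> cdom c \<Longrightarrow> p \<in> cdom d \<Longrightarrow> snd v d = transition c d p (snd v c)"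
proof -
  have v: "v \<in> tangent_bundle A" "fst v = p" using assms by (simp_all add: tspace_def)
  then obtain w where w: "v = (p, w)" by (cases v) simp
  note v = v(1)[unfolded w tangent_bundle_def mem_Collect_eq case_prod_conv]
  show "fst v = p" "p \<in> carrier A" using w v by simp_all
  show "snd v c = 0" if "\<not> (c \<in> A \<and> p \<in> cdom c)" for c
  proof -
    from v have "\<forall>c. \<not> (c \<in> A \<and> p \<in> cdom c) \<longrightarrow> w c = 0" by blast
    from mp[OF spec[OF this] that] show ?thesis by (simp add: w)
  qed
  show "snd v d = transition c d p (snd v c)"
    if "c \<in> A" "d \<in> A" "p \<in> cdom c" "p \<in> cdom d" for c d
  proof -
    from v have "\<forall>c\<in>A. \<forall>d\<in>A. p \<in> cdom c \<inter> cdom d \<longrightarrow> w d = transition c d p (w c)" by blast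
    from mp[OF bspec[OF bspec[OF this that(1)] that(2)]] that show ?thesis by (simp add: w)
  qed
qed

lemma tspaceI:
  assumes "fst v = p" and "p \<in> carrier A" and "\<And>c. \<not> (c \<in> A \<and> p \<in> cdom c) \<Longrightarrow> snd v c = 0"
    and "\<And>c d. c \<in> A \<Longrightarrow> d \<in> A \<Longrightarrow> p \<in> cdom c \<Longrightarrow> p \<in> cdom d \<Longrightarrow>
      snd v d = transition c d p (snd v c)"
  shows "v \<in> tspace A p"
proof -
  have "(p, snd v) \<in> tangent_bundle A"
    unfolding tangent_bundle_def mem_Collect_eq case_prod_conv using assms(2-4) by blast
  then show ?thesis using assms(1) by (auto simp: tspace_def)
qed

lemma tspace_eqI:
  assumes "v \<in> tspace A p" "w \<in> tspace A p" "c \<in> A" "p \<in> cdom c" "snd v c = snd w c"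
  shows "v = w"
proof -
  have "snd v d = snd w d" for d
  proof (cases "d \<in> A \<and> p \<in> cdom d")
    case True
    then show ?thesis
      using tspaceD(4)[OF assms(1,3) _ assms(4)] tspaceD(4)[OF assms(2,3) _ assms(4)] assms(5) by simp
  next
    case False
    then show ?thesis using tspaceD(3)[OF assms(1) False] tspaceD(3)[OF assms(2) False] by simp
  qed
  moreover have "fst v = fst w" using tspaceD(1)[OF assms(1)] tspaceD(1)[OF assms(2)] by simp
  ultimately show ?thesis by (simp add: prod_eq_iff fun_eq_iff)
qed

lemma tangent_bundle_iff: "u \<in> tangent_bundle A \<longleftrightarrow> u \<in> tspace A (fst u)"
  by (simp add: tspace_def)

lemma fst_tscale [simp]: "fst (tscale r v) = fst v"
  by (simp add: tscale_def)

lemma snd_tscale [simp]: "snd (tscale r v) c = r *\<^sub>R snd v c"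
  by (simp add: tscale_def)

locale differentiable_manifold =
  fixes A :: "('a, 'e::euclidean_space) chart set"
  assumes atlas: "differentiable_atlas A"
begin

lemma inj: "c \<in> A \<Longrightarrow> inj_on (cmap c) (cdom c)"
  using atlas by (simp add: differentiable_atlas_def)

lemma cinv [simp]: "c \<in> A \<Longrightarrow> p \<in> cdom c \<Longrightarrow> cinv c (cmap c p) = p"
  by (rule cinv_cmap[OF inj])

lemma open_overlap: "c \<in> A \<Longrightarrow> d \<in> A \<Longrightarrow> open (cmap c ` (cdom c \<inter> cdom d))"
  using atlas by (simp add: differentiable_atlas_def)

lemma open_image: "c \<in> A \<Longrightarrow> open (cmap c ` cdom c)"
  using open_overlap[of c c] by simp

lemma carrierI: "c \<in> A \<Longrightarrow> p \<in> cdom c \<Longrightarrow> p \<in> carrier A"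
  by (auto simp: carrier_def)

lemma transition_differentiable:
  "c \<in> A \<Longrightarrow> d \<in> A \<Longrightarrow> p \<in> cdom c \<Longrightarrow> p \<in> cdom d \<Longrightarrow> (cmap d \<circ> cinv c) differentiable (at (cmap c p))"
  using atlas by (auto simp: differentiable_atlas_def)

lemma transition_linear:
  "c \<in> A \<Longrightarrow> d \<in> A \<Longrightarrow> p \<in> cdom c \<Longrightarrow> p \<in> cdom d \<Longrightarrow> linear (transition c d p)"
  by (rule linear_frechet_derivative[OF transition_differentiable])

lemma differentiable_id:
  assumes "c \<in> A" "d \<in> A" "p \<in> cdom c" "p \<in> cdom d"
  shows "(cmap d \<circ> id \<circ> cinv c) differentiable (at (cmap c p))"
    and "open (cmap c ` (cdom c \<inter> id -` cdom d))"
  using transition_differentiable[OF assms] open_overlap[OF assms(1,2)] by simp_all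

lemma transition_compose:
  assumes "c \<in> A" "d \<in> A" "e \<in> A" "p \<in> cdom c" "p \<in> cdom d" "p \<in> cdom e"
  shows "transition d e p (transition c d p z) = transition c e p z"
proof -
  have "((cmap e \<circ> (id \<circ> id) \<circ> cinv c) has_derivative
    frechet_derivative (cmap e \<circ> id \<circ> cinv d) (at (cmap d (id p))) \<circ>
    frechet_derivative (cmap d \<circ> id \<circ> cinv c) (at (cmap c p))) (at (cmap c p))"
    by (rule has_derivative_chart_compose) (use assms inj differentiable_id in auto)
  from frechet_derivative_at[OF this] show ?thesis by (simp add: fun_eq_iff)
qed

lemma transition_same:
  assumes "c \<in> A" "p \<in> cdom c"
  shows "transition c c p z = z"
proof -
  have "((\<lambda>y. y) has_derivative (\<lambda>z. z)) (at (cmap c p))" by simp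
  then have "((cmap c \<circ> cinv c) has_derivative (\<lambda>z. z)) (at (cmap c p))"
    by (rule has_derivative_transform_within_open[OF _ open_image[OF assms(1)]])
      (use assms in \<open>auto simp: cmap_cinv\<close>)
  from frechet_derivative_at[OF this] show ?thesis by metis
qed

lemma mk_tvec_in_tspace:
  assumes "c \<in> A" "p \<in> cdom c"
  shows "mk_tvec A p c z \<in> tspace A p"
proof -
  have "snd (mk_tvec A p c z) e = transition d e p (snd (mk_tvec A p c z) d)"
    if "d \<in> A" "e \<in> A" "p \<in> cdom d" "p \<in> cdom e" for d e
    using that assms by (simp add: snd_mk_tvec transition_compose)
  moreover have "snd (mk_tvec A p c z) d = 0" if "\<not> (d \<in> A \<and> p \<in> cdom d)" for d
    using that unfolding mk_tvec_def by auto
  moreover have "fst (mk_tvec A p c z) = p" by simp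
  ultimately show ?thesis
    using carrierI[OF assms] by (intro tspaceI)
qed

lemma snd_mk_tvec_same: "c \<in> A \<Longrightarrow> p \<in> cdom c \<Longrightarrow> snd (mk_tvec A p c z) c = z"
  by (simp add: snd_mk_tvec transition_same)

lemma mk_tvec_snd:
  assumes "v \<in> tspace A p" "c \<in> A" "p \<in> cdom c"
  shows "mk_tvec A p c (snd v c) = v"
  by (rule tspace_eqI[OF mk_tvec_in_tspace[OF assms(2,3)] assms])
    (rule snd_mk_tvec_same[OF assms(2,3)])

lemma tscale_in_tspace:
  assumes "v \<in> tspace A p"
  shows "tscale r v \<in> tspace A p"
proof -
  have c: "chart_at A p \<in> A" "p \<in> cdom (chart_at A p)" using chart_at[OF tspaceD(2)[OF assms]] .
  have "tscale r v = mk_tvec A p (chart_at A p) (r *\<^sub>R snd v (chart_at A p))"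
  proof (rule prod_eqI)
    show "snd (tscale r v) = snd (mk_tvec A p (chart_at A p) (r *\<^sub>R snd v (chart_at A p)))"
    proof
      fix d
      show "snd (tscale r v) d = snd (mk_tvec A p (chart_at A p) (r *\<^sub>R snd v (chart_at A p))) d"
      proof (cases "d \<in> A \<and> p \<in> cdom d")
        case True
        then show ?thesis
          using tspaceD(4)[OF assms c(1) _ c(2), of d] linear_cmul[OF transition_linear[OF c(1) _ c(2)]]
          by (simp add: snd_mk_tvec)
      next
        case False
        then show ?thesis using tspaceD(3)[OF assms, of d] by (auto simp: mk_tvec_def)
      qed
    qed
  qed (use tspaceD(1)[OF assms] in simp)
  then show ?thesis using mk_tvec_in_tspace[OF c] by simp
qed

end

text \<open>The differential of a map is defined by means of one choice of charts; here all charts around the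
  points are admitted.\<close>
lemma tmap_in_charts:
  assumes A: "differentiable_manifold A" and A': "differentiable_manifold A'"
    and F: "differentiable_map_at A A' F p" and v: "v \<in> tspace A p"
    and c: "c \<in> A" "p \<in> cdom c" and d: "d \<in> A'" "F p \<in> cdom d"
  shows "tmap A A' F v \<in> tspace A' (F p)"
    and "snd (tmap A A' F v) d = chart_derivative c d F p (snd v c)"
proof -
  interpret A: differentiable_manifold A by fact
  interpret A': differentiable_manifold A' by fact
  define c0 where "c0 = chart_at A p"
  define d0 where "d0 = chart_at A' (F p)"
  have c0: "c0 \<in> A" "p \<in> cdom c0" unfolding c0_def using chart_at[OF A.carrierI[OF c]] .
  have d0: "d0 \<in> A'" "F p \<in> cdom d0" unfolding d0_def using chart_at[OF A'.carrierI[OF d]] .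
  have tm: "tmap A A' F v = mk_tvec A' (F p) d0 (chart_derivative c0 d0 F p (snd v c0))"
    using tspaceD(1)[OF v] by (simp add: tmap_def Let_def c0_def d0_def)
  then show "tmap A A' F v \<in> tspace A' (F p)" by (simp add: A'.mk_tvec_in_tspace[OF d0])
  have "((cmap d0 \<circ> (F \<circ> id) \<circ> cinv c) has_derivative
    frechet_derivative (cmap d0 \<circ> F \<circ> cinv c0) (at (cmap c0 (id p))) \<circ>
    frechet_derivative (cmap c0 \<circ> id \<circ> cinv c) (at (cmap c p))) (at (cmap c p))"
    by (rule has_derivative_chart_compose)
      (use c c0 d0 A.inj A.differentiable_id F in \<open>auto simp: differentiable_map_at_def\<close>)
  from frechet_derivative_at[OF this]
  have 1: "chart_derivative c d0 F p z = chart_derivative c0 d0 F p (transition c c0 p z)" for z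
    by (simp add: fun_eq_iff)
  have "((cmap d \<circ> (id \<circ> F) \<circ> cinv c) has_derivative
    frechet_derivative (cmap d \<circ> id \<circ> cinv d0) (at (cmap d0 (F p))) \<circ>
    frechet_derivative (cmap d0 \<circ> F \<circ> cinv c) (at (cmap c p))) (at (cmap c p))"
    by (rule has_derivative_chart_compose)
      (use c d d0 A.inj A'.inj A'.differentiable_id F in \<open>auto simp: differentiable_map_at_def\<close>)
  from frechet_derivative_at[OF this]
  have 2: "chart_derivative c d F p z = transition d0 d (F p) (chart_derivative c d0 F p z)" for z
    by (simp add: fun_eq_iff)
  have "snd (tmap A A' F v) d = transition d0 d (F p) (chart_derivative c0 d0 F p (snd v c0))"
    unfolding tm using d by (simp add: snd_mk_tvec)
  also have "snd v c0 = transition c c0 p (snd v c)" using tspaceD(4)[OF v c(1) c0(1) c(2) c0(2)] .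
  finally show "snd (tmap A A' F v) d = chart_derivative c d F p (snd v c)" by (simp only: 1 2)
qed

section \<open>The tangent bundle as a manifold\<close>

lemma cdom_tchart: "cdom (tchart A c) = {u \<in> tangent_bundle A. fst u \<in> cdom c}"
  by (simp add: tchart_def)

lemma cmap_tchart: "cmap (tchart A c) u = (cmap c (fst u), snd u c)"
  by (simp add: tchart_def)

context differentiable_manifold
begin

lemma inj_tchart:
  assumes "c \<in> A"
  shows "inj_on (cmap (tchart A c)) (cdom (tchart A c))"
proof (rule inj_onI)
  fix u w assume u: "u \<in> cdom (tchart A c)" and w: "w \<in> cdom (tchart A c)"
    and e: "cmap (tchart A c) u = cmap (tchart A c) w"
  have "fst u = fst w" using u w e inj[OF assms] by (auto simp: cdom_tchart cmap_tchart dest: inj_onD)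
  moreover have "snd u c = snd w c" using e by (simp add: cmap_tchart)
  ultimately show "u = w"
    using u w assms tspace_eqI[of u A "fst u" w c] by (auto simp: cdom_tchart tangent_bundle_iff)
qed

lemma cinv_tchart:
  assumes "c \<in> A" "y \<in> cmap c ` cdom c"
  shows "cinv (tchart A c) (y, z) = mk_tvec A (cinv c y) c z"
proof -
  let ?u = "mk_tvec A (cinv c y) c z"
  have q: "cinv c y \<in> cdom c" "cmap c (cinv c y) = y" using cmap_cinv[OF assms(2)] by auto
  have "?u \<in> cdom (tchart A c)"
    using mk_tvec_in_tspace[OF assms(1) q(1)] q by (simp add: cdom_tchart tangent_bundle_iff)
  moreover have "cmap (tchart A c) ?u = (y, z)"
    using assms(1) q by (simp add: cmap_tchart snd_mk_tvec_same)
  ultimately show ?thesis using cinv_cmap[OF inj_tchart[OF assms(1)]] by metis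
qed

lemma tchart_image:
  assumes "c \<in> A" "S \<subseteq> cdom c"
  shows "cmap (tchart A c) ` {u \<in> tangent_bundle A. fst u \<in> S} = (cmap c ` S) \<times> UNIV"
proof
  show "(cmap c ` S) \<times> UNIV \<subseteq> cmap (tchart A c) ` {u \<in> tangent_bundle A. fst u \<in> S}"
  proof clarify
    fix q z assume q: "q \<in> S"
    then have qc: "q \<in> cdom c" using assms by auto
    have "mk_tvec A q c z \<in> {u \<in> tangent_bundle A. fst u \<in> S}"
      using q mk_tvec_in_tspace[OF assms(1) qc] by (simp add: tangent_bundle_iff)
    moreover have "(cmap c q, z) = cmap (tchart A c) (mk_tvec A q c z)"
      using assms(1) qc by (simp add: cmap_tchart snd_mk_tvec_same)
    ultimately show "(cmap c q, z) \<in> cmap (tchart A c) ` {u \<in> tangent_bundle A. fst u \<in> S}"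
      by (rule rev_image_eqI)
  qed
qed (auto simp: cmap_tchart)

lemma carrier_tangent_atlas: "carrier (tangent_atlas A) = tangent_bundle A"
proof -
  have "carrier (tangent_atlas A) = {u \<in> tangent_bundle A. fst u \<in> carrier A}"
    unfolding carrier_def tangent_atlas_def by (simp add: cdom_tchart) blast
  moreover have "fst u \<in> carrier A" if "u \<in> tangent_bundle A" for u
    using that tspaceD(2) by (simp add: tangent_bundle_iff)
  ultimately show ?thesis by auto
qed

lemma tchart_in_atlas: "c \<in> A \<Longrightarrow> tchart A c \<in> tangent_atlas A"
  by (simp add: tangent_atlas_def)

end

lemma differentiable_Pair:
  "f differentiable (at x) \<Longrightarrow> g differentiable (at x) \<Longrightarrow> (\<lambda>y. (f y, g y)) differentiable (at x)"
  by (rule differentiableI[OF has_derivative_Pair]) (simp_all add: frechet_derivative_works)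

text \<open>A transition map of \<open>TM\<close> is \<open>(y, z) \<mapsto> (\<phi> y, D\<phi>(y) z)\<close> for a transition map \<open>\<phi>\<close> of \<open>M\<close>. As
  \<open>D\<phi>(y) z\<close> is linear in \<open>z\<close>, it is enough that \<open>D\<phi>(y) i\<close> is differentiable in \<open>y\<close> for the basis
  vectors \<open>i\<close>.\<close>
lemma differentiable_tangent_atlas:
  assumes "smooth_atlas A"
  shows "differentiable_atlas (tangent_atlas A)"
proof -
  interpret differentiable_manifold A
    by unfold_locales (rule smooth_atlas_imp_differentiable[OF assms])
  have op: "open (cmap (tchart A c) ` (cdom (tchart A c) \<inter> cdom (tchart A d)))"
    and im: "cmap (tchart A c) ` (cdom (tchart A c) \<inter> cdom (tchart A d)) = (cmap c ` (cdom c \<inter> cdom d)) \<times> UNIV"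
    if "c \<in> A" "d \<in> A" for c d
  proof -
    have "cdom (tchart A c) \<inter> cdom (tchart A d) = {u \<in> tangent_bundle A. fst u \<in> cdom c \<inter> cdom d}"
      by (auto simp: cdom_tchart)
    then show *: "cmap (tchart A c) ` (cdom (tchart A c) \<inter> cdom (tchart A d)) = (cmap c ` (cdom c \<inter> cdom d)) \<times> UNIV"
      using tchart_image[of c "cdom c \<inter> cdom d"] that by simp
    show "open (cmap (tchart A c) ` (cdom (tchart A c) \<inter> cdom (tchart A d)))"
      unfolding * using open_overlap that by (simp add: open_Times)
  qed
  have "(cmap (tchart A d) \<circ> cinv (tchart A c)) differentiable (at w)"
    if c: "c \<in> A" and d: "d \<in> A" and w: "w \<in> (cmap c ` (cdom c \<inter> cdom d)) \<times> UNIV" for c d w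
  proof -
    let ?U = "cmap c ` (cdom c \<inter> cdom d)"
    let ?\<phi> = "cmap d \<circ> cinv c"
    have sm: "smooth_on ?U ?\<phi>" using assms c d by (simp add: smooth_atlas_def)
    have w1: "fst w \<in> ?U" using w by auto
    have d1: "(\<lambda>w. ?\<phi> (fst w)) differentiable (at w)"
      using differentiable_chain_at[of fst w ?\<phi>] smooth_on_differentiable[OF sm w1]
      by (simp add: o_def bounded_linear_imp_differentiable bounded_linear_fst)
    have d2: "(\<lambda>w. frechet_derivative ?\<phi> (at (fst w)) i) differentiable (at w)" for i
      using differentiable_chain_at[of fst w "\<lambda>y. frechet_derivative ?\<phi> (at y) i"]
        smooth_on_differentiable[OF smooth_on_directional[OF sm] w1]
      by (simp add: o_def bounded_linear_imp_differentiable bounded_linear_fst)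
    have d3: "(\<lambda>w. snd w \<bullet> i) differentiable (at w)" for i :: 'b
      by (intro bounded_linear_imp_differentiable bounded_linear_compose[OF bounded_linear_inner_left]
          bounded_linear_snd)
    have "(\<lambda>w. (?\<phi> (fst w), \<Sum>i\<in>Basis. (snd w \<bullet> i) *\<^sub>R frechet_derivative ?\<phi> (at (fst w)) i))
      differentiable (at w)"
      by (intro differentiable_Pair d1 differentiable_sum ballI differentiable_scaleR d2 d3) simp
    moreover have "(?\<phi> (fst z), \<Sum>i\<in>Basis. (snd z \<bullet> i) *\<^sub>R frechet_derivative ?\<phi> (at (fst z)) i) =
        (cmap (tchart A d) \<circ> cinv (tchart A c)) z" if z: "z \<in> ?U \<times> UNIV" for z
    proof -
      obtain q where q: "q \<in> cdom c" "q \<in> cdom d" "fst z = cmap c q" using z by auto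
      have "cinv (tchart A c) (fst z, snd z) = mk_tvec A q c (snd z)"
        using cinv_tchart[OF c, of "cmap c q" "snd z"] q c by simp
      then have "cinv (tchart A c) z = mk_tvec A q c (snd z)" by simp
      then have "(cmap (tchart A d) \<circ> cinv (tchart A c)) z = (cmap d q, transition c d q (snd z))"
        using d q by (simp add: cmap_tchart snd_mk_tvec)
      moreover have "transition c d q (snd z) =
          (\<Sum>i\<in>Basis. (snd z \<bullet> i) *\<^sub>R frechet_derivative ?\<phi> (at (fst z)) i)"
        unfolding q(3) by (rule linear_expand_Basis[OF transition_linear[OF c d q(1,2)]])
      ultimately show ?thesis using q c by simp
    qed
    moreover have "open (?U \<times> (UNIV :: 'b set))" using open_overlap[OF c d] by (simp add: open_Times)
    ultimately show ?thesis
      using w unfolding differentiable_def by (meson has_derivative_transform_within_open)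
  qed
  note diff = this
  show ?thesis
    unfolding differentiable_atlas_def tangent_atlas_def
  proof (intro conjI ballI)
    fix C assume "C \<in> tchart A ` A"
    then obtain c where c: "c \<in> A" "C = tchart A c" by blast
    show "inj_on (cmap C) (cdom C)" unfolding c(2) by (rule inj_tchart[OF c(1)])
    fix D assume "D \<in> tchart A ` A"
    then obtain d where d: "d \<in> A" "D = tchart A d" by blast
    show "open (cmap C ` (cdom C \<inter> cdom D))" unfolding c(2) d(2) by (rule op[OF c(1) d(1)])
    show "(cmap D \<circ> cinv C) differentiable (at y)" if "y \<in> cmap C ` (cdom C \<inter> cdom D)" for y
      using diff[OF c(1) d(1)] that unfolding c(2) d(2) im[OF c(1) d(1)] by blast
  qed
qed

locale smooth_manifold_atlas =
  fixes A :: "('a, 'e::euclidean_space) chart set"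
  assumes smooth: "smooth_atlas A"
begin

sublocale differentiable_manifold A
  by unfold_locales (rule smooth_atlas_imp_differentiable[OF smooth])

sublocale TM: differentiable_manifold "tangent_atlas A"
  by unfold_locales (rule differentiable_tangent_atlas[OF smooth])

lemma projection_in_charts:
  assumes "c \<in> A" "d \<in> A" "u \<in> tangent_bundle A" "fst u \<in> cdom c" "fst u \<in> cdom d"
  shows "((cmap d \<circ> fst \<circ> cinv (tchart A c)) has_derivative
      (\<lambda>z. transition c d (fst u) (fst z))) (at (cmap (tchart A c) u))"
    and "open (cmap (tchart A c) ` (cdom (tchart A c) \<inter> fst -` cdom d))"
proof -
  let ?U = "cmap c ` (cdom c \<inter> cdom d)"
  have "cdom (tchart A c) \<inter> fst -` cdom d = {u \<in> tangent_bundle A. fst u \<in> cdom c \<inter> cdom d}"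
    by (auto simp: cdom_tchart)
  then have im: "cmap (tchart A c) ` (cdom (tchart A c) \<inter> fst -` cdom d) = ?U \<times> UNIV"
    using tchart_image[of c "cdom c \<inter> cdom d"] assms by simp
  show op: "open (cmap (tchart A c) ` (cdom (tchart A c) \<inter> fst -` cdom d))"
    unfolding im using open_overlap assms by (simp add: open_Times)
  have "((cmap d \<circ> cinv c) has_derivative transition c d (fst u)) (at (fst (cmap (tchart A c) u)))"
    using transition_differentiable[OF assms(1,2,4,5)]
    unfolding cmap_tchart fst_conv frechet_derivative_works .
  from has_derivative_compose[OF has_derivative_fst[OF has_derivative_ident] this]
  have "((\<lambda>z. (cmap d \<circ> cinv c) (fst z)) has_derivative (\<lambda>z. transition c d (fst u) (fst z)))
      (at (cmap (tchart A c) u))" .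
  then show "((cmap d \<circ> fst \<circ> cinv (tchart A c)) has_derivative
      (\<lambda>z. transition c d (fst u) (fst z))) (at (cmap (tchart A c) u))"
  proof (rule has_derivative_transform_within_open[OF _ op])
    show "cmap (tchart A c) u \<in> cmap (tchart A c) ` (cdom (tchart A c) \<inter> fst -` cdom d)"
      using assms by (auto simp: cdom_tchart)
    fix z assume "z \<in> cmap (tchart A c) ` (cdom (tchart A c) \<inter> fst -` cdom d)"
    then obtain q where "q \<in> cdom c" "q \<in> cdom d" "fst z = cmap c q" unfolding im by auto
    then have "cinv (tchart A c) (fst z, snd z) = mk_tvec A (cinv c (fst z)) c (snd z)"
      by (intro cinv_tchart[OF assms(1)]) blast
    then have "cinv (tchart A c) z = mk_tvec A (cinv c (fst z)) c (snd z)" by simp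
    then show "(cmap d \<circ> cinv c) (fst z) = (cmap d \<circ> fst \<circ> cinv (tchart A c)) z" by simp
  qed
qed

lemma tmap_projection:
  assumes "w \<in> tspace (tangent_atlas A) u" "c \<in> A" "fst u \<in> cdom c"
  shows "tmap (tangent_atlas A) A fst w \<in> tspace A (fst u)"
    and "snd (tmap (tangent_atlas A) A fst w) c = fst (snd w (tchart A c))"
proof -
  have u: "u \<in> tangent_bundle A" using tspaceD(2)[OF assms(1)] by (simp add: carrier_tangent_atlas)
  have D: "differentiable_map_at (tangent_atlas A) A fst u"
    unfolding differentiable_map_at_def
  proof (intro ballI impI)
    fix C d assume "C \<in> tangent_atlas A" and d: "d \<in> A" and "u \<in> cdom C" and ud: "fst u \<in> cdom d"
    then obtain c where c: "c \<in> A" "C = tchart A c" "fst u \<in> cdom c"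
      by (auto simp: tangent_atlas_def cdom_tchart)
    show "open (cmap C ` (cdom C \<inter> fst -` cdom d)) \<and>
        (cmap d \<circ> fst \<circ> cinv C) differentiable (at (cmap C u))"
      unfolding c(2) using projection_in_charts[OF c(1) d u c(3) ud] differentiableI by blast
  qed
  note * = tmap_in_charts[OF TM.differentiable_manifold_axioms differentiable_manifold_axioms D assms(1),
      of "tchart A c" c]
  show "tmap (tangent_atlas A) A fst w \<in> tspace A (fst u)"
    using *(1) assms u by (simp add: tchart_in_atlas cdom_tchart)
  have "snd (tmap (tangent_atlas A) A fst w) c = chart_derivative (tchart A c) c fst u (snd w (tchart A c))"
    using *(2) assms u by (simp add: tchart_in_atlas cdom_tchart)
  also have "\<dots> = transition c c (fst u) (fst (snd w (tchart A c)))"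
    using frechet_derivative_at[OF projection_in_charts(1)[OF assms(2,2) u assms(3,3)]] by metis
  finally show "snd (tmap (tangent_atlas A) A fst w) c = fst (snd w (tchart A c))"
    using assms by (simp add: transition_same)
qed

lemma vertical_lift_in_chart:
  assumes "u \<in> tangent_bundle A"
  shows "fst (vertical_lift A u z) = u"
    and "snd (vertical_lift A u z) (tchart A (chart_at A (fst u))) = (0, snd z (chart_at A (fst u)))"
proof -
  let ?c = "chart_at A (fst u)"
  have "fst u \<in> carrier A" using assms by (auto simp: tangent_bundle_def)
  from chart_at[OF this] have c: "?c \<in> A" "fst u \<in> cdom ?c" .
  show "fst (vertical_lift A u z) = u" by (simp add: vertical_lift_def Let_def)
  show "snd (vertical_lift A u z) (tchart A ?c) = (0, snd z ?c)"
    unfolding vertical_lift_def Let_def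
    by (rule TM.snd_mk_tvec_same) (use c assms in \<open>simp_all add: tchart_in_atlas cdom_tchart\<close>)
qed

end

section \<open>Christoffel symbols in a chart\<close>

lemma bilinear_expand_Basis:
  fixes h :: "'e::euclidean_space \<Rightarrow> 'e \<Rightarrow> real"
  assumes "bilinear h"
  shows "h a b = (\<Sum>i\<in>Basis. \<Sum>j\<in>Basis. (a \<bullet> i) * (b \<bullet> j) * h i j)"
proof -
  have l: "linear (\<lambda>a. h a b)" and r: "\<And>i. linear (h i)" using assms by (simp_all add: bilinear_def)
  have "h a b = (\<Sum>i\<in>Basis. (a \<bullet> i) * h i b)"
    using linear_expand_Basis[OF l, of a] by simp
  also have "\<dots> = (\<Sum>i\<in>Basis. (a \<bullet> i) * (\<Sum>j\<in>Basis. (b \<bullet> j) * h i j))"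
    using linear_expand_Basis[OF r, of _ b] by simp
  finally show ?thesis by (simp add: sum_distrib_left mult.assoc)
qed

text \<open>The Christoffel symbols at \<open>y\<close> of the Levi-Civita connection of a metric \<open>G\<close> on an open set of a
  Euclidean space: torsion-free and compatible with \<open>G\<close>.\<close>
definition christoffel_form :: "('e::euclidean_space \<Rightarrow> 'e \<Rightarrow> 'e \<Rightarrow> real) \<Rightarrow> 'e \<Rightarrow> ('e \<Rightarrow> 'e \<Rightarrow> 'e) \<Rightarrow> bool" where
  "christoffel_form G y \<Gamma> \<longleftrightarrow> bilinear \<Gamma> \<and> (\<forall>a b. \<Gamma> a b = \<Gamma> b a) \<and>
     (\<forall>a b e. frechet_derivative (\<lambda>z. G z b e) (at y) a = G y (\<Gamma> a b) e + G y b (\<Gamma> a e))"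

locale local_inner_form =
  fixes G :: "'e::euclidean_space \<Rightarrow> 'e \<Rightarrow> 'e \<Rightarrow> real" and U :: "'e set" and y :: 'e
  assumes U: "open U" "y \<in> U"
    and inner: "z \<in> U \<Longrightarrow> inner_form (G z)"
    and diff: "(\<lambda>z. G z a b) differentiable (at y)"
begin

sublocale at_y: inner_form "G y"
  by (rule inner[OF U(2)])

definition dG :: "'e \<Rightarrow> 'e \<Rightarrow> 'e \<Rightarrow> real" where
  "dG a b e = frechet_derivative (\<lambda>z. G z b e) (at y) a"

lemma has_derivative_G: "((\<lambda>z. G z b e) has_derivative (\<lambda>a. dG a b e)) (at y)"
  unfolding dG_def using diff unfolding frechet_derivative_works .

lemma dG_eqI:
  assumes "((\<lambda>z. F z) has_derivative F') (at y)" and "\<And>z. z \<in> U \<Longrightarrow> F z = G z b e"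
  shows "dG a b e = F' a"
proof -
  have "((\<lambda>z. G z b e) has_derivative F') (at y)"
    by (rule has_derivative_transform_within_open[OF assms(1) U assms(2)])
  from frechet_derivative_at[OF this] show ?thesis unfolding dG_def by simp
qed

lemma dG_sym: "dG a b e = dG a e b"
  by (rule dG_eqI[OF has_derivative_G]) (simp add: inner_form.sym[OF inner])

lemma dG_linear: "linear (\<lambda>a. dG a b e)"
  using has_derivative_G by (rule has_derivative_linear)

lemma dG_bilinear: "bilinear (dG a)"
proof -
  have l: "linear (\<lambda>b. dG a b e)" for e
  proof (rule linearI)
    show "dG a (b + b') e = dG a b e + dG a b' e" for b b'
      by (rule dG_eqI[OF has_derivative_add[OF has_derivative_G has_derivative_G]])
        (simp add: inner_form.simps[OF inner])
    show "dG a (r *\<^sub>R b) e = r *\<^sub>R dG a b e" for r b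
      by (rule dG_eqI[OF has_derivative_scaleR_right[OF has_derivative_G]])
        (simp add: inner_form.simps[OF inner])
  qed
  have "(\<lambda>e. dG a b e) = (\<lambda>e. dG a e b)" for b by (rule ext) (rule dG_sym)
  with l have "linear (dG a b)" for b by metis
  with l show ?thesis by (simp add: bilinear_def)
qed

text \<open>The Koszul formula: permuting the arguments in the compatibility condition determines the form \<open>T\<close>
  that \<open>\<Gamma> a b\<close> represents, and conversely this choice is torsion-free and compatible.\<close>
lemma ex1_christoffel_form: "\<exists>!\<Gamma>. christoffel_form G y \<Gamma>"
proof -
  define T where "T a b e = (dG a b e + dG b a e - dG e a b) / 2" for a b e
  note b = bilinear_ladd[OF dG_bilinear] bilinear_radd[OF dG_bilinear]
    bilinear_lmul[OF dG_bilinear] bilinear_rmul[OF dG_bilinear]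
    linear_add[OF dG_linear] linear_cmul[OF dG_linear]
  have "linear (T a b)" for a b
    by (rule linearI) (simp_all add: T_def b algebra_simps add_divide_distrib diff_divide_distrib)
  then have "\<exists>z. \<forall>e. G y z e = T a b e" for a b by (rule at_y.riesz)
  then obtain \<Gamma> where \<Gamma>: "\<And>a b e. G y (\<Gamma> a b) e = T a b e" by metis
  have "bilinear \<Gamma>"
    unfolding bilinear_def
  proof (intro conjI allI linearI)
    fix a a' b b' and r :: real
    show "\<Gamma> a (b + b') = \<Gamma> a b + \<Gamma> a b'"
      by (rule at_y.eqI) (simp add: at_y.simps \<Gamma> T_def b algebra_simps add_divide_distrib diff_divide_distrib)
    show "\<Gamma> (a + a') b = \<Gamma> a b + \<Gamma> a' b"
      by (rule at_y.eqI) (simp add: at_y.simps \<Gamma> T_def b algebra_simps add_divide_distrib diff_divide_distrib)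
    show "\<Gamma> a (r *\<^sub>R b) = r *\<^sub>R \<Gamma> a b"
      by (rule at_y.eqI) (simp add: at_y.simps \<Gamma> T_def b algebra_simps)
    show "\<Gamma> (r *\<^sub>R a) b = r *\<^sub>R \<Gamma> a b"
      by (rule at_y.eqI) (simp add: at_y.simps \<Gamma> T_def b algebra_simps)
  qed
  moreover have "\<Gamma> a b = \<Gamma> b a" for a b
  proof (rule at_y.eqI)
    show "G y (\<Gamma> a b) e = G y (\<Gamma> b a) e" for e
      unfolding \<Gamma> T_def dG_sym[of e a b] by simp
  qed
  moreover have "dG a b e = G y (\<Gamma> a b) e + G y b (\<Gamma> a e)" for a b e
  proof -
    have "G y (\<Gamma> a b) e + G y b (\<Gamma> a e) = T a b e + T a e b"
      using at_y.sym[of b] by (simp add: \<Gamma>)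
    also have "\<dots> = dG a b e"
      using dG_sym[of a e b] by (simp add: T_def field_simps dG_sym[of b e a] dG_sym[of e b a])
    finally show ?thesis by simp
  qed
  ultimately have ex: "christoffel_form G y \<Gamma>" by (simp add: christoffel_form_def dG_def)
  have "\<Delta> = \<Gamma>" if "christoffel_form G y \<Delta>" for \<Delta>
  proof (intro ext at_y.eqI)
    fix a b e
    have s: "\<Delta> b a = \<Delta> a b" "\<Delta> e a = \<Delta> a e" "\<Delta> e b = \<Delta> b e"
      and m: "\<And>a b e. dG a b e = G y (\<Delta> a b) e + G y b (\<Delta> a e)"
      using that unfolding christoffel_form_def dG_def by blast+
    have "T a b e = (G y (\<Delta> a b) e + G y b (\<Delta> a e) + (G y (\<Delta> a b) e + G y a (\<Delta> b e))
        - (G y (\<Delta> a e) b + G y a (\<Delta> b e))) / 2"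
      unfolding T_def m s by simp
    then show "G y (\<Delta> a b) e = G y (\<Gamma> a b) e"
      using at_y.sym[of b "\<Delta> a e"] by (simp add: \<Gamma>)
  qed
  with ex show ?thesis by blast
qed

text \<open>The product rule for the inner product of two vector fields along a map \<open>F\<close>, obtained from the
  expansion in components.\<close>
lemma has_derivative_along_map:
  assumes F: "(F has_derivative F') (at x)" "F x = y"
    and X: "(X has_derivative X') (at x)" and Z: "(Z has_derivative Z') (at x)"
    and V: "open V" "x \<in> V" "\<And>z. z \<in> V \<Longrightarrow> F z \<in> U"
  shows "((\<lambda>z. G (F z) (X z) (Z z)) has_derivative
    (\<lambda>a. dG (F' a) (X x) (Z x) + G y (X' a) (Z x) + G y (X x) (Z' a))) (at x)"
proof -
  have 1: "((\<lambda>z. G (F z) i j) has_derivative (\<lambda>a. dG (F' a) i j)) (at x)" for i j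
    using has_derivative_compose[OF F(1), of "\<lambda>z. G z i j"] has_derivative_G[of i j] F(2) by simp
  have "((\<lambda>z. \<Sum>i\<in>Basis. \<Sum>j\<in>Basis. (X z \<bullet> i) * (Z z \<bullet> j) * G (F z) i j) has_derivative
    (\<lambda>a. \<Sum>i\<in>Basis. \<Sum>j\<in>Basis. (X x \<bullet> i) * (Z x \<bullet> j) * dG (F' a) i j +
      ((X x \<bullet> i) * (Z' a \<bullet> j) + (X' a \<bullet> i) * (Z x \<bullet> j)) * G (F x) i j)) (at x)"
    by (intro has_derivative_sum has_derivative_mult has_derivative_inner_left X Z 1)
  moreover have "(\<Sum>i\<in>Basis. \<Sum>j\<in>Basis. (X x \<bullet> i) * (Z x \<bullet> j) * dG (F' a) i j +
      ((X x \<bullet> i) * (Z' a \<bullet> j) + (X' a \<bullet> i) * (Z x \<bullet> j)) * G (F x) i j) =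
    dG (F' a) (X x) (Z x) + G y (X' a) (Z x) + G y (X x) (Z' a)" for a
    unfolding bilinear_expand_Basis[OF dG_bilinear, of "F' a" "X x" "Z x"]
      bilinear_expand_Basis[OF at_y.bilinear, of "X' a" "Z x"]
      bilinear_expand_Basis[OF at_y.bilinear, of "X x" "Z' a"] F(2)
    by (simp add: sum.distrib distrib_left distrib_right ac_simps)
  ultimately have "((\<lambda>z. \<Sum>i\<in>Basis. \<Sum>j\<in>Basis. (X z \<bullet> i) * (Z z \<bullet> j) * G (F z) i j) has_derivative
    (\<lambda>a. dG (F' a) (X x) (Z x) + G y (X' a) (Z x) + G y (X x) (Z' a))) (at x)"
    by simp
  then show ?thesis
    by (rule has_derivative_transform_within_open[OF _ V(1,2)])
      (use V(3) in \<open>simp add: bilinear_expand_Basis[OF inner_form.bilinear[OF inner], symmetric]\<close>)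
qed

text \<open>The field \<open>K\<close> is the covariant derivative of a unit normal field \<open>W\<close> along a map \<open>F\<close>.
  Differentiating \<open>\<langle>W, W\<rangle> = 1\<close> shows that \<open>K\<close> is tangential; differentiating \<open>\<langle>W, DF b\<rangle> = 0\<close> gives
  \<open>\<langle>K a, DF b\<rangle> = - \<langle>W, D\<^sup>2F(a, b) + \<Gamma>(DF a, DF b)\<rangle>\<close>, which is symmetric in \<open>a\<close> and \<open>b\<close>.\<close>
lemma covariant_derivative_of_unit_normal:
  fixes F W :: "'x::euclidean_space \<Rightarrow> 'e"
  assumes \<Gamma>: "christoffel_form G y \<Gamma>"
    and V: "open V" "x \<in> V" "\<And>z. z \<in> V \<Longrightarrow> F z \<in> U" and Fx: "F x = y"
    and F: "\<And>z. z \<in> V \<Longrightarrow> (F has_derivative F' z) (at z)"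
    and F'': "\<And>b. ((\<lambda>z. F' z b) has_derivative E b) (at x)"
    and W: "(W has_derivative W') (at x)"
    and unit: "\<And>z. z \<in> V \<Longrightarrow> G (F z) (W z) (W z) = 1"
    and normal: "\<And>z b. z \<in> V \<Longrightarrow> G (F z) (W z) (F' z b) = 0"
  defines "K \<equiv> \<lambda>a. W' a + \<Gamma> (F' x a) (W x)"
  shows "G y (K a) (W x) = 0"
    and "G y (K a) (F' x b) = G y (K b) (F' x a)"
    and "linear K"
proof -
  have m: "dG a b e = G y (\<Gamma> a b) e + G y b (\<Gamma> a e)" and s: "\<Gamma> a b = \<Gamma> b a" and bil: "bilinear \<Gamma>" for a b e
    using \<Gamma> by (auto simp: christoffel_form_def dG_def)
  have const: "f' a = 0" if "((\<lambda>z. G (F z) (X z) (Z z)) has_derivative f') (at x)"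
    and "\<And>z. z \<in> V \<Longrightarrow> G (F z) (X z) (Z z) = c" for f' X Z c a
  proof -
    have "((\<lambda>z. c) has_derivative f') (at x)"
      by (rule has_derivative_transform_within_open[OF that(1) V(1,2) that(2)])
    then have "f' = (\<lambda>_. 0)" using has_derivative_const has_derivative_unique by blast
    then show ?thesis by simp
  qed
  note D = has_derivative_along_map[OF F[OF V(2)] Fx W _ V]
  have "dG (F' x a) (W x) (W x) + G y (W' a) (W x) + G y (W x) (W' a) = 0"
    by (rule const[OF D[OF W] unit])
  then show "G y (K a) (W x) = 0"
    using at_y.sym[of "W x"] by (simp add: m K_def at_y.simps)
  have K: "G y (K a) (F' x b) = - G y (W x) (E b a + \<Gamma> (F' x a) (F' x b))" for a b
  proof -
    have "dG (F' x a) (W x) (F' x b) + G y (W' a) (F' x b) + G y (W x) (E b a) = 0"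
      by (rule const[OF D[OF F''] normal])
    then show ?thesis by (simp add: m K_def at_y.simps)
  qed
  have "E b a = E a b"
    by (rule second_derivative_symmetric[OF V(1,2) F F'' F''])
  then show "G y (K a) (F' x b) = G y (K b) (F' x a)"
    unfolding K using s[of "F' x a"] by simp
  show "linear K"
    unfolding K_def
  proof (rule linear_compose_add)
    show "linear W'" using W by (rule has_derivative_linear)
    have "linear (\<lambda>b. \<Gamma> b (W x))" using bil by (simp add: bilinear_def)
    from linear_compose[OF has_derivative_linear[OF F[OF V(2)]] this]
    show "linear (\<lambda>a. \<Gamma> (F' x a) (W x))" by (simp add: o_def)
  qed
qed

end

section \<open>The unit normal of a hyperplane\<close>

lemma bordered_det_expand:
  fixes w :: "real ^ ('n::finite option)"
  shows "bordered_det w T = (\<Sum>p | p permutes UNIV. of_int (sign p) * (w $ p None * (\<Prod>j\<in>UNIV. T (axis j 1) $ p (Some j))))"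
  by (simp add: bordered_det_def det_colmat_sum UNIV_option_conv prod.reindex)

lemma bordered_det_linear: "linear (\<lambda>w. bordered_det w T)"
  unfolding bordered_det_expand
  by (rule linearI) (simp_all add: algebra_simps sum.distrib sum_distrib_left)

lemma det_nonzero_iff_inj:
  fixes A :: "real ^ 'k ^ 'k::finite"
  shows "det A \<noteq> 0 \<longleftrightarrow> inj ((*v) A)"
  using det_nz_iff_inj[of "(*v) A"] by simp

lemma colmat_normal_mult:
  fixes w :: "real ^ ('n::finite option)" and T :: "real ^ 'n \<Rightarrow> real ^ ('n option)"
  assumes "linear T"
  shows "colmat (case_option w (\<lambda>j. T (axis j 1))) *v a = a $ None *\<^sub>R w + T (\<chi> j. a $ Some j)"
  using linear_expand_axis[OF assms, of "\<chi> j. a $ Some j"]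
  by (simp add: colmat_mult_vec sum_UNIV_option)

lemma bordered_det_nonzero_iff:
  fixes w :: "real ^ ('n::finite option)"
  assumes "linear T" "inj T"
  shows "bordered_det w T \<noteq> 0 \<longleftrightarrow> w \<notin> range T"
proof -
  let ?A = "colmat (case_option w (\<lambda>j. T (axis j 1)))"
  have "bordered_det w T \<noteq> 0 \<longleftrightarrow> inj ((*v) ?A)"
    unfolding bordered_det_def by (rule det_nonzero_iff_inj)
  also have "\<dots> \<longleftrightarrow> (\<forall>a. ?A *v a = 0 \<longrightarrow> a = 0)"
    by (rule linear_injective_0) simp
  also have "\<dots> \<longleftrightarrow> w \<notin> range T"
  proof
    assume l: "\<forall>a. ?A *v a = 0 \<longrightarrow> a = 0"
    show "w \<notin> range T"
    proof
      assume "w \<in> range T"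
      then obtain b where b: "w = T b" by auto
      let ?a = "(\<chi> r. case r of None \<Rightarrow> - 1 | Some j \<Rightarrow> b $ j) :: real ^ ('n option)"
      have "(\<chi> j. ?a $ Some j) = b" by (simp add: vec_eq_iff)
      then have "?A *v ?a = 0" by (simp add: colmat_normal_mult[OF assms(1)] b)
      then have "?a $ None = 0" using l by (metis zero_index)
      then show False by simp
    qed
  next
    assume r: "w \<notin> range T"
    show "\<forall>a. ?A *v a = 0 \<longrightarrow> a = 0"
    proof (intro allI impI)
      fix a assume "?A *v a = 0"
      then have e: "a $ None *\<^sub>R w + T (\<chi> j. a $ Some j) = 0"
        by (simp add: colmat_normal_mult[OF assms(1)])
      have n: "a $ None = 0"
      proof (rule ccontr)
        assume ne: "a $ None \<noteq> 0"
        have "a $ None *\<^sub>R w = T (- (\<chi> j. a $ Some j))"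
          using e by (simp add: linear_neg[OF assms(1)] eq_neg_iff_add_eq_0)
        then have "(1 / a $ None) *\<^sub>R a $ None *\<^sub>R w = T ((1 / a $ None) *\<^sub>R - (\<chi> j. a $ Some j))"
          by (simp only: linear_cmul[OF assms(1)])
        then have "w = T ((1 / a $ None) *\<^sub>R - (\<chi> j. a $ Some j))" using ne by simp
        with r show False by blast
      qed
      with e have "T (\<chi> j. a $ Some j) = 0" by simp
      then have "(\<chi> j. a $ Some j) = 0" using assms linear_injective_0 by blast
      then have "a $ Some j = 0" for j by (simp add: vec_eq_iff)
      with n show "a = 0" unfolding vec_eq_iff by (metis option.exhaust zero_index)
    qed
  qed
  finally show ?thesis .
qed

lemma ex_not_in_range_option:
  fixes T :: "real ^ 'n::finite \<Rightarrow> real ^ ('n option)"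
  assumes "linear T"
  shows "\<exists>w. w \<notin> range T"
proof (rule ccontr)
  assume "\<not> ?thesis"
  then have "range T = UNIV" by auto
  moreover have "dim (range T) \<le> dim (UNIV :: (real ^ 'n) set)"
    using assms by (rule dim_image_le)
  ultimately show False by simp
qed

text \<open>The sign of the determinant encodes the orientation: \<open>w\<close> comes first in a direct frame.\<close>
definition is_unit_normal ::
  "(real ^ ('n::finite option) \<Rightarrow> real ^ ('n option) \<Rightarrow> real) \<Rightarrow> (real ^ 'n \<Rightarrow> real ^ ('n option)) \<Rightarrow>
   real ^ ('n option) \<Rightarrow> bool" where
  "is_unit_normal G T w \<longleftrightarrow> G w w = 1 \<and> (\<forall>b. G w (T b) = 0) \<and> 0 < bordered_det w T"

definition gram :: "(real ^ 'k::finite \<Rightarrow> real ^ 'k \<Rightarrow> real) \<Rightarrow> real ^ 'k ^ 'k" where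
  "gram G = (\<chi> i j. G (axis i 1) (axis j 1))"

lemma eq_normal_plus_tangential:
  fixes T :: "real ^ 'n::finite \<Rightarrow> real ^ ('n option)"
  assumes "linear T" "0 \<noteq> bordered_det w T"
  shows "\<exists>r b. z = r *\<^sub>R w + T b"
proof -
  have "invertible (colmat (case_option w (\<lambda>j. T (axis j 1))))"
    using assms(2) by (simp add: invertible_det_nz bordered_det_def)
  then obtain B where "colmat (case_option w (\<lambda>j. T (axis j 1))) ** B = mat 1"
    by (auto simp: invertible_def)
  then have "colmat (case_option w (\<lambda>j. T (axis j 1))) *v (B *v z) = z"
    by (simp add: matrix_vector_mul_assoc)
  then show ?thesis unfolding colmat_normal_mult[OF assms(1)] by metis
qed

context
  fixes G :: "real ^ ('n::finite option) \<Rightarrow> real ^ ('n option) \<Rightarrow> real"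
    and T :: "real ^ 'n \<Rightarrow> real ^ ('n option)"
  assumes G: "inner_form G" and T: "linear T" "inj T"
begin

interpretation inner_form G by (rule G)

lemma orthogonal_to_normal_in_range:
  assumes "is_unit_normal G T w" "G z w = 0"
  shows "\<exists>b. z = T b"
proof -
  have w: "G w w = 1" "\<And>b. G w (T b) = 0" "bordered_det w T \<noteq> 0"
    using assms(1) by (auto simp: is_unit_normal_def)
  from eq_normal_plus_tangential[OF T(1) w(3)[symmetric]] obtain r b where "z = r *\<^sub>R w + T b" by metis
  moreover from this have "r = 0" using assms(2) w sym[of "T b" w] by (simp add: simps)
  ultimately show ?thesis by auto
qed

text \<open>The difference of \<open>w'\<close> and its projection to \<open>w\<close> is tangential and orthogonal to all tangential
  vectors, so \<open>w'\<close> is a multiple of \<open>w\<close>; length and orientation fix the factor.\<close>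
lemma is_unit_normal_unique:
  assumes w: "is_unit_normal G T w" and w': "is_unit_normal G T w'"
  shows "w' = w"
proof -
  define r where "r = G w' w"
  have "G (w' - r *\<^sub>R w) w = 0" using w by (simp add: r_def simps is_unit_normal_def)
  from orthogonal_to_normal_in_range[OF w this] obtain b where b: "w' - r *\<^sub>R w = T b" by auto
  have "G (T b) (T b) = G (w' - r *\<^sub>R w) (T b)" using b by simp
  also have "\<dots> = 0" using w w' by (simp add: simps is_unit_normal_def)
  finally have "T b = 0" by (simp add: eq_zero_iff)
  with b have e: "w' = r *\<^sub>R w" by simp
  have "r * r = 1" using w w' by (simp add: e simps is_unit_normal_def)
  moreover have "0 < r * bordered_det w T"
    using w' linear_cmul[OF bordered_det_linear, of r w T] by (simp add: e is_unit_normal_def)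
  then have "0 < r" using w by (simp add: is_unit_normal_def zero_less_mult_iff)
  ultimately have "r = 1" by (simp add: square_eq_1_iff)
  with e show ?thesis by simp
qed

text \<open>The function \<open>bordered_det\<close> vanishes exactly on the image of \<open>T\<close>, so its gradient \<open>X\<close> is a nonzero
  normal vector; it points to the right side since its own value is \<open>G X X > 0\<close>.\<close>
lemma normalized_gradient_of_bordered_det:
  assumes X: "\<And>e. G X e = bordered_det e T"
  shows "0 < G X X" and "is_unit_normal G T ((1 / sqrt (G X X)) *\<^sub>R X)"
proof -
  obtain e where "e \<notin> range T" using ex_not_in_range_option[OF T(1)] by auto
  then have "G X e \<noteq> 0" using bordered_det_nonzero_iff[OF T] X by simp
  then have "X \<noteq> 0" by (auto simp: simps)
  then show p: "0 < G X X" by (rule pos)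
  have "G X (T b) = 0" for b using bordered_det_nonzero_iff[OF T, of "T b"] by (auto simp: X)
  moreover have "0 < bordered_det ((1 / sqrt (G X X)) *\<^sub>R X) T"
    using p linear_cmul[OF bordered_det_linear, of "1 / sqrt (G X X)" X T] X[of X] by simp
  moreover have "(1 / sqrt (G X X)) * ((1 / sqrt (G X X)) * G X X) = 1" using p by simp
  ultimately show "is_unit_normal G T ((1 / sqrt (G X X)) *\<^sub>R X)"
    unfolding is_unit_normal_def by (simp add: simps)
qed

lemma is_unit_normal_exists: "\<exists>w. is_unit_normal G T w"
proof -
  obtain X where "\<And>e. G X e = bordered_det e T"
    using riesz[OF bordered_det_linear[of T]] by auto
  from normalized_gradient_of_bordered_det(2)[OF this] show ?thesis by blast
qed

end

lemma inner_form_gram_mult: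
  assumes "inner_form G"
  shows "(gram G *v a) $ i = G (axis i 1) a"
proof -
  interpret inner_form G by fact
  show ?thesis
    using linear_expand_axis[OF linear_right, of "axis i 1" a]
    by (simp add: gram_def matrix_vector_mult_def mult.commute)
qed

lemma det_gram_nonzero:
  assumes "inner_form G"
  shows "det (gram G) \<noteq> 0"
proof -
  interpret inner_form G by fact
  have "a = 0" if "gram G *v a = 0" for a
  proof (rule eqI)
    have "G (axis i 1) a = 0" for i using inner_form_gram_mult[OF assms, of a i] that by simp
    then show "G a e = G 0 e" for e
      using linear_expand_axis[OF linear_right, of a e] sym[of a] by (simp add: simps)
  qed
  then have "inj ((*v) (gram G))" by (subst linear_injective_0) auto
  then show ?thesis by (simp add: det_nonzero_iff_inj)
qed

text \<open>The matrix \<open>P\<close> with the orthonormal columns \<open>u\<close> satisfies \<open>P\<^sup>T (gram G) P = 1\<close>; take determinants.\<close>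
lemma gram_vol_orthonormal:
  fixes G :: "real ^ 'k::finite \<Rightarrow> real ^ 'k \<Rightarrow> real"
  assumes "inner_form G" and on: "\<And>i j. G (u i) (u j) = (if i = j then 1 else 0)"
    and d: "0 < det (colmat u)"
  shows "sqrt (det (gram G)) * det (colmat u) = 1"
proof -
  interpret inner_form G by fact
  have "transpose (colmat u) ** (gram G ** colmat u) = mat 1"
  proof -
    have "(transpose (colmat u) ** (gram G ** colmat u)) $ i $ j = mat 1 $ i $ j" for i j
    proof -
      have "(gram G ** colmat u) $ k $ j = G (axis k 1) (u j)" for k
        by (simp add: matrix_mul_colmat inner_form_gram_mult[OF assms(1)])
      then have "(transpose (colmat u) ** (gram G ** colmat u)) $ i $ j = (\<Sum>k\<in>UNIV. u i $ k * G (axis k 1) (u j))"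
        by (subst matrix_matrix_mult_def) (simp add: transpose_def)
      also have "\<dots> = G (u i) (u j)"
        using linear_expand_axis[OF linear_left, of "u i" "u j"] by simp
      finally show ?thesis by (simp add: on mat_def)
    qed
    then show ?thesis by (simp add: vec_eq_iff)
  qed
  then have "det (transpose (colmat u) ** (gram G ** colmat u)) = 1" by simp
  then have "det (gram G) * (det (colmat u))\<^sup>2 = 1"
    by (simp add: det_mul power2_eq_square mult_ac)
  then have "sqrt (det (gram G)) * sqrt ((det (colmat u))\<^sup>2) = 1"
    by (metis real_sqrt_mult real_sqrt_one)
  then show ?thesis using d by simp
qed

lemma differentiable_sqrt:
  fixes F :: "'e::real_normed_vector \<Rightarrow> real"
  assumes "F differentiable (at x)" "0 < F x"
  shows "(\<lambda>z. sqrt (F z)) differentiable (at x)"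
  using assms unfolding differentiable_def by (blast intro: has_derivative_real_sqrt)

text \<open>The vector \<open>X\<close> below solves the linear system for the gradient of \<open>bordered_det\<close> by Cramer's rule,
  so it is a quotient of polynomials in the entries of the metric and of \<open>T\<close>. By uniqueness \<open>W\<close> is
  its normalization.\<close>
lemma differentiable_unit_normal:
  fixes G :: "'x::euclidean_space \<Rightarrow> real ^ ('n::finite option) \<Rightarrow> real ^ ('n option) \<Rightarrow> real"
  assumes V: "open V" "x \<in> V"
    and G: "\<And>z. z \<in> V \<Longrightarrow> inner_form (G z)"
    and T: "\<And>z. z \<in> V \<Longrightarrow> linear (T z)" "\<And>z. z \<in> V \<Longrightarrow> inj (T z)"
    and dG: "\<And>a b. (\<lambda>z. G z a b) differentiable (at x)"
    and dT: "\<And>b. (\<lambda>z. T z b) differentiable (at x)"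
    and W: "\<And>z. z \<in> V \<Longrightarrow> is_unit_normal (G z) (T z) (W z)"
  shows "W differentiable (at x)"
proof -
  define \<beta> where "\<beta> z = (\<chi> i. bordered_det (axis i 1) (T z))" for z
  define X where "X z = (\<chi> k. det (\<chi> i j. if j = k then \<beta> z $ i else gram (G z) $ i $ j) / det (gram (G z)))" for z
  define W0 where "W0 z = (1 / sqrt (bordered_det (X z) (T z))) *\<^sub>R X z" for z
  have GX: "G z (X z) e = bordered_det e (T z)" if z: "z \<in> V" for z e
  proof -
    interpret inner_form "G z" by (rule G[OF z])
    have "gram (G z) *v X z = \<beta> z"
      using cramer[OF det_gram_nonzero[OF G[OF z]], of "X z" "\<beta> z"] by (simp add: X_def)
    then have "G z (axis i 1) (X z) = bordered_det (axis i 1) (T z)" for i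
      using inner_form_gram_mult[OF G[OF z], of "X z" i] by (simp add: \<beta>_def)
    then show ?thesis
      using linear_expand_axis[OF linear_right, of "X z" e]
        linear_expand_axis[OF bordered_det_linear, of e "T z"] sym[of "X z"] by simp
  qed
  have eq: "W0 z = W z" if z: "z \<in> V" for z
    using is_unit_normal_unique[OF G[OF z] T[OF z] W[OF z]]
      normalized_gradient_of_bordered_det(2)[OF G[OF z] T[OF z] GX[OF z]] GX[OF z]
    by (simp add: W0_def)
  have dTc: "(\<lambda>z. T z b $ k) differentiable (at x)" for b k
    using dT[of b] by (simp add: differentiable_vec_componentwise)
  have d\<beta>: "(\<lambda>z. \<beta> z $ i) differentiable (at x)" for i
  proof -
    have "(\<lambda>z. det (colmat (case_option (axis i 1) (\<lambda>j. T z (axis j 1))))) differentiable (at x)"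
    proof (rule differentiable_det)
      fix r s
      show "(\<lambda>z. colmat (case_option (axis i 1) (\<lambda>j. T z (axis j 1))) $ r $ s) differentiable (at x)"
        by (cases s) (simp_all add: dTc)
    qed
    then show ?thesis by (simp add: \<beta>_def bordered_det_def)
  qed
  have ddet: "(\<lambda>z. det (\<chi> i j. if j = k then \<beta> z $ i else gram (G z) $ i $ j)) differentiable (at x)" for k
  proof (rule differentiable_det)
    fix r s
    show "(\<lambda>z. (\<chi> i j. if j = k then \<beta> z $ i else gram (G z) $ i $ j) $ r $ s) differentiable (at x)"
      using d\<beta> dG by (cases "s = k") (simp_all add: gram_def)
  qed
  have dgram: "(\<lambda>z. det (gram (G z))) differentiable (at x)"
    by (rule differentiable_det) (simp add: gram_def dG)
  have dXc: "(\<lambda>z. X z $ k) differentiable (at x)" for k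
    using differentiable_divide[OF ddet dgram det_gram_nonzero[OF G[OF V(2)]]] by (simp add: X_def)
  have dX: "X differentiable (at x)" using dXc by (simp add: differentiable_vec_componentwise)
  have "bordered_det (X z) (T z) = (\<Sum>i\<in>UNIV. X z $ i * \<beta> z $ i)" for z
    using linear_expand_axis[OF bordered_det_linear, of "X z" "T z"] by (simp add: \<beta>_def)
  moreover have "(\<lambda>z. \<Sum>i\<in>UNIV. X z $ i * \<beta> z $ i) differentiable (at x)"
    by (intro differentiable_sum ballI differentiable_mult dXc d\<beta>) simp
  ultimately have dB: "(\<lambda>z. bordered_det (X z) (T z)) differentiable (at x)" by simp
  have p: "0 < bordered_det (X x) (T x)"
    using normalized_gradient_of_bordered_det(1)[OF G[OF V(2)] T[OF V(2)] GX[OF V(2)]] GX[OF V(2)] by simp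
  have "W0 differentiable (at x)"
    unfolding W0_def
    by (intro differentiable_scaleR differentiable_divide differentiable_const differentiable_sqrt dB dX p)
      (use p in simp)
  then show ?thesis
    using eq V unfolding differentiable_def by (meson has_derivative_transform_within_open)
qed

section \<open>Riemannian manifolds in charts\<close>

lemma comp_matrix_eq_colmat: "comp_matrix c v = colmat (\<lambda>j. snd (v j) c)"
  by (simp add: comp_matrix_def colmat_def)

locale riemannian_manifold = smooth_manifold_atlas A
  for A :: "('a, 'e::euclidean_space) chart set" +
  fixes g :: "('a, 'e) metric"
  assumes metric: "riemannian_metric A g"
begin

lemma local_inner_form:
  assumes "c \<in> A" "y \<in> cmap c ` cdom c"
  shows "inner_form (local_metric A g c y)"
  using metric assms unfolding riemannian_metric_def by (intro inner_form.intro) blast+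

lemma metric_in_chart:
  assumes "v \<in> tspace A p" "w \<in> tspace A p" "c \<in> A" "p \<in> cdom c"
  shows "g v w = local_metric A g c (cmap c p) (snd v c) (snd w c)"
  using assms by (simp add: local_metric_def mk_tvec_snd)

lemma local_metric_differentiable:
  assumes "c \<in> A" "y \<in> cmap c ` cdom c"
  shows "(\<lambda>z. local_metric A g c z a b) differentiable (at y)"
proof -
  have "smooth_on (cmap c ` cdom c) (\<lambda>y. local_metric A g c y a b)"
    using metric assms(1) unfolding riemannian_metric_def by blast
  then show ?thesis using assms(2) by (rule smooth_on_differentiable)
qed

lemma local_inner_form_field:
  assumes "c \<in> A" "y \<in> cmap c ` cdom c"
  shows "local_inner_form (local_metric A g c) (cmap c ` cdom c) y"
  by (rule local_inner_form.intro[OF open_image[OF assms(1)] assms(2) local_inner_form[OF assms(1)]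
        local_metric_differentiable[OF assms]])

lemma levi_civita_christoffel_form:
  assumes "c \<in> A" "y \<in> cmap c ` cdom c"
  shows "christoffel_form (local_metric A g c) y (levi_civita A g c y)"
  using theI'[OF local_inner_form.ex1_christoffel_form[OF local_inner_form_field[OF assms]]]
  unfolding levi_civita_def christoffel_form_def .

lemma levi_civita_bilinear:
  assumes "c \<in> A" "y \<in> cmap c ` cdom c"
  shows "bilinear (levi_civita A g c y)"
  using levi_civita_christoffel_form[OF assms] by (simp add: christoffel_form_def)

text \<open>The connection map, like the volume form, refers to the chart \<open>chart_at A p\<close>, so all computations
  at a point take place in that chart.\<close>
lemma connection_map_in_chart:
  assumes "fst (fst w) = p" "p \<in> carrier A" "c = chart_at A p"
  shows "connection_map A g w \<in> tspace A p"
    and "snd (connection_map A g w) c =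
      snd (snd w (tchart A c)) + levi_civita A g c (cmap c p) (fst (snd w (tchart A c))) (snd (fst w) c)"
proof -
  have c: "c \<in> A" "p \<in> cdom c" using chart_at[OF assms(2)] by (simp_all add: assms(3))
  have "connection_map A g w = mk_tvec A p c
      (snd (snd w (tchart A c)) + levi_civita A g c (cmap c p) (fst (snd w (tchart A c))) (snd (fst w) c))"
    by (simp add: connection_map_def Let_def assms)
  then show "connection_map A g w \<in> tspace A p"
    and "snd (connection_map A g w) c =
      snd (snd w (tchart A c)) + levi_civita A g c (cmap c p) (fst (snd w (tchart A c))) (snd (fst w) c)"
    using mk_tvec_in_tspace[OF c] snd_mk_tvec_same[OF c] by simp_all
qed

lemma connection_map_scaled_canonical_field:
  assumes "u \<in> tangent_bundle A" "c = chart_at A (fst u)"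
  shows "snd (connection_map A g (tscale r (canonical_field A u))) c = r *\<^sub>R snd u c"
proof -
  have u: "fst u \<in> carrier A" using assms(1) tspaceD(2) by (simp add: tangent_bundle_iff)
  have c: "c \<in> A" "fst u \<in> cdom c" using chart_at[OF u] by (simp_all add: assms(2))
  note bil = levi_civita_bilinear[OF c(1) imageI[OF c(2)]]
  have "fst (fst (tscale r (canonical_field A u))) = fst u"
    by (simp add: canonical_field_def vertical_lift_in_chart[OF assms(1)])
  from connection_map_in_chart(2)[OF this u assms(2)] show ?thesis
    using vertical_lift_in_chart[OF assms(1), of u] bilinear_lzero[OF bil]
    by (simp add: canonical_field_def assms(2))
qed

text \<open>The mirror map moves the projection of \<open>w\<close> into the vertical space, on which the connection map is
  the identification with the tangent space of the base: the Christoffel symbols see the first component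
  0 only.\<close>
lemma connection_map_mirror:
  assumes "w \<in> tspace (tangent_atlas A) u" "c = chart_at A (fst u)"
  shows "snd (connection_map A g (mirror A w)) c = fst (snd w (tchart A c))"
proof -
  have u: "u \<in> tangent_bundle A" using tspaceD(2)[OF assms(1)] by (simp add: carrier_tangent_atlas)
  have w: "fst w = u" using tspaceD(1)[OF assms(1)] .
  have p: "fst u \<in> carrier A" using u tspaceD(2) by (simp add: tangent_bundle_iff)
  have c: "c \<in> A" "fst u \<in> cdom c" using chart_at[OF p] by (simp_all add: assms(2))
  note bil = levi_civita_bilinear[OF c(1) imageI[OF c(2)]]
  have "fst (fst (mirror A w)) = fst u"
    by (simp add: mirror_def w vertical_lift_in_chart[OF u])
  from connection_map_in_chart(2)[OF this p assms(2)] show ?thesis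
    using vertical_lift_in_chart[OF u, of "tmap (tangent_atlas A) A fst w"] bilinear_lzero[OF bil]
      tmap_projection(2)[OF assms(1) c]
    by (simp add: mirror_def w assms(2))
qed

end

locale oriented_manifold = smooth_manifold_atlas A
  for A :: "('a, real ^ 'k::finite) chart set" +
  assumes oriented: "oriented_atlas A"
begin

text \<open>Transition maps of an oriented atlas have positive determinant, so the sign of the determinant of
  the components of a family may be tested in a single chart.\<close>
lemma det_comp_matrix_change_chart:
  assumes "\<And>j. v j \<in> tspace A p" "c \<in> A" "d \<in> A" "p \<in> cdom c" "p \<in> cdom d"
  shows "\<exists>r>0. det (comp_matrix d v) = r * det (comp_matrix c v)"
proof -
  have "comp_matrix d v = colmat (\<lambda>j. transition c d p (snd (v j) c))"
    using tspaceD(4)[OF assms(1-5)] by (simp add: comp_matrix_eq_colmat)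
  then have "det (comp_matrix d v) = det (matrix (transition c d p)) * det (comp_matrix c v)"
    using det_colmat_linear[OF transition_linear[OF assms(2-5)]] by (simp add: comp_matrix_eq_colmat)
  moreover have "0 < det (matrix (transition c d p))"
    using oriented assms(2-5) unfolding oriented_atlas_def by blast
  ultimately show ?thesis by blast
qed

lemma frame_iff_in_chart:
  assumes "\<And>j. v j \<in> tspace A p" "c \<in> A" "p \<in> cdom c"
  shows "frame A p v \<longleftrightarrow> det (comp_matrix c v) \<noteq> 0"
proof
  assume "frame A p v"
  then show "det (comp_matrix c v) \<noteq> 0" using assms(2,3) by (simp add: frame_def)
next
  assume n: "det (comp_matrix c v) \<noteq> 0"
  have "det (comp_matrix d v) \<noteq> 0" if "d \<in> A" "p \<in> cdom d" for d
    using det_comp_matrix_change_chart[of v, OF assms(1,2) that(1) assms(3) that(2)] n by auto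
  then show "frame A p v" using assms(1) by (simp add: frame_def)
qed

lemma direct_orthonormal_frame_iff_in_chart:
  assumes "\<And>j. v j \<in> tspace A p" "c \<in> A" "p \<in> cdom c"
  shows "direct_orthonormal_frame A g p v \<longleftrightarrow>
    0 < det (comp_matrix c v) \<and> (\<forall>i j. g (v i) (v j) = (if i = j then 1 else 0))"
proof
  assume "direct_orthonormal_frame A g p v"
  then show "0 < det (comp_matrix c v) \<and> (\<forall>i j. g (v i) (v j) = (if i = j then 1 else 0))"
    using assms(2,3) by (simp add: direct_orthonormal_frame_def)
next
  assume n: "0 < det (comp_matrix c v) \<and> (\<forall>i j. g (v i) (v j) = (if i = j then 1 else 0))"
  have "0 < det (comp_matrix d v)" if "d \<in> A" "p \<in> cdom d" for d
    using det_comp_matrix_change_chart[of v, OF assms(1,2) that(1) assms(3) that(2)] n by auto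
  then show "direct_orthonormal_frame A g p v"
    using assms(1) n by (simp add: direct_orthonormal_frame_def)
qed

end

section \<open>Direct orthonormal bases and the shape operator\<close>

lemma det_colmat_orthonormal_nonzero:
  fixes b :: "'k \<Rightarrow> real ^ 'k::finite"
  assumes "inner_form G" and on: "\<And>i j. G (b i) (b j) = (if i = j then 1 else 0)"
  shows "det (colmat b) \<noteq> 0"
proof -
  interpret inner_form G by fact
  have "a = 0" if "colmat b *v a = 0" for a
  proof -
    have "a $ i = 0" for i
    proof -
      have "G (b i) (\<Sum>j\<in>UNIV. a $ j *\<^sub>R b j) = (\<Sum>j\<in>UNIV. a $ j * (if i = j then 1 else 0))"
        by (simp only: linear_sum[OF linear_right] linear_cmul[OF linear_right] on real_scaleR_def)
      also have "\<dots> = a $ i" by (simp add: if_distrib cong: if_cong)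
      finally show ?thesis using that by (simp add: colmat_mult_vec simps)
    qed
    then show ?thesis by (simp add: vec_eq_iff)
  qed
  then have "inj ((*v) (colmat b))" by (subst linear_injective_0) auto
  then show ?thesis by (simp add: det_nonzero_iff_inj)
qed

lemma det_colmat_flip:
  fixes b :: "'k \<Rightarrow> real ^ 'k::finite"
  shows "det (colmat (b(k := - b k))) = - det (colmat b)"
proof -
  have "(\<Prod>j\<in>UNIV. (b(k := - b k)) j $ p j) = - (\<Prod>j\<in>UNIV. b j $ p j)" for p
  proof -
    have "(\<Prod>j\<in>UNIV - {k}. (b(k := - b k)) j $ p j) = (\<Prod>j\<in>UNIV - {k}. b j $ p j)"
      by (rule prod.cong) auto
    then show ?thesis
      using prod.remove[of UNIV k "\<lambda>j. (b(k := - b k)) j $ p j"]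
        prod.remove[of UNIV k "\<lambda>j. b j $ p j"] by simp
  qed
  then show ?thesis by (simp only: det_colmat_sum mult_minus_right sum_negf)
qed

text \<open>Diagonalizing the inner product relative to itself yields an orthonormal basis. Reversing one of
  its vectors corrects the orientation.\<close>
lemma inner_form_direct_orthonormal_basis:
  fixes G :: "real ^ 'k::finite \<Rightarrow> real ^ 'k \<Rightarrow> real"
  assumes "inner_form G"
  shows "\<exists>b :: 'k \<Rightarrow> real ^ 'k. (\<forall>i j. G (b i) (b j) = (if i = j then 1 else 0)) \<and> 0 < det (colmat b)"
proof -
  interpret inner_form G by fact
  obtain b :: "'k \<Rightarrow> real ^ 'k" where b: "\<And>i j. G (b i) (b j) = (if i = j then 1 else 0)"
    using inner_form_diagonalize_symmetric[OF assms bilinear sym] by blast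
  show ?thesis
  proof (cases "0 < det (colmat b)")
    case True
    with b show ?thesis by blast
  next
    case False
    then have "det (colmat b) < 0" using det_colmat_orthonormal_nonzero[OF assms b] by simp
    then have "0 < det (colmat (b(k := - b k)))" for k by (simp add: det_colmat_flip)
    moreover have "G ((b(k := - b k)) i) ((b(k := - b k)) j) = (if i = j then 1 else 0)" for i j k
      by (simp add: simps b)
    ultimately show ?thesis by blast
  qed
qed

text \<open>Here \<open>K\<close> plays the role of the covariant derivative of the unit normal \<open>w\<close>. It takes values in the
  image of \<open>T\<close>, and \<open>- K\<close> pulled back by \<open>T\<close> is self-adjoint for the induced inner product \<open>H\<close>, which
  yields the eigenbasis.\<close>
lemma shape_operator_exists:
  fixes G :: "real ^ ('n::finite option) \<Rightarrow> real ^ ('n option) \<Rightarrow> real"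
  assumes G: "inner_form G" and T: "linear T" "inj T" and w: "is_unit_normal G T w"
    and K: "linear K" "\<And>a. G (K a) w = 0" "\<And>a b. G (K a) (T b) = G (K b) (T a)"
  shows "\<exists>L. linear L \<and> (\<forall>a. T (L a) = - K a) \<and>
    (\<exists>(b :: 'n \<Rightarrow> real ^ 'n) l. det (colmat b) \<noteq> 0 \<and> (\<forall>j. L (b j) = l j *\<^sub>R b j))"
proof -
  interpret inner_form G by fact
  have "G (- K a) w = 0" for a using K(2) by (simp add: simps)
  then have "\<exists>b. - K a = T b" for a by (rule orthogonal_to_normal_in_range[OF G T w])
  then obtain L where L: "\<And>a. T (L a) = - K a" by metis
  have linL: "linear L"
  proof (rule linearI)
    show "L (a + b) = L a + L b" for a b
      by (rule injD[OF T(2)]) (simp add: linear_add[OF T(1)] linear_add[OF K(1)] L)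
    show "L (r *\<^sub>R a) = r *\<^sub>R L a" for r a
      by (rule injD[OF T(2)]) (simp add: linear_cmul[OF T(1)] linear_cmul[OF K(1)] L)
  qed
  define H where "H a b = G (T a) (T b)" for a b
  have H: "inner_form H"
  proof
    show "bilinear H"
      unfolding bilinear_def H_def
      by (intro conjI allI linearI) (simp_all add: linear_add[OF T(1)] linear_cmul[OF T(1)] simps)
    show "H a b = H b a" for a b unfolding H_def by (rule sym)
    show "0 < H a a" if "a \<noteq> 0" for a
    proof -
      have "T a \<noteq> 0" using T that linear_injective_0 by blast
      then show ?thesis unfolding H_def by (rule pos)
    qed
  qed
  interpret H: inner_form H by (rule H)
  define q where "q a b = H (L a) b" for a b
  have "bilinear q"
    unfolding bilinear_def q_def
    by (intro conjI allI linearI) (simp_all add: linear_add[OF linL] linear_cmul[OF linL] H.simps)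
  moreover have "q a b = q b a" for a b
    using K(3)[of a b] by (simp add: q_def H_def L simps)
  ultimately obtain b :: "'n \<Rightarrow> real ^ 'n" and l where b: "\<And>i j. H (b i) (b j) = (if i = j then 1 else 0)"
    and l: "\<And>j z. q (b j) z = l j * H (b j) z"
    using inner_form_diagonalize_symmetric[OF H] by blast
  have "L (b j) = l j *\<^sub>R b j" for j
    by (rule H.eqI) (use l in \<open>simp add: q_def H.simps\<close>)
  moreover have "det (colmat b) \<noteq> 0" by (rule det_colmat_orthonormal_nonzero[OF H b])
  ultimately show ?thesis using linL L by blast
qed

section \<open>The unit normal of an immersed hypersurface\<close>

locale oriented_hypersurface =
  fixes M :: "('a, real ^ ('n::finite option)) chart set" and g :: "('a, real ^ ('n option)) metric"
    and N :: "('b, real ^ 'n) chart set" and h :: "('b, real ^ 'n) metric" and f :: "'b \<Rightarrow> 'a"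
  assumes ambient: "oriented_riemannian_manifold M g"
    and source: "oriented_riemannian_manifold N h"
    and immersion: "isometric_immersion N h M g f"
begin

sublocale M: riemannian_manifold M g
  by unfold_locales (use ambient in \<open>simp_all add: oriented_riemannian_manifold_def smooth_manifold_def\<close>)

sublocale M: oriented_manifold M
  by unfold_locales (use ambient in \<open>simp_all add: oriented_riemannian_manifold_def\<close>)

sublocale N: riemannian_manifold N h
  by unfold_locales (use source in \<open>simp_all add: oriented_riemannian_manifold_def smooth_manifold_def\<close>)

sublocale N: oriented_manifold N
  by unfold_locales (use source in \<open>simp_all add: oriented_riemannian_manifold_def\<close>)

lemma f_carrier: "x \<in> carrier N \<Longrightarrow> f x \<in> carrier M"
  using immersion by (auto simp: isometric_immersion_def smooth_map_def)

lemma f_smooth: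
  assumes "c \<in> N" "d \<in> M"
  shows "open (cmap c ` (cdom c \<inter> f -` cdom d))"
    and "smooth_on (cmap c ` (cdom c \<inter> f -` cdom d)) (cmap d \<circ> f \<circ> cinv c)"
  using immersion assms unfolding isometric_immersion_def smooth_map_def by blast+

lemma f_differentiable: "differentiable_map_at N M f x"
  unfolding differentiable_map_at_def using f_smooth smooth_on_differentiable by blast

abbreviation normal :: "'b \<Rightarrow> ('a, real ^ ('n option)) tvec" where
  "normal \<equiv> unit_normal_lift N h M g f"

end

text \<open>The charts \<open>c\<close> and \<open>d\<close> are arbitrary: differentiability of the lift has to be known in
  all of them before its differential can be computed in chosen ones.\<close>
locale hypersurface_charts = oriented_hypersurface M g N h f
  for M :: "('a, real ^ ('n::finite option)) chart set" and g
    and N :: "('b, real ^ 'n) chart set" and h f +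
  fixes c d
  assumes c: "c \<in> N" and d: "d \<in> M"
begin

definition dom :: "'b set" where "dom = cdom c \<inter> f -` cdom d"

abbreviation df :: "'b \<Rightarrow> real ^ 'n \<Rightarrow> real ^ ('n option)" where
  "df x \<equiv> chart_derivative c d f x"

abbreviation G :: "'b \<Rightarrow> real ^ ('n option) \<Rightarrow> real ^ ('n option) \<Rightarrow> real" where
  "G x \<equiv> local_metric M g d (cmap d (f x))"

lemma domD: "x \<in> dom \<Longrightarrow> x \<in> cdom c" "x \<in> dom \<Longrightarrow> f x \<in> cdom d"
  by (simp_all add: dom_def)

lemma inner_form_G: "x \<in> dom \<Longrightarrow> inner_form (G x)"
  by (rule M.local_inner_form[OF d]) (simp add: domD)

lemma df_linear: "x \<in> dom \<Longrightarrow> linear (df x)"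
  using f_differentiable[of x] c d domD[of x] unfolding differentiable_map_at_def
  by (intro linear_frechet_derivative) blast

lemma tmap_f:
  assumes "x \<in> dom" "v \<in> tspace N x"
  shows "tmap N M f v \<in> tspace M (f x)" "snd (tmap N M f v) d = df x (snd v c)"
  using tmap_in_charts[OF N.differentiable_manifold_axioms M.differentiable_manifold_axioms
      f_differentiable assms(2) c domD(1)[OF assms(1)] d domD(2)[OF assms(1)]] by blast+

lemma metric_df:
  assumes x: "x \<in> dom"
  shows "G x (df x a) (df x b) = local_metric N h c (cmap c x) a b"
proof -
  let ?v = "mk_tvec N x c a" and ?w = "mk_tvec N x c b"
  have v: "?v \<in> tspace N x" "?w \<in> tspace N x"
    using N.mk_tvec_in_tspace[OF c domD(1)[OF x]] by auto
  have xs: "snd ?v c = a" "snd ?w c = b" using N.snd_mk_tvec_same[OF c domD(1)[OF x]] by auto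
  have "x \<in> carrier N" using N.carrierI[OF c domD(1)[OF x]] .
  then have "g (tmap N M f ?v) (tmap N M f ?w) = h ?v ?w"
    using immersion v unfolding isometric_immersion_def by blast
  then show ?thesis
    using M.metric_in_chart[OF tmap_f(1)[OF x v(1)] tmap_f(1)[OF x v(2)] d domD(2)[OF x]]
      N.metric_in_chart[OF v c domD(1)[OF x]] tmap_f(2)[OF x v(1)] tmap_f(2)[OF x v(2)] xs
    by simp
qed

lemma df_inj:
  assumes x: "x \<in> dom"
  shows "inj (df x)"
proof (rule linear_injective_0[OF df_linear[OF x], THEN iffD2], intro allI impI)
  fix a assume a: "df x a = 0"
  interpret G: inner_form "G x" by (rule inner_form_G[OF x])
  interpret H: inner_form "local_metric N h c (cmap c x)"
    by (rule N.local_inner_form[OF c]) (simp add: domD[OF x])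
  have "local_metric N h c (cmap c x) a a = 0"
    using metric_df[OF x, of a a] by (simp add: a G.simps)
  then show "a = 0" by (simp add: H.eq_zero_iff)
qed

lemma det_normal_frame:
  assumes x: "x \<in> dom" and e: "\<And>j. e j \<in> tspace N x"
  shows "det (comp_matrix d (case_option w (\<lambda>j. tmap N M f (e j)))) =
    bordered_det (snd w d) (df x) * det (comp_matrix c e)"
proof -
  have "(\<lambda>j. snd (case_option w (\<lambda>j. tmap N M f (e j)) j) d) =
      case_option (snd w d) (\<lambda>j. df x (snd (e j) c))"
    using tmap_f(2)[OF x e] by (auto simp: fun_eq_iff split: option.split)
  then show ?thesis
    by (simp add: comp_matrix_eq_colmat det_normal_column[OF df_linear[OF x]])
qed

lemma ex_direct_orthonormal_frame:
  assumes x: "x \<in> dom"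
  shows "\<exists>e. direct_orthonormal_frame N h x e"
proof -
  have "inner_form (local_metric N h c (cmap c x))"
    by (rule N.local_inner_form[OF c]) (simp add: domD[OF x])
  from inner_form_direct_orthonormal_basis[OF this] obtain b
    where b: "\<And>i j. local_metric N h c (cmap c x) (b i) (b j) = (if i = j then 1 else 0)"
      "0 < det (colmat b)" by blast
  let ?e = "\<lambda>j. mk_tvec N x c (b j)"
  have e: "?e j \<in> tspace N x" for j by (rule N.mk_tvec_in_tspace[OF c domD(1)[OF x]])
  have s: "snd (?e j) c = b j" for j by (rule N.snd_mk_tvec_same[OF c domD(1)[OF x]])
  have "direct_orthonormal_frame N h x ?e"
    unfolding N.direct_orthonormal_frame_iff_in_chart[OF e c domD(1)[OF x]]
    by (simp only: comp_matrix_eq_colmat s N.metric_in_chart[OF e e c domD(1)[OF x]] b) simp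
  then show ?thesis by blast
qed

text \<open>The orientation condition in the definition of the lift quantifies over all direct orthonormal
  frames \<open>e\<close> of \<open>N\<close>. By \<open>det_normal_frame\<close> it amounts to the sign of \<open>bordered_det\<close> as soon as one
  such frame exists.\<close>
lemma unit_normal_lift_eq:
  assumes x: "x \<in> dom" and w: "is_unit_normal (G x) (df x) w"
  shows "normal x = mk_tvec M (f x) d w"
  unfolding unit_normal_lift_def
proof (rule the_equality)
  note fx = domD(2)[OF x]
  let ?w = "mk_tvec M (f x) d w"
  have wt: "?w \<in> tspace M (f x)" by (rule M.mk_tvec_in_tspace[OF d fx])
  have ws: "snd ?w d = w" by (rule M.snd_mk_tvec_same[OF d fx])
  have ww: "g ?w ?w = 1" using w by (simp add: M.metric_in_chart[OF wt wt d fx] ws is_unit_normal_def)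
  have wn: "g ?w (tmap N M f v) = 0" if "v \<in> tspace N x" for v
    using w unfolding M.metric_in_chart[OF wt tmap_f(1)[OF x that] d fx]
    by (simp add: ws is_unit_normal_def tmap_f(2)[OF x that])
  have wn': "g (tmap N M f v) ?w = 0" if v: "v \<in> tspace N x" for v
    using wn[OF v] inner_form.sym[OF inner_form_G[OF x]]
    unfolding M.metric_in_chart[OF wt tmap_f(1)[OF x v] d fx] M.metric_in_chart[OF tmap_f(1)[OF x v] wt d fx]
    by simp
  have wf: "direct_orthonormal_frame M g (f x) (case_option ?w (\<lambda>j. tmap N M f (e j)))"
    if e: "direct_orthonormal_frame N h x e" for e
  proof -
    have et: "e j \<in> tspace N x" for j using e by (simp add: direct_orthonormal_frame_def)
    have e1: "0 < det (comp_matrix c e)" "\<And>i j. h (e i) (e j) = (if i = j then 1 else 0)"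
      using e unfolding N.direct_orthonormal_frame_iff_in_chart[OF et c domD(1)[OF x]] by blast+
    have t: "case_option ?w (\<lambda>j. tmap N M f (e j)) r \<in> tspace M (f x)" for r
      by (cases r) (simp_all add: wt tmap_f(1)[OF x et])
    have i: "g (tmap N M f (e i)) (tmap N M f (e j)) = (if i = j then 1 else 0)" for i j
      using immersion et[of i] et[of j] e1(2)[of i j] N.carrierI[OF c domD(1)[OF x]]
      unfolding isometric_immersion_def by metis
    show ?thesis
      unfolding M.direct_orthonormal_frame_iff_in_chart[OF t d fx] det_normal_frame[OF x et] ws
    proof (intro conjI allI)
      show "0 < bordered_det w (df x) * det (comp_matrix c e)"
        using w e1(1) by (simp add: is_unit_normal_def)
      fix r s
      show "g (case_option ?w (\<lambda>j. tmap N M f (e j)) r) (case_option ?w (\<lambda>j. tmap N M f (e j)) s) =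
          (if r = s then 1 else 0)"
        by (cases r; cases s) (simp_all add: ww wn[OF et] wn'[OF et] i)
    qed
  qed
  show "?w \<in> tspace M (f x) \<and> g ?w ?w = 1 \<and> (\<forall>v\<in>tspace N x. g ?w (tmap N M f v) = 0) \<and>
    (\<forall>e. direct_orthonormal_frame N h x e \<longrightarrow>
      direct_orthonormal_frame M g (f x) (case_option ?w (\<lambda>j. tmap N M f (e j))))"
    using wt ww wn wf by blast
  fix z
  assume z: "z \<in> tspace M (f x) \<and> g z z = 1 \<and> (\<forall>v\<in>tspace N x. g z (tmap N M f v) = 0) \<and>
    (\<forall>e. direct_orthonormal_frame N h x e \<longrightarrow>
      direct_orthonormal_frame M g (f x) (case_option z (\<lambda>j. tmap N M f (e j))))"
  then have zt: "z \<in> tspace M (f x)" by blast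
  have "is_unit_normal (G x) (df x) (snd z d)"
    unfolding is_unit_normal_def
  proof (intro conjI allI)
    show "G x (snd z d) (snd z d) = 1" using z M.metric_in_chart[OF zt zt d fx] by simp
    show "G x (snd z d) (df x b) = 0" for b
    proof -
      have v: "mk_tvec N x c b \<in> tspace N x" by (rule N.mk_tvec_in_tspace[OF c domD(1)[OF x]])
      then have "g z (tmap N M f (mk_tvec N x c b)) = 0" using z by blast
      then show ?thesis
        using M.metric_in_chart[OF zt tmap_f(1)[OF x v] d fx] tmap_f(2)[OF x v]
          N.snd_mk_tvec_same[OF c domD(1)[OF x]] by simp
    qed
    obtain e where e: "direct_orthonormal_frame N h x e" using ex_direct_orthonormal_frame[OF x] by blast
    then have et: "e j \<in> tspace N x" for j by (simp add: direct_orthonormal_frame_def)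
    have "0 < det (comp_matrix c e)"
      using e unfolding N.direct_orthonormal_frame_iff_in_chart[OF et c domD(1)[OF x]] by blast
    moreover have "0 < det (comp_matrix d (case_option z (\<lambda>j. tmap N M f (e j))))"
      using z e d fx unfolding direct_orthonormal_frame_def by blast
    ultimately show "0 < bordered_det (snd z d) (df x)"
      unfolding det_normal_frame[OF x et] by (simp add: zero_less_mult_iff)
  qed
  then have "snd z d = w"
    by (rule is_unit_normal_unique[OF inner_form_G[OF x] df_linear[OF x] df_inj[OF x] w])
  then show "z = ?w" using M.mk_tvec_snd[OF zt d fx] by simp
qed

lemma normal_in_chart:
  assumes x: "x \<in> dom"
  shows "normal x \<in> tspace M (f x)" and "is_unit_normal (G x) (df x) (snd (normal x) d)"
proof -
  obtain w where w: "is_unit_normal (G x) (df x) w"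
    using is_unit_normal_exists[OF inner_form_G[OF x] df_linear[OF x] df_inj[OF x]] by blast
  show "normal x \<in> tspace M (f x)" and "is_unit_normal (G x) (df x) (snd (normal x) d)"
    using w M.mk_tvec_in_tspace[OF d domD(2)[OF x]] M.snd_mk_tvec_same[OF d domD(2)[OF x]]
    by (simp_all add: unit_normal_lift_eq[OF x w])
qed

end

section \<open>The differential of the lift\<close>

lemma (in oriented_hypersurface) normal_tangent_bundle:
  assumes "x \<in> carrier N"
  shows "normal x \<in> tangent_bundle M" and "fst (normal x) = f x"
proof -
  define c' where "c' = chart_at N x"
  define d' where "d' = chart_at M (f x)"
  interpret H: hypersurface_charts M g N h f c' d'
    by unfold_locales (use chart_at[OF assms] chart_at[OF f_carrier[OF assms]] in \<open>simp_all add: c'_def d'_def\<close>)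
  have "x \<in> H.dom"
    using chart_at[OF assms] chart_at[OF f_carrier[OF assms]] unfolding H.dom_def by (simp add: c'_def d'_def)
  then have "normal x \<in> tspace M (f x)" by (rule H.normal_in_chart(1))
  then show "normal x \<in> tangent_bundle M" "fst (normal x) = f x" by (simp_all add: tspace_def)
qed

context hypersurface_charts
begin

lemma open_dom: "open (cmap c ` dom)"
  unfolding dom_def by (rule f_smooth(1)[OF c d])

abbreviation f_loc :: "real ^ 'n \<Rightarrow> real ^ ('n option)" where
  "f_loc \<equiv> cmap d \<circ> f \<circ> cinv c"

definition normal_loc :: "real ^ 'n \<Rightarrow> real ^ ('n option)" where
  "normal_loc y = snd (normal (cinv c y)) d"

lemma f_loc_smooth: "smooth_on (cmap c ` dom) f_loc"
  unfolding dom_def by (rule f_smooth(2)[OF c d])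

lemma domE:
  assumes "y \<in> cmap c ` dom"
  obtains x where "x \<in> dom" "y = cmap c x" "cinv c y = x" "f_loc y = cmap d (f x)"
    "frechet_derivative f_loc (at y) = df x"
  using assms N.cinv[OF c] domD(1) by auto

lemma f_loc_has_derivative:
  assumes "y \<in> cmap c ` dom"
  shows "(f_loc has_derivative frechet_derivative f_loc (at y)) (at y)"
  using smooth_on_differentiable[OF f_loc_smooth assms] unfolding frechet_derivative_works .

lemma normal_loc_unit_normal:
  assumes "y \<in> cmap c ` dom"
  shows "is_unit_normal (local_metric M g d (f_loc y)) (frechet_derivative f_loc (at y)) (normal_loc y)"
proof -
  from assms obtain x where "x \<in> dom" "cinv c y = x" "f_loc y = cmap d (f x)"
    "frechet_derivative f_loc (at y) = df x" by (rule domE)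
  then show ?thesis using normal_in_chart(2)[of x] unfolding normal_loc_def by metis
qed

lemma normal_loc_differentiable:
  assumes "y \<in> cmap c ` dom"
  shows "normal_loc differentiable (at y)"
proof (rule differentiable_unit_normal[OF open_dom assms, where G = "\<lambda>z. local_metric M g d (f_loc z)"
      and T = "\<lambda>z. frechet_derivative f_loc (at z)"])
  fix z assume "z \<in> cmap c ` dom"
  then obtain x where x: "x \<in> dom" "f_loc z = cmap d (f x)" "frechet_derivative f_loc (at z) = df x"
    by (rule domE)
  show "inner_form (local_metric M g d (f_loc z))" unfolding x(2) by (rule inner_form_G[OF x(1)])
  show "linear (frechet_derivative f_loc (at z))" unfolding x(3) by (rule df_linear[OF x(1)])
  show "inj (frechet_derivative f_loc (at z))" unfolding x(3) by (rule df_inj[OF x(1)])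
next
  from assms obtain x where x: "x \<in> dom" "f_loc y = cmap d (f x)" by (rule domE)
  have "(\<lambda>z. local_metric M g d z a b) differentiable (at (f_loc y))" for a b
    by (rule M.local_metric_differentiable[OF d]) (use x domD in auto)
  then show "(\<lambda>z. local_metric M g d (f_loc z) a b) differentiable (at y)" for a b
    using differentiable_chain_at[OF smooth_on_differentiable[OF f_loc_smooth assms],
        of "\<lambda>z. local_metric M g d z a b"] by (simp add: o_def)
  show "(\<lambda>z. frechet_derivative f_loc (at z) b) differentiable (at y)" for b
    by (rule smooth_on_differentiable[OF smooth_on_directional[OF f_loc_smooth] assms])
qed (rule normal_loc_unit_normal)

text \<open>In charts the lift is \<open>y \<mapsto> (f y, W y)\<close> with \<open>W\<close> the components of the unit normal.\<close>
lemma normal_in_tangent_charts: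
  assumes x: "x \<in> dom"
  shows "open (cmap c ` (cdom c \<inter> normal -` cdom (tchart M d)))"
    and "((cmap (tchart M d) \<circ> normal \<circ> cinv c) has_derivative
      (\<lambda>a. (df x a, frechet_derivative normal_loc (at (cmap c x)) a))) (at (cmap c x))"
proof -
  have xc: "z \<in> carrier N" if "z \<in> cdom c" for z using N.carrierI[OF c that] .
  have eq: "cdom c \<inter> normal -` cdom (tchart M d) = dom"
    using normal_tangent_bundle[OF xc] by (auto simp: dom_def cdom_tchart)
  show "open (cmap c ` (cdom c \<inter> normal -` cdom (tchart M d)))" unfolding eq by (rule open_dom)
  have y: "cmap c x \<in> cmap c ` dom" using x by simp
  have "((\<lambda>y. (f_loc y, normal_loc y)) has_derivative
      (\<lambda>a. (df x a, frechet_derivative normal_loc (at (cmap c x)) a))) (at (cmap c x))"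
    using has_derivative_Pair[OF f_loc_has_derivative[OF y]
        normal_loc_differentiable[OF y, unfolded frechet_derivative_works]] .
  then show "((cmap (tchart M d) \<circ> normal \<circ> cinv c) has_derivative
      (\<lambda>a. (df x a, frechet_derivative normal_loc (at (cmap c x)) a))) (at (cmap c x))"
  proof (rule has_derivative_transform_within_open[OF _ open_dom y])
    fix z assume "z \<in> cmap c ` dom"
    then obtain q where q: "q \<in> dom" "cinv c z = q" by (rule domE)
    have "fst (normal q) = f q" by (rule normal_tangent_bundle(2)[OF xc[OF domD(1)[OF q(1)]]])
    then show "(f_loc z, normal_loc z) = (cmap (tchart M d) \<circ> normal \<circ> cinv c) z"
      by (simp add: cmap_tchart normal_loc_def q)
  qed
qed

end

context oriented_hypersurface
begin

lemma normal_differentiable: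
  assumes "x \<in> carrier N"
  shows "differentiable_map_at N (tangent_atlas M) normal x"
  unfolding differentiable_map_at_def
proof (intro ballI impI)
  fix c D assume c: "c \<in> N" and "D \<in> tangent_atlas M" and xc: "x \<in> cdom c" and nD: "normal x \<in> cdom D"
  then obtain d where dM: "d \<in> M" "D = tchart M d" by (auto simp: tangent_atlas_def)
  interpret hypersurface_charts M g N h f c d
    by unfold_locales (use c dM in auto)
  have "x \<in> dom"
    using xc nD normal_tangent_bundle(2)[OF assms] unfolding dM(2) cdom_tchart dom_def by simp
  from normal_in_tangent_charts[OF this] show "open (cmap c ` (cdom c \<inter> normal -` cdom D)) \<and>
      (cmap D \<circ> normal \<circ> cinv c) differentiable (at (cmap c x))"
    unfolding dM(2) by (blast intro: differentiableI)
qed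

end

text \<open>From now on the charts are the ones that the definitions of volume forms, Christoffel symbols and
  the connection map select.\<close>
locale hypersurface_at = oriented_hypersurface M g N h f
  for M :: "('a, real ^ ('n::finite option)) chart set" and g
    and N :: "('b, real ^ 'n) chart set" and h f +
  fixes x
  assumes x_carrier: "x \<in> carrier N"
begin

definition c where "c = chart_at N x"
definition d where "d = chart_at M (f x)"

lemma c_chart: "c \<in> N" "x \<in> cdom c"
  unfolding c_def using chart_at[OF x_carrier] .

lemma d_chart: "d \<in> M" "f x \<in> cdom d"
  unfolding d_def using chart_at[OF f_carrier[OF x_carrier]] .

sublocale hypersurface_charts M g N h f c d
  by unfold_locales (rule c_chart d_chart)+

lemma x_dom: "x \<in> dom"
  using c_chart d_chart by (simp add: dom_def)

abbreviation w where "w \<equiv> snd (normal x) d"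

abbreviation \<Gamma> where "\<Gamma> \<equiv> levi_civita M g d (cmap d (f x))"

definition nabla_normal :: "real ^ 'n \<Rightarrow> real ^ ('n option)" where
  "nabla_normal a = frechet_derivative normal_loc (at (cmap c x)) a + \<Gamma> (df x a) w"

text \<open>The first component is the projection to \<open>TM\<close>; the second becomes the covariant derivative of the
  normal once the Christoffel term is added.\<close>
lemma tmap_normal:
  assumes "v \<in> tspace N x"
  shows "tmap N (tangent_atlas M) normal v \<in> tspace (tangent_atlas M) (normal x)"
    and "snd (tmap N (tangent_atlas M) normal v) (tchart M d) =
      (df x (snd v c), frechet_derivative normal_loc (at (cmap c x)) (snd v c))"
proof -
  have n: "normal x \<in> cdom (tchart M d)"
    using normal_tangent_bundle[OF x_carrier] d_chart by (simp add: cdom_tchart)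
  note * = tmap_in_charts[OF N.differentiable_manifold_axioms M.TM.differentiable_manifold_axioms
      normal_differentiable[OF x_carrier] assms c_chart M.tchart_in_atlas[OF d_chart(1)] n]
  show "tmap N (tangent_atlas M) normal v \<in> tspace (tangent_atlas M) (normal x)" by (rule *(1))
  show "snd (tmap N (tangent_atlas M) normal v) (tchart M d) =
      (df x (snd v c), frechet_derivative normal_loc (at (cmap c x)) (snd v c))"
    unfolding *(2) frechet_derivative_at[OF normal_in_tangent_charts(2)[OF x_dom], symmetric] by (rule refl)
qed

lemma chart_at_normal: "d = chart_at M (fst (normal x))"
  by (simp add: d_def normal_tangent_bundle(2)[OF x_carrier])

lemma connection_map_tmap_normal:
  assumes "v \<in> tspace N x"
  shows "connection_map M g (tmap N (tangent_atlas M) normal v) \<in> tspace M (f x)"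
    and "snd (connection_map M g (tmap N (tangent_atlas M) normal v)) d = nabla_normal (snd v c)"
proof -
  have 1: "fst (tmap N (tangent_atlas M) normal v) = normal x"
    using tspaceD(1)[OF tmap_normal(1)[OF assms]] .
  then have 2: "fst (fst (tmap N (tangent_atlas M) normal v)) = f x"
    by (simp only: normal_tangent_bundle(2)[OF x_carrier])
  note * = M.connection_map_in_chart[OF 2 f_carrier[OF x_carrier] d_def]
  show "connection_map M g (tmap N (tangent_atlas M) normal v) \<in> tspace M (f x)" by (rule *(1))
  show "snd (connection_map M g (tmap N (tangent_atlas M) normal v)) d = nabla_normal (snd v c)"
    unfolding *(2) tmap_normal(2)[OF assms] 1 by (simp add: nabla_normal_def)
qed

lemma nabla_normal:
  shows "G x (nabla_normal a) w = 0"
    and "G x (nabla_normal a) (df x b) = G x (nabla_normal b) (df x a)"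
    and "linear nabla_normal"
proof -
  let ?y = "cmap c x"
  have y: "?y \<in> cmap c ` dom" using x_dom by simp
  have yd: "cmap d (f x) \<in> cmap d ` cdom d" using d_chart by simp
  interpret L: local_inner_form "local_metric M g d" "cmap d ` cdom d" "cmap d (f x)"
    by (rule M.local_inner_form_field[OF d_chart(1) yd])
  have wl: "normal_loc ?y = w" using N.cinv[OF c_chart] by (simp add: normal_loc_def)
  have V: "f_loc z \<in> cmap d ` cdom d" if z: "z \<in> cmap c ` dom" for z
    using z by (rule domE) (use domD in auto)
  have Fx: "f_loc ?y = cmap d (f x)" using N.cinv[OF c_chart] by simp
  have F'': "((\<lambda>z. frechet_derivative f_loc (at z) b) has_derivative
      frechet_derivative (\<lambda>z. frechet_derivative f_loc (at z) b) (at ?y)) (at ?y)" for b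
    using smooth_on_differentiable[OF smooth_on_directional[OF f_loc_smooth] y]
    unfolding frechet_derivative_works .
  have unit: "local_metric M g d (f_loc z) (normal_loc z) (normal_loc z) = 1"
    and nrm: "local_metric M g d (f_loc z) (normal_loc z) (frechet_derivative f_loc (at z) b) = 0"
    if "z \<in> cmap c ` dom" for z b
    using normal_loc_unit_normal[OF that] unfolding is_unit_normal_def by blast+
  note * = L.covariant_derivative_of_unit_normal[where F = f_loc and W = normal_loc and
      F' = "\<lambda>z. frechet_derivative f_loc (at z)" and V = "cmap c ` dom" and x = ?y,
      OF M.levi_civita_christoffel_form[OF d_chart(1) yd] open_dom y V Fx f_loc_has_derivative F''
        normal_loc_differentiable[OF y, unfolded frechet_derivative_works] unit nrm, unfolded wl]
  show "G x (nabla_normal a) w = 0" unfolding nabla_normal_def by (rule *(1))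
  show "G x (nabla_normal a) (df x b) = G x (nabla_normal b) (df x a)"
    unfolding nabla_normal_def by (rule *(2))
  show "linear nabla_normal" unfolding nabla_normal_def[abs_def] by (rule *(3))
qed

abbreviation shape where "shape \<equiv> second_fundamental_form N h M g f"

text \<open>The operator \<open>L\<close> represents the second fundamental form in the chart \<open>c\<close>: the tangent vector in its
  definition exists because the covariant derivative of the normal is tangential, and it is unique because
  \<open>f\<close> is an immersion.\<close>
lemma shape_in_chart:
  shows "\<exists>L. linear L \<and> (\<forall>a. df x (L a) = - nabla_normal a) \<and>
    (\<exists>(b :: 'n \<Rightarrow> real ^ 'n) l. det (colmat b) \<noteq> 0 \<and> (\<forall>j. L (b j) = l j *\<^sub>R b j)) \<and>
    (\<forall>v\<in>tspace N x. shape v \<in> tspace N x \<and> snd (shape v) c = L (snd v c))"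
proof -
  obtain L and b :: "'n \<Rightarrow> real ^ 'n" and l where L: "linear L" "\<And>a. df x (L a) = - nabla_normal a"
    and b: "det (colmat b) \<noteq> 0" "\<And>j. L (b j) = l j *\<^sub>R b j"
    using shape_operator_exists[OF inner_form_G[OF x_dom] df_linear[OF x_dom] df_inj[OF x_dom]
        normal_in_chart(2)[OF x_dom] nabla_normal(3,1,2)] by blast
  have sh: "shape v = mk_tvec N x c (L (snd v c))" if v: "v \<in> tspace N x" for v
    unfolding second_fundamental_form_def
  proof (rule the_equality)
    let ?a = "mk_tvec N x c (L (snd v c))"
    let ?K = "connection_map M g (tmap N (tangent_atlas M) normal v)"
    have fv: "fst v = x" by (rule tspaceD(1)[OF v])
    have a: "?a \<in> tspace N x" by (rule N.mk_tvec_in_tspace[OF c_chart])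
    have Kt: "tscale (-1) ?K \<in> tspace M (f x)"
      by (rule M.tscale_in_tspace[OF connection_map_tmap_normal(1)[OF v]])
    have "tmap N M f ?a = tscale (-1) ?K"
      by (rule tspace_eqI[OF tmap_f(1)[OF x_dom a] Kt d_chart])
        (simp add: tmap_f(2)[OF x_dom a] N.snd_mk_tvec_same[OF c_chart] L
          connection_map_tmap_normal(2)[OF v])
    then show "?a \<in> tspace N (fst v) \<and> tmap N M f ?a = tscale (-1) ?K" using a fv by simp
    fix z assume z: "z \<in> tspace N (fst v) \<and> tmap N M f z = tscale (-1) ?K"
    then have zt: "z \<in> tspace N x" using fv by simp
    have "df x (snd z c) = df x (L (snd v c))"
      using tmap_f(2)[OF x_dom zt] z by (simp add: L connection_map_tmap_normal(2)[OF v])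
    then have "snd z c = L (snd v c)" using df_inj[OF x_dom] by (simp add: inj_eq)
    then show "z = ?a" using N.mk_tvec_snd[OF zt c_chart] by simp
  qed
  have "shape v \<in> tspace N x \<and> snd (shape v) c = L (snd v c)" if v: "v \<in> tspace N x" for v
    unfolding sh[OF v] using N.mk_tvec_in_tspace[OF c_chart] N.snd_mk_tvec_same[OF c_chart] by blast
  with L b show ?thesis by blast
qed

text \<open>The list of eigenvalues is selected arbitrarily among the possible ones. It is replaced by a basis
  that realizes exactly this list, which may differ from \<open>b\<close> and \<open>l\<close>.\<close>
lemma elem_sym_eigenvalues_in_chart:
  assumes L: "\<And>v. v \<in> tspace N x \<Longrightarrow> shape v \<in> tspace N x \<and> snd (shape v) c = L (snd v c)"
    and b: "det (colmat b) \<noteq> 0" "\<And>j. L (b j) = l j *\<^sub>R b j"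
  shows "\<exists>\<beta> \<mu>. det (colmat \<beta>) \<noteq> 0 \<and> (\<forall>j. L (\<beta> j) = \<mu> j *\<^sub>R \<beta> j) \<and>
    (\<forall>i. elem_sym_eigenvalues N x shape i = elem_sym i \<mu>)"
proof -
  let ?b = "\<lambda>j. mk_tvec N x c (b j)"
  have bt: "?b j \<in> tspace N x" for j by (rule N.mk_tvec_in_tspace[OF c_chart])
  have bs: "snd (?b j) c = b j" for j by (rule N.snd_mk_tvec_same[OF c_chart])
  have "eigenvalue_list N x shape l"
    unfolding eigenvalue_list_def
  proof (intro exI conjI allI)
    show "frame N x ?b"
      unfolding N.frame_iff_in_chart[of ?b, OF bt c_chart] using b(1) by (simp add: comp_matrix_eq_colmat bs)
    show "shape (?b j) = tscale (l j) (?b j)" for j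
      by (rule tspace_eqI[OF conjunct1[OF L[OF bt]] N.tscale_in_tspace[OF bt] c_chart])
        (simp add: L[OF bt] bs b(2))
  qed
  then have "eigenvalue_list N x shape (SOME l. eigenvalue_list N x shape l)"
    by (rule someI[of "eigenvalue_list N x shape"])
  then obtain e where e: "frame N x e"
    and ev: "\<And>j. shape (e j) = tscale ((SOME l. eigenvalue_list N x shape l) j) (e j)"
    unfolding eigenvalue_list_def by blast
  have et: "e j \<in> tspace N x" for j using e by (simp add: frame_def)
  have "det (colmat (\<lambda>j. snd (e j) c)) \<noteq> 0"
    using e unfolding N.frame_iff_in_chart[of e, OF et c_chart] comp_matrix_eq_colmat .
  moreover have "L (snd (e j) c) = (SOME l. eigenvalue_list N x shape l) j *\<^sub>R snd (e j) c" for j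
    using L[OF et, of j] unfolding ev by simp
  ultimately show ?thesis unfolding elem_sym_eigenvalues_def by blast
qed

text \<open>Contracting the volume form of \<open>M\<close> with the unit normal gives that of \<open>N\<close>: a direct orthonormal
  frame \<open>b\<close> of \<open>N\<close> together with the normal is a direct orthonormal frame of \<open>M\<close>, and both volume forms
  are 1 on these frames.\<close>
lemma vol_normal_frame:
  "sqrt (det (gram (G x))) * bordered_det w (df x) = sqrt (det (gram (local_metric N h c (cmap c x))))"
proof -
  let ?H = "local_metric N h c (cmap c x)"
  have H: "inner_form ?H" by (rule N.local_inner_form[OF c_chart(1)]) (simp add: c_chart)
  obtain b where b0: "(\<forall>i j. ?H (b i) (b j) = (if i = j then 1 else 0)) \<and> 0 < det (colmat b)"
    by (rule exE[OF inner_form_direct_orthonormal_basis[OF H]])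
  then have b: "?H (b i) (b j) = (if i = j then 1 else 0)" and db: "0 < det (colmat b)" for i j by simp_all
  interpret inner_form "G x" by (rule inner_form_G[OF x_dom])
  let ?u = "case_option w (\<lambda>j. df x (b j))"
  have n: "G x w w = 1" "G x w (df x a) = 0" "0 < bordered_det w (df x)" for a
    using normal_in_chart(2)[OF x_dom] unfolding is_unit_normal_def by blast+
  have n': "G x (df x a) w = 0" for a using sym[of "df x a" w] n(2) by simp
  have "G x (?u r) (?u s) = (if r = s then 1 else 0)" for r s
    by (cases r; cases s) (simp_all add: n n' metric_df[OF x_dom] b)
  moreover have "0 < det (colmat ?u)"
    unfolding det_normal_column[OF df_linear[OF x_dom]] using n(3) db by simp
  ultimately have "sqrt (det (gram (G x))) * det (colmat ?u) = 1"
    by (rule gram_vol_orthonormal[OF inner_form_G[OF x_dom]])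
  moreover have "sqrt (det (gram ?H)) * det (colmat b) = 1" by (rule gram_vol_orthonormal[OF H b db])
  ultimately have "(sqrt (det (gram (G x))) * bordered_det w (df x)) * det (colmat b) =
      sqrt (det (gram ?H)) * det (colmat b)"
    unfolding det_normal_column[OF df_linear[OF x_dom]] by (simp add: mult.assoc)
  then show ?thesis using db by simp
qed

text \<open>The slots with \<open>P\<close> carry mirrored vectors, the others the vertical parts \<open>- T (L v)\<close>.\<close>
lemma alpha_top_normal:
  assumes v: "\<And>j. v j \<in> tspace N x"
    and L: "\<And>a. df x (L a) = - nabla_normal a"
  shows "alpha_top M g (normal x) (\<lambda>j. if P j
      then mirror M (tmap N (tangent_atlas M) normal (v j)) else tmap N (tangent_atlas M) normal (v j)) =
    sqrt (det (gram (local_metric N h c (cmap c x)))) *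
      det (colmat (\<lambda>j. if P j then snd (v j) c else - L (snd (v j) c)))"
    (is "alpha_top M g _ ?W = _")
proof -
  note nb = normal_tangent_bundle[OF x_carrier]
  have "g (normal x) (normal x) = 1"
    using normal_in_chart[OF x_dom] M.metric_in_chart[OF _ _ d_chart]
    unfolding is_unit_normal_def by simp
  then have 1: "snd (connection_map M g (tscale (1 / sqrt (g (normal x) (normal x)))
      (canonical_field M (normal x)))) d = w"
    using M.connection_map_scaled_canonical_field[OF nb(1) chart_at_normal] by simp
  have 2: "snd (connection_map M g (?W j)) d = df x (if P j then snd (v j) c else - L (snd (v j) c))" for j
  proof (cases "P j")
    case True
    have "snd (connection_map M g (mirror M (tmap N (tangent_atlas M) normal (v j)))) d = df x (snd (v j) c)"
      unfolding M.connection_map_mirror[OF tmap_normal(1)[OF v] chart_at_normal] tmap_normal(2)[OF v]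
      by simp
    with True show ?thesis by simp
  next
    case False
    have "df x (- L (snd (v j) c)) = nabla_normal (snd (v j) c)"
      by (simp only: linear_neg[OF df_linear[OF x_dom]] L minus_minus)
    with False show ?thesis using connection_map_tmap_normal(2)[OF v] by simp
  qed
  let ?z = "case_option (tscale (1 / sqrt (g (normal x) (normal x))) (canonical_field M (normal x))) ?W"
  have "(\<lambda>j. snd (connection_map M g (?z j)) d) =
      case_option w (\<lambda>j. df x (if P j then snd (v j) c else - L (snd (v j) c)))"
    using 1 2 by (auto simp: fun_eq_iff split: option.split)
  then have "alpha_top M g (normal x) ?W = sqrt (det (gram (G x))) *
      det (colmat (case_option w (\<lambda>j. df x (if P j then snd (v j) c else - L (snd (v j) c)))))"
    unfolding alpha_top_def vertical_vol_def vol_def nb(2) d_def[symmetric] Let_def comp_matrix_eq_colmat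
      gram_def by simp
  also have "\<dots> = (sqrt (det (gram (G x))) * bordered_det w (df x)) *
      det (colmat (\<lambda>j. if P j then snd (v j) c else - L (snd (v j) c)))"
    unfolding det_normal_column[OF df_linear[OF x_dom]] by (simp only: mult.assoc)
  finally show ?thesis unfolding vol_normal_frame .
qed

end

theorem proposition3p1:
  fixes M :: "('a, real ^ ('n::{finite,linorder} option)) chart set"
    and g :: "('a, real ^ ('n option)) metric"
    and N :: "('b, real ^ ('n::{finite,linorder})) chart set"
    and h :: "('b, real ^ ('n::{finite,linorder})) metric"
    and f :: "'b \<Rightarrow> 'a"
    and i :: nat
    and x :: 'b
    and v :: "'n \<Rightarrow> ('b, real ^ ('n::{finite,linorder})) tvec"
  assumes "oriented_riemannian_manifold M g"
    and "oriented_riemannian_manifold N h"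
    and "compact_space (mtopology N)"
    and "isometric_immersion N h M g f"
    and "i \<le> CARD('n)"
    and "x \<in> carrier N"
    and "\<And>j. v j \<in> tspace N x"
  shows "pullback N (tangent_atlas M) (unit_normal_lift N h M g f) (alpha M g i) x v =
    (- 1) ^ i * elem_sym_eigenvalues N x (second_fundamental_form N h M g f) i * vol N h x v"
proof -
  interpret hypersurface_at M g N h f x
    by unfold_locales (use assms in auto)
  obtain L b l where L: "linear L" "\<And>a. df x (L a) = - nabla_normal a"
    and b: "det (colmat b) \<noteq> 0" "\<And>j. L (b j) = l j *\<^sub>R b j"
    and sh: "\<And>v. v \<in> tspace N x \<Longrightarrow> shape v \<in> tspace N x \<and> snd (shape v) c = L (snd v c)"
    using shape_in_chart by blast
  obtain \<beta> \<mu> where \<beta>: "det (colmat \<beta>) \<noteq> 0" "\<And>j. L (\<beta> j) = \<mu> j *\<^sub>R \<beta> j"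
    and es: "elem_sym_eigenvalues N x shape i = elem_sym i \<mu>"
    using elem_sym_eigenvalues_in_chart[OF sh b] by blast
  \<comment> \<open>The slots, \<open>i\<close> in number, that are not mirrored.\<close>
  let ?J = "{j :: 'n. \<not> card {k. k < j} < CARD('n) - i}"
  have "?J = - {j :: 'n. card {k. k < j} < CARD('n) - i}" by auto
  then have J: "card ?J = i"
    using card_rank_less[where 'n = 'n, of "CARD('n) - i"] assms(5)
    by (simp add: Compl_eq_Diff_UNIV card_Diff_subset)
  define V where "V j = snd (v j) c" for j
  define H where "H = sqrt (det (gram (local_metric N h c (cmap c x))))"
  have at: "alpha_top M g (normal x) (\<lambda>j. if card {k. k < j} < CARD('n) - i
      then mirror M (tmap N (tangent_atlas M) normal (v (\<sigma> j))) else tmap N (tangent_atlas M) normal (v (\<sigma> j))) =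
    H * det (colmat (\<lambda>j. if j \<in> ?J then - L (V (\<sigma> j)) else V (\<sigma> j)))" for \<sigma>
  proof -
    have eq: "(\<lambda>j. if card {k. k < j} < CARD('n) - i then V (\<sigma> j) else - L (V (\<sigma> j))) =
        (\<lambda>j. if j \<in> ?J then - L (V (\<sigma> j)) else V (\<sigma> j))"
      by auto
    show ?thesis
      unfolding eq[symmetric] unfolding V_def H_def by (rule alpha_top_normal[OF assms(7) L(2)])
  qed
  have "(\<Sum>\<sigma> | \<sigma> permutes UNIV. of_int (sign \<sigma>) *
      det (colmat (\<lambda>j. if j \<in> ?J then - L (V (\<sigma> j)) else V (\<sigma> j)))) =
    fact (card ?J) * fact (CARD('n) - card ?J) * elem_sym (card ?J) (\<lambda>j. - \<mu> j) * det (colmat V)"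
    by (rule sum_sign_det_mixed_eigenbasis[OF linear_compose_neg[OF L(1)] \<beta>(1)]) (simp add: \<beta>(2))
  then have sum: "(\<Sum>\<sigma> | \<sigma> permutes UNIV. of_int (sign \<sigma>) *
      (H * det (colmat (\<lambda>j. if j \<in> ?J then - L (V (\<sigma> j)) else V (\<sigma> j))))) =
    H * (fact i * fact (CARD('n) - i) * ((- 1) ^ i * elem_sym i \<mu>) * det (colmat V))"
    unfolding J elem_sym_uminus mult.left_commute[of _ H] sum_distrib_left[symmetric] by simp
  have "pullback N (tangent_atlas M) normal (alpha M g i) x v =
      1 / (fact i * fact (CARD('n) - i)) *
      (H * (fact i * fact (CARD('n) - i) * ((- 1) ^ i * elem_sym i \<mu>) * det (colmat V)))"
    unfolding pullback_def alpha_def at sum ..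
  also have "\<dots> = (- 1) ^ i * elem_sym i \<mu> * (H * det (colmat V))" by simp
  also have "H * det (colmat V) = vol N h x v"
    by (simp add: vol_def Let_def c_def[symmetric] H_def gram_def comp_matrix_eq_colmat V_def[abs_def])
  finally show ?thesis unfolding es .
qed
end
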